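(* Let $N\ge3$, $R>0$, and let $B_R\subset\mathbb{R}^N$ be the ball of radius $R$ centered at the origin. For a radial function $v$ on $B_R$ define the radial function $w$ on $\mathbb{R}^N$ by $$v(|x|)=w(t),\qquad t=\Big(-\log\Big(\frac{|x|}{R}\Big)\Big)^{-\frac{1}{N-2}} .$$ Then $v\in\widetilde{\mathcal H}_r(B_R)$ if and only if $w\in\mathcal{D}^{1,2}_r(\mathbb{R}^N)$, and $$\|v\|^2_{\widetilde{\mathcal H}_r(B_R)}=(N-2)^{-1}\,\|w\|^2_{\mathcal{D}^{1,2}_r(\mathbb{R}^N)} .$$
   Context: $\widetilde{\mathcal H}(B_R)$ is the completion of $C_0^\infty(B_R)$ under $\|v\|^2=\int_{B_R}|x|^{-(N-2)}|\nabla v|^2dx$. $\mathcal{D}^{1,2}(\mathbb{R}^N)$ is the closure of $C_0^\infty(\mathbb{R}^N)$ under $\|\phi\|^2=\int_{\mathbb{R}^N}|\nabla\phi|^2dx$. $\widetilde{\mathcal H}_r(B_R)$ and $\mathcal{D}^{1,2}_r(\mathbb{R}^N)$ are the corresponding subspaces of radial functions, with the same norms. A radial function is identified with its profile as a function of the radius; $t\in(0,\infty)$ is the radial variable of $w$. *)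

theory Defs
  imports "HOL-Analysis.Analysis"
begin

definition grad :: "('a::euclidean_space \<Rightarrow> real) \<Rightarrow> 'a \<Rightarrow> 'a" where
  "grad f x = (THE D. GDERIV f x :> D)"

primrec C_k :: "nat \<Rightarrow> ('a::euclidean_space \<Rightarrow> real) \<Rightarrow> bool" where
  "C_k 0 f \<longleftrightarrow> continuous_on UNIV f"
| "C_k (Suc k) f \<longleftrightarrow>
     (\<forall>x. f differentiable (at x)) \<and> (\<forall>b\<in>Basis. C_k k (\<lambda>x. grad f x \<bullet> b))"

text \<open>
  \<open>C\<^sub>0\<^sup>\<infinity>(\<Omega>)\<close> for open \<open>\<Omega>\<close>; its elements are extended by zero, hence smooth on the whole space.
\<close>

definition test_functions :: "'a::euclidean_space set \<Rightarrow> ('a \<Rightarrow> real) set" where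
  "test_functions \<Omega> =
     {\<phi>. (\<forall>k. C_k k \<phi>) \<and> compact (closure {x. \<phi> x \<noteq> 0}) \<and> closure {x. \<phi> x \<noteq> 0} \<subseteq> \<Omega>}"

definition dirichlet_norm ::
  "('a::euclidean_space \<Rightarrow> real) \<Rightarrow> 'a set \<Rightarrow> ('a \<Rightarrow> real) \<Rightarrow> real" where
  "dirichlet_norm \<rho> \<Omega> \<phi> = sqrt (LINT x:\<Omega>|lebesgue. \<rho> x * (norm (grad \<phi> x))\<^sup>2)"

text \<open>
  The completion of \<open>C\<^sub>0\<^sup>\<infinity>(\<Omega>)\<close> under \<open>dirichlet_norm \<rho> \<Omega>\<close>, realised as a space of functions: its
  elements are classes of Cauchy sequences, and the class of \<open>\<phi>\<close> is identified with the limit of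
  \<open>\<phi>\<close> in \<open>L\<^sup>1\<^sub>l\<^sub>o\<^sub>c(\<Omega>)\<close>. For the two weights below and dimension at least 3, the Poincare
  inequality on the ball (the weight is bounded below there) and the Sobolev inequality on the
  whole space show that every Cauchy sequence has such a limit and that sequences with the same
  limit are equivalent. Functions equal almost everywhere on \<open>\<Omega>\<close> represent the same element.
\<close>

definition represents ::
  "('a::euclidean_space \<Rightarrow> real) \<Rightarrow> 'a set \<Rightarrow> (nat \<Rightarrow> 'a \<Rightarrow> real) \<Rightarrow> ('a \<Rightarrow> real) \<Rightarrow> bool" where
  "represents \<rho> \<Omega> \<phi> v \<longleftrightarrow>
     (\<forall>n. \<phi> n \<in> test_functions \<Omega>) \<and>
     (\<forall>e>0. \<exists>M. \<forall>m\<ge>M. \<forall>n\<ge>M. dirichlet_norm \<rho> \<Omega> (\<lambda>x. \<phi> m x - \<phi> n x) < e) \<and>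
     (\<forall>K. compact K \<and> K \<subseteq> \<Omega> \<longrightarrow>
        set_integrable lebesgue K v \<and>
        (\<lambda>n. LINT x:K|lebesgue. \<bar>\<phi> n x - v x\<bar>) \<longlonglongrightarrow> 0)"

definition completion ::
  "('a::euclidean_space \<Rightarrow> real) \<Rightarrow> 'a set \<Rightarrow> ('a \<Rightarrow> real) set" where
  "completion \<rho> \<Omega> = {v. \<exists>\<phi>. represents \<rho> \<Omega> \<phi> v}"

text \<open>
  The extension of \<open>dirichlet_norm\<close> by continuity; it is meaningful on \<open>completion \<rho> \<Omega>\<close> only.
\<close>

definition completion_norm ::
  "('a::euclidean_space \<Rightarrow> real) \<Rightarrow> 'a set \<Rightarrow> ('a \<Rightarrow> real) \<Rightarrow> real" where
  "completion_norm \<rho> \<Omega> v =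
     (THE l. \<exists>\<phi>. represents \<rho> \<Omega> \<phi> v \<and> (\<lambda>n. dirichlet_norm \<rho> \<Omega> (\<phi> n)) \<longlonglongrightarrow> l)"

definition has_profile_on :: "'a::euclidean_space set \<Rightarrow> ('a \<Rightarrow> real) \<Rightarrow> (real \<Rightarrow> real) \<Rightarrow> bool" where
  "has_profile_on \<Omega> v f \<longleftrightarrow> (AE x in lebesgue. x \<in> \<Omega> \<longrightarrow> v x = f (norm x))"

definition radial_on :: "'a::euclidean_space set \<Rightarrow> ('a \<Rightarrow> real) \<Rightarrow> bool" where
  "radial_on \<Omega> v \<longleftrightarrow> (\<exists>f. has_profile_on \<Omega> v f)"

definition H_weight :: "'a::euclidean_space \<Rightarrow> real" where
  "H_weight x = norm x powr (- (real DIM('a) - 2))"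

definition H_rad :: "real \<Rightarrow> ('a::euclidean_space \<Rightarrow> real) set" where
  "H_rad R = {v \<in> completion H_weight (ball 0 R). radial_on (ball 0 R) v}"

definition H_norm :: "real \<Rightarrow> ('a::euclidean_space \<Rightarrow> real) \<Rightarrow> real" where
  "H_norm R = completion_norm H_weight (ball 0 R)"

definition D12_rad :: "('a::euclidean_space \<Rightarrow> real) set" where
  "D12_rad = {w \<in> completion (\<lambda>_. 1) UNIV. radial_on UNIV w}"

definition D12_norm :: "('a::euclidean_space \<Rightarrow> real) \<Rightarrow> real" where
  "D12_norm = completion_norm (\<lambda>_. 1) UNIV"

end

theory Submission
  imports Defs
begin

text \<open>
  In the right radial variable both spaces are the same one-dimensional space. Write a radial weight
  \<open>\<rho>\<close> on \<open>\<Omega>\<close> by means of a decreasing parametrisation \<open>r = r(s)\<close>, \<open>0 < s < \<infinity>\<close>, of the radii such that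
  \<open>\<rho>(x) |x|\<^sup>N\<^sup>-\<^sup>1 = - \<kappa> r'(s)\<close> whenever \<open>|x| = r(s)\<close>. In polar coordinates the weighted Dirichlet
  integral of \<open>x \<mapsto> u(s(|x|))\<close> becomes \<open>c \<kappa> \<integral> u'(s)\<^sup>2 ds\<close> over the half-line, where \<open>c\<close> depends on the
  dimension only. The weight \<open>|x|\<^sup>2\<^sup>-\<^sup>N\<close> on the ball has \<open>s = - log (|x| / R)\<close> and \<open>\<kappa> = 1\<close>; the weight 1 on
  the whole space has \<open>s = |x|\<^sup>2\<^sup>-\<^sup>N\<close> and \<open>\<kappa> = N - 2\<close>. The relation between \<open>v\<close> and \<open>w\<close> says precisely
  that both have the same profile \<open>u\<close> in the variable \<open>s\<close>, so only the factor \<open>\<kappa>\<close> tells the two norms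
  apart.

  It remains to describe membership in the abstract completion, and its norm, by \<open>u\<close> alone. This is
  lemma \<open>completion_iff_approximates\<close> in the locale \<open>radial_weight\<close>: a radial function lies in the
  completion iff there are profiles \<open>U n\<close> vanishing near \<open>s = 0\<close> whose derivatives form a Cauchy
  sequence in \<open>L\<^sup>2(0,\<infinity>)\<close> and which tend to \<open>u\<close> almost everywhere. It rests on three facts.

  From functions to profiles (\<open>represents_imp_approximates\<close>): the test functions that approximate a
  radial function need not be radial, so they are replaced by their spherical means. By Jensen's
  inequality this does not increase the energy, and since the limit is radial, the means still tend
  to it, by Fatou's lemma along rays.

  From profiles to functions (\<open>radial_test_density\<close>, \<open>radial_test_represents\<close>): a profile with
  square-integrable derivative is approximated in energy by profiles of radial test functions. A
  profile vanishing near \<open>s = 0\<close> satisfies \<open>|u(s)| \<le> (1 + s) \<parallel>u'\<parallel>\<close>, and \<open>s(|x|)\<close> is locally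
  integrable, so convergence in energy implies convergence in \<open>L\<^sup>1\<close> on compact sets, also near the
  origin, where \<open>s = \<infinity>\<close>.

  The norm of the completion is well defined (\<open>closable\<close>): if the energies of a Cauchy sequence of
  test functions are measured against \<open>C\<^sup>1\<close> weights below \<open>\<rho>\<close>, integration by parts moves all
  derivatives to one factor, so a sequence tending to 0 in \<open>L\<^sup>1\<close> on compact sets tends to 0 in energy.
\<close>

section \<open>Polar coordinates\<close>

lemma nn_integral_scaleR:
  fixes h :: "'a::euclidean_space \<Rightarrow> ennreal"
  assumes [measurable]: "h \<in> borel_measurable borel" and c: "c > 0"
  shows "(\<integral>\<^sup>+x. h x \<partial>lborel) = ennreal (c ^ DIM('a)) * (\<integral>\<^sup>+x. h (c *\<^sub>R x) \<partial>lborel)"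
  using c by (subst lborel_affine[where c = c and t = 0])
     (auto simp add: nn_integral_density nn_integral_distr nn_integral_cmult)

text \<open>Spherical means are taken by integrating \<open>h(r y/|y|)\<close> over \<open>y\<close> in a spherical shell. This gives
  rotation-invariant averages over the sphere of radius \<open>r\<close> by means of Lebesgue measure alone, without
  a surface measure, and \<open>y/|y|\<close> is smooth there.\<close>

definition shell :: "'a::euclidean_space set" where
  "shell = {y. 1 \<le> norm y \<and> norm y \<le> 2}"

lemma shell_measurable [measurable]: "shell \<in> sets borel"
  unfolding shell_def by measurable

text \<open>The ratio between integration over \<open>r > 0\<close> and directions from the shell on the one hand and
  integration over the space on the other.\<close>

definition polar_const :: "nat \<Rightarrow> ennreal" where
  "polar_const n = (\<integral>\<^sup>+t. indicator {1/2..1} t * ennreal (1 / t ^ (n + 1)) \<partial>lborel)"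

lemma polar_const_finite: "polar_const n < \<infinity>"
proof -
  have "polar_const n \<le> (\<integral>\<^sup>+t. ennreal (2 ^ (n + 1)) * indicator {1/2..1::real} t \<partial>lborel)"
    unfolding polar_const_def
  proof (intro nn_integral_mono)
    fix t :: real
    have "1 / t ^ (n + 1) \<le> 2 ^ (n + 1)" if "t \<ge> 1/2"
      using power_mono[of "1/2" t "n + 1"] that by (simp add: field_simps)
    then show "indicator {1/2..1} t * ennreal (1 / t ^ (n + 1)) \<le> ennreal (2 ^ (n + 1)) * indicator {1/2..1} t"
      by (auto split: split_indicator intro!: ennreal_leI)
  qed
  also have "\<dots> = ennreal (2 ^ (n + 1)) * emeasure lborel {1/2..1::real}"
    by (simp add: nn_integral_cmult_indicator)
  also have "\<dots> = ennreal (2 ^ (n + 1) * (1/2))"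
    by (subst ennreal_mult) (auto simp: emeasure_lborel_Icc simp del: power_Suc)
  also have "\<dots> < \<infinity>"
    by simp
  finally show ?thesis .
qed

lemma polar_const_pos: "polar_const n > 0"
proof -
  have "ennreal (1/2) = (\<integral>\<^sup>+t. indicator {1/2..1::real} t \<partial>lborel)"
    by simp
  also have "\<dots> \<le> polar_const n"
    unfolding polar_const_def
  proof (intro nn_integral_mono)
    fix t :: real
    have "1 \<le> 1 / t ^ (n + 1)" if "1/2 \<le> t" "t \<le> 1"
      using that by (simp add: field_simps power_le_one mult_le_one)
    then show "indicator {1/2..1} t \<le> indicator {1/2..1} t * ennreal (1 / t ^ (n + 1))"
      by (auto split: split_indicator)
  qed
  finally show ?thesis
    by (metis ennreal_less_zero_iff half_gt_zero less_le_trans zero_less_one)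
qed

text \<open>For fixed \<open>y\<close> the substitution \<open>r = |y| t\<close> turns the integrand into \<open>h(t y)\<close>. For fixed \<open>t\<close> the
  scaling \<open>z = t y\<close> turns it into \<open>h(z)\<close>, and what is left over is an integral in \<open>t\<close> which, by
  homogeneity, does not depend on \<open>z\<close>. The steps between are applications of Fubini's theorem.\<close>

lemma nn_integral_polar:
  fixes h :: "'a::euclidean_space \<Rightarrow> ennreal"
  assumes [measurable]: "h \<in> borel_measurable borel"
  shows "(\<integral>\<^sup>+r. \<integral>\<^sup>+y. indicator {0<..} r * indicator (shell :: 'a set) y
            * ennreal (r ^ (DIM('a) - 1)) * h (r *\<^sub>R sgn y) \<partial>lborel \<partial>lborel)
         = polar_const (DIM('a)) * (\<integral>\<^sup>+x. h x \<partial>lborel)"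
proof -
  define N where "N = DIM('a)"
  have N: "N \<ge> 1" by (simp add: N_def)
  have powN: "t * t ^ (N - 1) = t ^ N" for t :: real
    using N by (cases N) auto
  have "(\<integral>\<^sup>+r. \<integral>\<^sup>+y. indicator {0<..} r * indicator (shell :: 'a set) y
            * ennreal (r ^ (N - 1)) * h (r *\<^sub>R sgn y) \<partial>lborel \<partial>lborel)
      = (\<integral>\<^sup>+y. \<integral>\<^sup>+r. indicator {0<..} r * indicator (shell :: 'a set) y
            * ennreal (r ^ (N - 1)) * h (r *\<^sub>R sgn y) \<partial>lborel \<partial>lborel)"
    by (intro lborel_pair.Fubini'[symmetric]) measurable
  also have "\<dots> = (\<integral>\<^sup>+y. \<integral>\<^sup>+t. indicator {0<..} t * indicator (shell :: 'a set) y
            * ennreal (norm y ^ N * t ^ (N - 1)) * h (t *\<^sub>R y) \<partial>lborel \<partial>lborel)"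
  proof (rule nn_integral_cong)
    fix y :: 'a
    show "(\<integral>\<^sup>+r. indicator {0<..} r * indicator (shell :: 'a set) y
            * ennreal (r ^ (N - 1)) * h (r *\<^sub>R sgn y) \<partial>lborel)
        = (\<integral>\<^sup>+t. indicator {0<..} t * indicator (shell :: 'a set) y
            * ennreal (norm y ^ N * t ^ (N - 1)) * h (t *\<^sub>R y) \<partial>lborel)"
    proof (cases "y \<in> shell")
      case True
      then have y: "norm y > 0" "y \<noteq> 0" by (auto simp: shell_def)
      have 1: "(norm y * t) *\<^sub>R sgn y = t *\<^sub>R y" for t
        using y by (simp add: sgn_div_norm)
      have 2: "ennreal (norm y) * (indicator {0<..} (norm y * t) * ennreal ((norm y * t) ^ (N - 1)) * h (t *\<^sub>R y))
          = indicator {0<..} t * ennreal (norm y ^ N * t ^ (N - 1)) * h (t *\<^sub>R y)" for t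
      proof (cases "t > 0")
        case True
        have "ennreal (norm y) * ennreal ((norm y * t) ^ (N - 1)) = ennreal (norm y ^ N * t ^ (N - 1))"
          using True y by (simp add: ennreal_mult[symmetric] power_mult_distrib powN[symmetric] mult.assoc)
        then show ?thesis using True y by (simp add: mult.assoc[symmetric])
      qed (use y in \<open>auto simp: zero_less_mult_iff\<close>)
      show ?thesis using True y
        by (subst nn_integral_real_affine[where c = "norm y" and t = 0])
           (simp_all add: 1 2 nn_integral_cmult[symmetric] del: One_nat_def)
    qed auto
  qed
  also have "\<dots> = (\<integral>\<^sup>+t. \<integral>\<^sup>+y. indicator {0<..} t * indicator (shell :: 'a set) y
            * ennreal (norm y ^ N * t ^ (N - 1)) * h (t *\<^sub>R y) \<partial>lborel \<partial>lborel)"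
    by (intro lborel_pair.Fubini') measurable
  also have "\<dots> = (\<integral>\<^sup>+t. \<integral>\<^sup>+z. indicator {0<..} t * indicator (shell :: 'a set) ((1 / t) *\<^sub>R z)
            * ennreal (norm z ^ N * (1 / t ^ (N + 1))) * h z \<partial>lborel \<partial>lborel)"
  proof (rule nn_integral_cong)
    fix t :: real
    show "(\<integral>\<^sup>+y. indicator {0<..} t * indicator (shell :: 'a set) y
            * ennreal (norm y ^ N * t ^ (N - 1)) * h (t *\<^sub>R y) \<partial>lborel)
        = (\<integral>\<^sup>+z. indicator {0<..} t * indicator (shell :: 'a set) ((1 / t) *\<^sub>R z)
            * ennreal (norm z ^ N * (1 / t ^ (N + 1))) * h z \<partial>lborel)"
    proof (cases "t > 0")
      case True
      have 2: "ennreal (1 / t ^ N) * (indicator (shell :: 'a set) ((1 / t) *\<^sub>R z)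
            * ennreal (norm z ^ N * t ^ (N - 1) / t ^ N) * h z)
          = indicator (shell :: 'a set) ((1 / t) *\<^sub>R z) * ennreal (norm z ^ N / t ^ (N + 1)) * h z" for z
      proof -
        have "1 / t ^ N * (norm z ^ N * t ^ (N - 1) / t ^ N) = norm z ^ N / t ^ (N + 1)"
          using True powN[of t] by (simp add: field_simps)
        then have 3: "ennreal (1 / t ^ N) * ennreal (norm z ^ N * t ^ (N - 1) / t ^ N) = ennreal (norm z ^ N / t ^ (N + 1))"
          using True by (subst ennreal_mult[symmetric]) auto
        have 4: "a * (b * c * d) = b * (a * c) * d" for a b c d :: ennreal
          by (simp add: mult_ac)
        show ?thesis
          unfolding 4 3 ..
      qed
      show ?thesis using True
        by (subst nn_integral_scaleR[where c = "1 / t"])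
           (simp_all add: 2 N_def[symmetric] nn_integral_cmult[symmetric] power_one_over power_divide del: One_nat_def)
    qed simp
  qed
  also have "\<dots> = (\<integral>\<^sup>+z. \<integral>\<^sup>+t. indicator {0<..} t * indicator (shell :: 'a set) ((1 / t) *\<^sub>R z)
            * ennreal (norm z ^ N * (1 / t ^ (N + 1))) * h z \<partial>lborel \<partial>lborel)"
    by (intro lborel_pair.Fubini') measurable
  also have "\<dots> = (\<integral>\<^sup>+z. polar_const N * h z \<partial>lborel)"
  proof (intro nn_integral_cong_AE)
    have "AE z in lborel. z \<noteq> (0::'a)"
      by (simp add: AE_lborel_singleton)
    then show "AE z in lborel. (\<integral>\<^sup>+t. indicator {0<..} t * indicator (shell :: 'a set) ((1 / t) *\<^sub>R z)
            * ennreal (norm z ^ N * (1 / t ^ (N + 1))) * h z \<partial>lborel) = polar_const N * h z"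
    proof eventually_elim
      case (elim z)
      have 3: "indicator {0<..} (norm z * t) * indicator (shell :: 'a set) ((1 / (norm z * t)) *\<^sub>R z)
            = (indicator {1/2..1} t :: ennreal)" for t
        using elim by (auto simp: shell_def field_simps zero_less_mult_iff split: split_indicator)
      have "(\<integral>\<^sup>+t. indicator {0<..} t * indicator (shell :: 'a set) ((1 / t) *\<^sub>R z)
            * ennreal (norm z ^ N * (1 / t ^ (N + 1))) \<partial>lborel)
         = (\<integral>\<^sup>+t. ennreal (norm z) * (indicator {1/2..1} t * ennreal (norm z ^ N * (1 / (norm z * t) ^ (N + 1)))) \<partial>lborel)"
        using elim by (subst nn_integral_real_affine[where c = "norm z" and t = 0])
          (simp_all add: nn_integral_cmult[symmetric] 3[unfolded mult.assoc] 3 del: power_Suc)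
      also have "\<dots> = polar_const N"
        unfolding polar_const_def
      proof (intro nn_integral_cong)
        fix t :: real
        have "ennreal (norm z) * ennreal (norm z ^ N * (1 / (norm z * t) ^ (N + 1))) = ennreal (1 / t ^ (N + 1))" if "t > 0"
          using that elim by (simp add: ennreal_mult[symmetric] power_mult_distrib)
        then show "ennreal (norm z) * (indicator {1/2..1} t * ennreal (norm z ^ N * (1 / (norm z * t) ^ (N + 1))))
             = indicator {1/2..1} t * ennreal (1 / t ^ (N + 1))"
          by (auto split: split_indicator)
      qed
      finally show ?case
        by (simp add: nn_integral_multc)
    qed
  qed
  also have "\<dots> = polar_const N * (\<integral>\<^sup>+x. h x \<partial>lborel)"
    by (simp add: nn_integral_cmult)
  finally show ?thesis by (simp add: N_def)
qed

text \<open>On compact intervals reflection makes \<open>r\<close> increasing, and indicator functions as integrands show that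
  the image of the measure with density \<open>- r'\<close> is Lebesgue measure, so the formula holds for every
  nonnegative integrand. Monotone convergence then exhausts the half-line.\<close>

lemma nn_integral_substitution_antimono:
  fixes r r' :: "real \<Rightarrow> real" and k :: "real \<Rightarrow> ennreal"
  assumes k [measurable]: "k \<in> borel_measurable borel"
    and r: "\<And>s. s > 0 \<Longrightarrow> (r has_real_derivative r' s) (at s)"
    and r': "\<And>s. s > 0 \<Longrightarrow> r' s < 0"
    and cont: "continuous_on {0<..} r'"
  shows "(\<integral>\<^sup>+t. indicator (r ` {0<..}) t * k t \<partial>lborel)
       = (\<integral>\<^sup>+s. indicator {0<..} s * ennreal (- r' s) * k (r s) \<partial>lborel)"
proof -
  have contr: "continuous_on {0<..} r"
    by (intro DERIV_continuous_on[of _ r r']) (auto intro: r has_field_derivative_at_within)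
  have mono: "r t < r s" if "0 < s" "s < t" for s t
    by (rule DERIV_neg_imp_decreasing[OF that(2)]) (use r r' that in \<open>meson less_le_trans\<close>)
  have mono2: "r t \<le> r s" if "0 < s" "s \<le> t" for s t
    using mono[of s t] that by (cases "s = t") auto
  define S where "S n = {1 / real (Suc n) .. real (Suc n)}" for n
  have S: "incseq S" "(\<Union>n. S n) = {0<..}"
  proof -
    show "incseq S"
      by (auto simp: incseq_def S_def field_simps intro: order_trans)
    show "(\<Union>n. S n) = {0<..}"
    proof safe
      fix x :: real assume "x > 0"
      then obtain n1 where n1: "1 / real (Suc n1) < x" using nat_approx_posE by blast
      obtain n2 where n2: "x < real n2" using reals_Archimedean2 by blast
      have "x \<in> S (max n1 n2)"
      proof -
        have "1 / real (Suc (max n1 n2)) \<le> 1 / real (Suc n1)"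
          by (intro divide_left_mono) auto
        then show ?thesis using n1 n2 by (auto simp: S_def)
      qed
      then show "x \<in> (\<Union>n. S n)" by blast
    qed (auto simp: S_def intro: less_le_trans[rotated])
  qed
  have rS: "r ` S n = {r (real (Suc n)) .. r (1 / real (Suc n))}" for n
  proof -
    have "r ` S n \<subseteq> {r (real (Suc n)) .. r (1 / real (Suc n))}"
    proof safe
      fix x assume "x \<in> S n"
      then have "1 / real (Suc n) \<le> x" "x \<le> real (Suc n)" by (auto simp: S_def)
      moreover have "0 < 1 / real (Suc n)" by simp
      moreover from this calculation have "0 < x" by linarith
      ultimately show "r x \<in> {r (real (Suc n)) .. r (1 / real (Suc n))}" 
        using mono2[of x "real (Suc n)"] mono2[of "1 / real (Suc n)" x] by fastforce
    qed
    moreover have "t \<in> r ` S n" if "t \<in> {r (real (Suc n)) .. r (1 / real (Suc n))}" for t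
    proof -
      have "\<exists>x\<ge>1 / real (Suc n). x \<le> real (Suc n) \<and> r x = t"
      proof (rule IVT2')
        have "0 < 1 / real (Suc n)" by simp
        then show "continuous_on {1 / real (Suc n)..real (Suc n)} r"
          by (intro continuous_on_subset[OF contr] subsetI) (simp only: atLeastAtMost_iff greaterThan_iff, linarith)
        have "1 / real (Suc n) \<le> 1" by (rule divide_le_eq_1[THEN iffD2]) auto
        also have "1 \<le> real (Suc n)" by simp
        finally show "1 / real (Suc n) \<le> real (Suc n)" .
      qed (use that in auto)
      then show ?thesis by (auto simp: S_def)
    qed
    ultimately show ?thesis by blast
  qed
  have r'_meas [measurable]: "(\<lambda>s. indicator {0<..} s * ennreal (- r' s)) \<in> borel_measurable borel"
  proof -
    have "(\<lambda>s. indicator {0<..} s *\<^sub>R (- r' s)) \<in> borel_measurable borel"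
      by (intro borel_measurable_continuous_on_indicator continuous_intros cont) auto
    then have "(\<lambda>s. ennreal (indicator {0<..} s *\<^sub>R (- r' s))) \<in> borel_measurable borel"
      by simp
    also have "(\<lambda>s. ennreal (indicator {0<..} s *\<^sub>R (- r' s))) = (\<lambda>s. indicator {0<..} s * ennreal (- r' s))"
      by (auto split: split_indicator)
    finally show ?thesis .
  qed
  have r_meas: "(\<lambda>s. indicator {0<..} s * r s) \<in> borel_measurable borel"
    using borel_measurable_continuous_on_indicator[OF _ contr] by simp
  have key: "(\<integral>\<^sup>+t. indicator (r ` S n) t * k t \<partial>lborel)
       = (\<integral>\<^sup>+s. indicator (S n) s * ennreal (- r' s) * k (r s) \<partial>lborel)" for n
  proof -
    define r0 where "r0 s = indicator {0<..} s * r s" for s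
    have r0 [measurable]: "r0 \<in> borel_measurable borel" 
      using r_meas by (simp add: r0_def[abs_def])
    define M1 where "M1 = density lborel (\<lambda>t. indicator (r ` S n) t :: ennreal)"
    define M2 where "M2 = distr (density lborel (\<lambda>s. indicator (S n) s * (indicator {0<..} s * ennreal (- r' s)))) borel r0"
    have Sn [measurable]: "S n \<in> sets borel" "r ` S n \<in> sets borel"
      by (simp add: S_def, subst rS, simp)
    have Spos: "s > 0" if "s \<in> S n" for s
      using that by (auto simp: S_def intro: less_le_trans[rotated])
    have "M1 = M2"
    proof (rule measure_eqI)
      show "sets M1 = sets M2" by (simp add: M1_def M2_def)
      fix X assume "X \<in> sets M1"
      then have [measurable]: "X \<in> sets borel" by (simp add: M1_def)
      define a where "a = 1 / real (Suc n)"
      define b where "b = real (Suc n)"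
      have ab: "0 < a" "a \<le> b" "S n = {a..b}" "r ` S n = {r b..r a}"
        using rS[of n] order_trans[of "1 / real (Suc n)" 1 "real (Suc n)"]
        by (auto simp: a_def b_def S_def)
      have "emeasure M1 X = (\<integral>\<^sup>+t. ennreal (indicator X t * indicator {r b..r a} t) \<partial>lborel)"
        unfolding M1_def ab(4)
        by (auto simp: emeasure_density intro!: nn_integral_cong split: split_indicator)
      also have "\<dots> = (\<integral>\<^sup>+t. ennreal (indicator X (- t) * indicator {- r a..- r b} t) \<partial>lborel)"
        by (subst nn_integral_real_affine[where c = "-1" and t = 0])
           (auto intro!: nn_integral_cong split: split_indicator)
      also have "\<dots> = (\<integral>\<^sup>+s. ennreal (indicator X (- (- r s)) * (- r' s) * indicator {a..b} s) \<partial>lborel)"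
      proof (rule nn_integral_substitution[where g = "\<lambda>s. - r s" and f = "\<lambda>t. indicator X (- t)"])
        show "set_borel_measurable borel {- r a..- r b} (\<lambda>t. indicator X (- t) :: real)"
          unfolding set_borel_measurable_def by measurable
        show "((\<lambda>s. - r s) has_real_derivative - r' x) (at x)" if "x \<in> {a..b}" for x
          using that ab by (auto intro!: derivative_eq_intros r)
        show "continuous_on {a..b} (\<lambda>s. - r' s)"
          using ab by (auto intro!: continuous_intros continuous_on_subset[OF cont])
        show "- r' x \<ge> 0" if "x \<in> {a..b}" for x
          using r'[of x] that ab by auto
      qed (use ab in auto)
      also have "\<dots> = (\<integral>\<^sup>+s. indicator (S n) s * (indicator {0<..} s * ennreal (- r' s)) * indicator X (r0 s) \<partial>lborel)"
        using ab by (intro nn_integral_cong) (auto split: split_indicator simp: r0_def)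
      also have "\<dots> = emeasure M2 X"
      proof -
        have "emeasure M2 X = (\<integral>\<^sup>+x. indicator X x \<partial>M2)"
          by (rule nn_integral_indicator[symmetric]) (simp add: M2_def)
        also have "\<dots> = (\<integral>\<^sup>+s. indicator (S n) s * (indicator {0<..} s * ennreal (- r' s)) * indicator X (r0 s) \<partial>lborel)"
          unfolding M2_def by (subst nn_integral_distr) (auto simp: nn_integral_density)
        finally show ?thesis ..
      qed
      finally show "emeasure M1 X = emeasure M2 X" .
    qed
    then have "(\<integral>\<^sup>+t. k t \<partial>M1) = (\<integral>\<^sup>+t. k t \<partial>M2)" by simp
    also have "(\<integral>\<^sup>+t. k t \<partial>M1) = (\<integral>\<^sup>+t. indicator (r ` S n) t * k t \<partial>lborel)"
      unfolding M1_def by (simp add: nn_integral_density)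
    also have "(\<integral>\<^sup>+t. k t \<partial>M2) = (\<integral>\<^sup>+s. indicator (S n) s * (indicator {0<..} s * ennreal (- r' s)) * k (r0 s) \<partial>lborel)"
      unfolding M2_def by (subst nn_integral_distr) (auto simp: nn_integral_density)
    also have "\<dots> = (\<integral>\<^sup>+s. indicator (S n) s * ennreal (- r' s) * k (r s) \<partial>lborel)"
      using Spos by (intro nn_integral_cong) (auto split: split_indicator simp: r0_def)
    finally show ?thesis .
  qed
  have SUP_indicator: "(SUP n. indicator (B n) x * (c::ennreal)) = indicator (\<Union>n. B n) x * c"
    for B :: "nat \<Rightarrow> real set" and x c
  proof (rule SUP_eqI)
    show "indicator (B n) x * c \<le> indicator (\<Union>n. B n) x * c" for n
      by (auto split: split_indicator)
    fix y assume "\<And>n. n \<in> UNIV \<Longrightarrow> indicator (B n) x * c \<le> y"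
    then show "indicator (\<Union>n. B n) x * c \<le> y"
      by (cases "x \<in> (\<Union>n. B n)") (auto, metis indicator_simps(1) mult_1)
  qed
  have UN_rS: "(\<Union>n. r ` S n) = r ` {0<..}"
    using S(2) by blast
  have inc_rS: "incseq (\<lambda>n. r ` S n)"
    using S(1) by (auto simp: incseq_def)
  have [measurable]: "S n \<in> sets borel" "r ` S n \<in> sets borel" for n
    by (simp add: S_def, subst rS, simp)
  have rs_meas: "(\<lambda>s. indicator (S n) s * (ennreal (- r' s) * k (r s))) \<in> borel_measurable borel" for n
  proof -
    define r0 where "r0 s = indicator {0<..} s * r s" for s
    have [measurable]: "r0 \<in> borel_measurable borel" 
      using r_meas by (simp add: r0_def[abs_def])
    have "(\<lambda>s. indicator (S n) s * ((indicator {0<..} s * ennreal (- r' s)) * k (r0 s))) \<in> borel_measurable borel"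
      by measurable
    also have "(\<lambda>s. indicator (S n) s * ((indicator {0<..} s * ennreal (- r' s)) * k (r0 s)))
        = (\<lambda>s. indicator (S n) s * (ennreal (- r' s) * k (r s)))"
      using S(2) by (intro ext) (auto split: split_indicator simp: r0_def)
    finally show ?thesis .
  qed
  have "(\<integral>\<^sup>+t. indicator (r ` {0<..}) t * k t \<partial>lborel) = (\<integral>\<^sup>+t. (SUP n. indicator (r ` S n) t * k t) \<partial>lborel)"
    by (simp add: SUP_indicator UN_rS)
  also have "\<dots> = (SUP n. \<integral>\<^sup>+t. indicator (r ` S n) t * k t \<partial>lborel)"
    using inc_rS by (intro nn_integral_monotone_convergence_SUP)
      (auto simp: incseq_def le_fun_def split: split_indicator)
  also have "\<dots> = (SUP n. \<integral>\<^sup>+s. indicator (S n) s * (ennreal (- r' s) * k (r s)) \<partial>lborel)"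
    by (simp add: key mult.assoc)
  also have "\<dots> = (\<integral>\<^sup>+s. (SUP n. indicator (S n) s * (ennreal (- r' s) * k (r s))) \<partial>lborel)"
    using S(1) rs_meas by (intro nn_integral_monotone_convergence_SUP[symmetric])
      (auto simp: incseq_def le_fun_def split: split_indicator)
  also have "\<dots> = (\<integral>\<^sup>+s. indicator {0<..} s * ennreal (- r' s) * k (r s) \<partial>lborel)"
    by (simp add: SUP_indicator S(2) mult.assoc)
  finally show ?thesis .
qed

section \<open>Smooth functions\<close>

lemma GDERIV_unique:
  assumes "GDERIV f x :> D" "GDERIV f x :> E"
  shows "D = E"
proof -
  have "(\<lambda>h. h \<bullet> D) = (\<lambda>h. h \<bullet> E)"
    using assms unfolding gderiv_def by (rule has_derivative_unique)
  then have "(D - E) \<bullet> (D - E) = 0"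
    by (metis inner_diff_right right_minus_eq)
  then show ?thesis by simp
qed

lemma grad_eqI: "GDERIV f x :> D \<Longrightarrow> grad f x = D"
  unfolding grad_def using GDERIV_unique by blast

text \<open>The Riesz representation of the derivative.\<close>

lemma GDERIV_grad:
  fixes f :: "'a::euclidean_space \<Rightarrow> real"
  assumes "f differentiable (at x)"
  shows "GDERIV f x :> grad f x"
proof -
  obtain f' where f': "(f has_derivative f') (at x)"
    using assms by (auto simp: differentiable_def)
  then interpret f': linear f'
    by (intro has_derivative_linear)
  have "f' h = h \<bullet> (\<Sum>b\<in>Basis. f' b *\<^sub>R b)" for h
  proof -
    have "f' h = f' (\<Sum>b\<in>Basis. (h \<bullet> b) *\<^sub>R b)"
      by (simp add: euclidean_representation)
    also have "\<dots> = (\<Sum>b\<in>Basis. (h \<bullet> b) * f' b)"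
      by (simp add: f'.sum f'.scale)
    finally show ?thesis
      by (simp add: inner_sum_right mult.commute)
  qed
  then have "f' = (\<lambda>h. h \<bullet> (\<Sum>b\<in>Basis. f' b *\<^sub>R b))" by blast
  with f' have "GDERIV f x :> (\<Sum>b\<in>Basis. f' b *\<^sub>R b)"
    unfolding gderiv_def by simp
  then show ?thesis
    using grad_eqI by metis
qed

lemma GDERIV_real_iff: "GDERIV f x :> D \<longleftrightarrow> (f has_real_derivative D) (at x)"
  by (simp add: gderiv_def has_field_derivative_def mult_commute_abs)

lemma C_k_SucI:
  assumes "\<And>x. GDERIV f x :> D x" "\<And>b. b \<in> Basis \<Longrightarrow> C_k k (\<lambda>x. D x \<bullet> b)"
  shows "C_k (Suc k) f"
  using assms by (auto simp: grad_eqI[OF assms(1)] gderiv_def differentiable_def)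

lemma C_k_SucD:
  assumes "C_k (Suc k) f"
  shows "GDERIV f x :> grad f x" "b \<in> Basis \<Longrightarrow> C_k k (\<lambda>x. grad f x \<bullet> b)"
  using assms by (auto intro: GDERIV_grad)

lemma C_k_Suc_imp: "C_k (Suc k) f \<Longrightarrow> C_k k f"
proof (induction k arbitrary: f)
  case 0
  then have "f differentiable (at x)" for x by simp
  then show ?case
    by (auto intro!: continuous_at_imp_continuous_on differentiable_imp_continuous_within)
next
  case (Suc k)
  have "C_k k (\<lambda>x. grad f x \<bullet> b)" if "b \<in> Basis" for b
    using Suc.IH[of "\<lambda>x. grad f x \<bullet> b"] Suc.prems that by simp
  with Suc.prems show ?case by simp
qed

lemma C_k_real_SucI:
  fixes f :: "real \<Rightarrow> real"
  assumes "\<And>x. (f has_real_derivative f' x) (at x)" "C_k k f'"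
  shows "C_k (Suc k) f"
  by (rule C_k_SucI[where D = f']) (use assms in \<open>auto simp: GDERIV_real_iff\<close>)

lemma C_k_add: "C_k k f \<Longrightarrow> C_k k g \<Longrightarrow> C_k k (\<lambda>x. f x + g x)"
proof (induction k arbitrary: f g)
  case 0
  then show ?case by (auto intro: continuous_intros)
next
  case (Suc k)
  show ?case
    by (rule C_k_SucI[OF GDERIV_add[OF C_k_SucD(1)[OF Suc.prems(1)] C_k_SucD(1)[OF Suc.prems(2)]]])
       (use Suc in \<open>auto simp: inner_add_left\<close>)
qed

lemma C_k_const: "C_k k (\<lambda>x. c)"
proof (induction k arbitrary: c)
  case (Suc k)
  show ?case
    by (rule C_k_SucI[OF GDERIV_const]) (use Suc in \<open>auto\<close>)
qed (auto intro: continuous_intros)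

lemma C_k_mult: "C_k k f \<Longrightarrow> C_k k g \<Longrightarrow> C_k k (\<lambda>x. f x * g x)"
proof (induction k arbitrary: f g)
  case 0
  then show ?case by (auto intro: continuous_intros)
next
  case (Suc k)
  show ?case
    by (rule C_k_SucI[OF GDERIV_mult[OF C_k_SucD(1)[OF Suc.prems(1)] C_k_SucD(1)[OF Suc.prems(2)]]])
       (simp only: inner_add_left inner_scaleR_left, intro C_k_add Suc.IH C_k_Suc_imp[OF Suc.prems(1)]
          C_k_Suc_imp[OF Suc.prems(2)] C_k_SucD(2)[OF Suc.prems(1)] C_k_SucD(2)[OF Suc.prems(2)])
qed

lemma C_k_diff: "C_k k f \<Longrightarrow> C_k k g \<Longrightarrow> C_k k (\<lambda>x. f x - g x)"
  using C_k_add[of k f "\<lambda>x. (-1) * g x"] C_k_mult[OF C_k_const[of k "-1"], of g] by simp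

lemma C_k_inner: "C_k k (\<lambda>x. x \<bullet> b)"
proof (cases k)
  case (Suc j)
  have "GDERIV (\<lambda>x. x \<bullet> b) x :> b" for x
    unfolding gderiv_def by (auto intro!: derivative_eq_intros)
  then show ?thesis
    unfolding Suc by (rule C_k_SucI) (simp add: C_k_const)
qed (auto intro: continuous_intros)

lemma C_k_compose_affine:
  fixes f :: "real \<Rightarrow> real"
  shows "C_k k f \<Longrightarrow> C_k k (\<lambda>x. f (a * x + b))"
proof (induction k arbitrary: f)
  case 0
  then show ?case
    by (auto intro!: continuous_intros continuous_on_compose2[of UNIV f])
next
  case (Suc k)
  have f': "(f has_real_derivative grad f x) (at x)" for x
    using C_k_SucD(1)[OF Suc.prems] by (simp add: GDERIV_real_iff)
  have "((\<lambda>x. f (a * x + b)) has_real_derivative (a * grad f (a * x + b))) (at x)" for x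
  proof -
    have "((\<lambda>x. a * x + b) has_real_derivative a) (at x)"
      by (auto intro!: derivative_eq_intros)
    from DERIV_chain2[OF f' this] show ?thesis
      by (simp add: mult.commute)
  qed
  moreover have "C_k k (grad f)"
    using C_k_SucD(2)[OF Suc.prems, of 1] by simp
  then have "C_k k (\<lambda>x. a * grad f (a * x + b))"
    by (intro C_k_mult C_k_const Suc.IH)
  ultimately show ?case
    by (rule C_k_real_SucI)
qed

text \<open>Smooth radial functions are built as smooth functions of the squared radius, which avoids
  the singularity of the radius at the origin.\<close>

lemma GDERIV_radial:
  fixes G :: "real \<Rightarrow> real" and x :: "'a::euclidean_space"
  assumes "(G has_real_derivative q) (at (x \<bullet> x))"
  shows "GDERIV (\<lambda>x. G (x \<bullet> x)) x :> (2 * q) *\<^sub>R x"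
proof -
  have "((\<lambda>x. x \<bullet> x) has_derivative (\<lambda>h. x \<bullet> h + h \<bullet> x)) (at x)"
    by (auto intro!: derivative_eq_intros)
  from has_derivative_compose[OF this] assms
  have "((\<lambda>x. G (x \<bullet> x)) has_derivative (\<lambda>h. q * (x \<bullet> h + h \<bullet> x))) (at x)"
    by (simp add: has_field_derivative_def)
  moreover have "(\<lambda>h. q * (x \<bullet> h + h \<bullet> x)) = (\<lambda>h. h \<bullet> ((2 * q) *\<^sub>R x))"
    by (auto simp: inner_commute algebra_simps)
  ultimately show ?thesis
    unfolding gderiv_def by simp
qed

lemma C_k_radial:
  fixes G :: "real \<Rightarrow> real"
  shows "C_k k G \<Longrightarrow> C_k k (\<lambda>x::'a::euclidean_space. G (x \<bullet> x))"
proof (induction k arbitrary: G)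
  case 0
  then show ?case
    by (auto intro!: continuous_intros continuous_on_compose2[of UNIV G])
next
  case (Suc k)
  have "(G has_real_derivative grad G z) (at z)" for z
    using C_k_SucD(1)[OF Suc.prems] by (simp add: GDERIV_real_iff)
  from GDERIV_radial[OF this] show ?case
  proof (rule C_k_SucI)
    fix b :: 'a
    have "C_k k (grad G)"
      using C_k_SucD(2)[OF Suc.prems, of 1] by simp
    then have "C_k k (\<lambda>x::'a. (2 * grad G (x \<bullet> x)) * (x \<bullet> b))"
      by (intro C_k_mult C_k_const Suc.IH C_k_inner)
    then show "C_k k (\<lambda>x::'a. ((2 * grad G (x \<bullet> x)) *\<^sub>R x) \<bullet> b)"
      by simp
  qed
qed

lemma C_k_real_polynomial_function:
  fixes g :: "real \<Rightarrow> real"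
  assumes "real_polynomial_function g"
  shows "C_k k g"
  using assms
proof induction
  case (linear f)
  then interpret linear f by (simp add: bounded_linear.linear)
  have "f = (\<lambda>x. f 1 * (x \<bullet> 1))"
  proof
    show "f x = f 1 * (x \<bullet> 1)" for x
      using scale[of x 1] by (simp add: mult.commute)
  qed
  then show ?case
    using C_k_mult[OF C_k_const C_k_inner] by metis
qed (auto intro: C_k_const C_k_add C_k_mult)

text \<open>The functions \<open>P(1/x) exp(-1/x)\<close>, continued by zero: differentiation stays within this
  family, so smoothness at the origin need only be checked once.\<close>

definition flat :: "real poly \<Rightarrow> real \<Rightarrow> real" where
  "flat P x = (if x > 0 then poly P (1 / x) * exp (- 1 / x) else 0)"

lemma tendsto_poly_exp_0:
  fixes P :: "real poly"
  shows "((\<lambda>y. y ^ k * poly P y * exp (- y)) \<longlongrightarrow> 0) at_top"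
proof (induction P arbitrary: k)
  case (pCons a P)
  have "((\<lambda>y. a * (y ^ k / exp y) + y ^ Suc k * poly P y * exp (- y)) \<longlongrightarrow> a * 0 + 0) at_top"
    by (intro tendsto_intros tendsto_power_div_exp_0 pCons.IH)
  then show ?case
    by (simp add: exp_minus field_simps)
qed simp

lemma DERIV_flat: "(flat P has_real_derivative flat ([:0, 0, 1:] * (P - pderiv P)) x) (at x)"
proof -
  consider "x > 0" | "x < 0" | "x = 0" by linarith
  then show ?thesis
  proof cases
    case 1
    have "((\<lambda>x. poly P (1 / x) * exp (- 1 / x)) has_real_derivative flat ([:0, 0, 1:] * (P - pderiv P)) x) (at x)"
      using 1 unfolding flat_def
      by (auto intro!: derivative_eq_intros poly_DERIV[THEN DERIV_chain2] simp: field_simps power2_eq_square)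
    then show ?thesis
      by (rule has_field_derivative_transform_within_open[where S = "{0<..}"]) (use 1 in \<open>auto simp: flat_def\<close>)
  next
    case 2
    have "((\<lambda>x. 0) has_real_derivative flat ([:0, 0, 1:] * (P - pderiv P)) x) (at x)"
      using 2 by (auto simp: flat_def)
    then show ?thesis
      by (rule has_field_derivative_transform_within_open[where S = "{..<0}"]) (use 2 in \<open>auto simp: flat_def\<close>)
  next
    case 3
    have "((\<lambda>h. flat P h / h) \<longlongrightarrow> 0) (at_right 0)"
    proof -
      have "filterlim (\<lambda>h::real. 1 / h) at_top (at_right 0)"
        by (simp add: filterlim_inverse_at_top_right inverse_eq_divide[symmetric])
      from filterlim_compose[OF tendsto_poly_exp_0[of 1 P] this]
      have "((\<lambda>h. (1 / h) ^ 1 * poly P (1 / h) * exp (- (1 / h))) \<longlongrightarrow> 0) (at_right 0)" .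
      then show ?thesis
        by (rule Lim_transform_eventually) (auto simp: flat_def eventually_at_filter)
    qed
    moreover have "((\<lambda>h. flat P h / h) \<longlongrightarrow> 0) (at_left 0)"
      by (rule tendsto_eventually) (auto simp: flat_def eventually_at_filter)
    ultimately have "((\<lambda>h. flat P h / h) \<longlongrightarrow> 0) (at 0)"
      by (simp add: filterlim_at_split)
    then show ?thesis
      using 3 by (simp add: has_field_derivative_iff flat_def)
  qed
qed

lemma C_k_flat: "C_k k (flat P)"
proof (induction k arbitrary: P)
  case 0
  show ?case using DERIV_flat[of P] by (auto intro!: DERIV_continuous_on)
next
  case (Suc k)
  show ?case by (rule C_k_real_SucI[OF DERIV_flat Suc])
qed

text \<open>A polynomial is turned into a smooth function with compact support by a positive smooth
  bump; dividing the target by the bump first makes the Weierstrass approximation theorem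
  applicable.\<close>

lemma smooth_approximation:
  fixes q :: "real \<Rightarrow> real"
  assumes q: "continuous_on UNIV q" and supp: "\<And>z. z \<notin> {a'..b'} \<Longrightarrow> q z = 0"
    and ab: "a < a'" "a' \<le> b'" "b' < b" and e: "e > 0"
  shows "\<exists>p. (\<forall>k. C_k k p) \<and> (\<forall>z. z \<notin> {a<..<b} \<longrightarrow> p z = 0) \<and> (\<forall>z. \<bar>p z - q z\<bar> \<le> e)"
proof -
  define B where "B z = flat 1 (z - a) * flat 1 (b - z)" for z
  have B: "C_k k B" for k
  proof -
    have "C_k k (\<lambda>z. flat 1 (1 * z + (- a)) * flat 1 ((-1) * z + b))"
      by (intro C_k_mult C_k_compose_affine C_k_flat)
    also have "(\<lambda>z. flat 1 (1 * z + (- a)) * flat 1 ((-1) * z + b)) = B"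
      by (auto simp: B_def)
    finally show ?thesis .
  qed
  have Bcont: "continuous_on UNIV B"
    using B[of 0] by simp
  have Bpos: "B z > 0" if "a < z" "z < b" for z
    using that by (simp add: B_def flat_def)
  have B0: "B z = 0" if "z \<notin> {a<..<b}" for z
    using that by (auto simp: B_def flat_def)
  have B1: "0 \<le> B z" "B z \<le> 1" for z
    by (auto simp: B_def flat_def intro!: mult_le_one)
  \<comment> \<open>outside the support of \<open>q\<close> the quotient is zero, also where the bump vanishes\<close>
  have "continuous_on ({a<..<b} \<union> - {a'..b'}) (\<lambda>z. q z / B z)"
  proof (rule continuous_on_open_Un)
    show "continuous_on {a<..<b} (\<lambda>z. q z / B z)"
      using Bpos by (intro continuous_on_divide continuous_on_subset[OF q] continuous_on_subset[OF Bcont]) force+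
    have "continuous_on (- {a'..b'}) (\<lambda>z. 0 :: real)" by simp
    then show "continuous_on (- {a'..b'}) (\<lambda>z. q z / B z)"
      by (rule continuous_on_eq) (use supp in auto)
  qed auto
  then have "continuous_on {a..b} (\<lambda>z. q z / B z)"
    by (rule continuous_on_subset) (use ab in auto)
  from Stone_Weierstrass_real_polynomial_function[OF _ this e]
  obtain g where g: "real_polynomial_function g" "\<And>z. z \<in> {a..b} \<Longrightarrow> \<bar>q z / B z - g z\<bar> < e"
    by auto
  have "C_k k (\<lambda>z. B z * g z)" for k
    by (intro C_k_mult B C_k_real_polynomial_function g)
  moreover have "\<bar>B z * g z - q z\<bar> \<le> e" for z
  proof (cases "z \<in> {a<..<b}")
    case True
    then have "\<bar>B z * g z - q z\<bar> = B z * \<bar>q z / B z - g z\<bar>"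
      using Bpos[of z] by (simp add: abs_mult_pos' right_diff_distrib abs_minus_commute)
    also have "\<dots> \<le> 1 * e"
      using B1[of z] g(2)[of z] True by (intro mult_mono) auto
    finally show ?thesis by simp
  next
    case False
    then have "q z = 0" using supp ab by auto
    with False show ?thesis using B0 e by simp
  qed
  ultimately show ?thesis
    using B0 by (intro exI[of _ "\<lambda>z. B z * g z"]) auto
qed

section \<open>Antiderivatives\<close>

lemma antiderivative_exists:
  fixes q :: "real \<Rightarrow> real"
  assumes "continuous_on UNIV q"
  shows "\<exists>G. (\<forall>z. (G has_real_derivative q z) (at z)) \<and> G c = 0"
proof -
  define G where "G z = (LBINT y=c..z. q y)" for z :: real
  have "(G has_real_derivative q z) (at z)" for z
  proof -
    define m where "m = min c z - 1"
    define M where "M = max c z + 1"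
    have "((\<lambda>u. LBINT y=c..u. q y) has_vector_derivative q z) (at z within {m..M})"
      by (rule interval_integral_FTC2) (auto simp: m_def M_def intro: continuous_on_subset[OF assms])
    then have "(G has_real_derivative q z) (at z within {m..M})"
      by (simp add: G_def[abs_def] has_real_derivative_iff_has_vector_derivative)
    moreover have "z \<in> interior {m..M}" by (auto simp: m_def M_def)
    ultimately show ?thesis
      by (metis at_within_interior)
  qed
  moreover have "G c = 0" by (simp add: G_def)
  ultimately show ?thesis by blast
qed

lemma DERIV_zero_on_Ici:
  fixes G q :: "real \<Rightarrow> real"
  assumes "\<And>z. (G has_real_derivative q z) (at z)" "\<And>z. z \<ge> c \<Longrightarrow> q z = 0" "z \<ge> c"
  shows "G z = G c"
proof (cases "z = c")
  case False
  then have "c < z" using assms by simp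
  then obtain y where "y > c" "G z - G c = (z - c) * q y"
    using MVT2[of c z G q] assms(1) by blast
  with assms(2)[of y] show ?thesis by simp
qed simp

lemma DERIV_zero_on_Iic:
  fixes G q :: "real \<Rightarrow> real"
  assumes "\<And>z. (G has_real_derivative q z) (at z)" "\<And>z. z \<le> c \<Longrightarrow> q z = 0" "z \<le> c"
  shows "G z = G c"
proof (cases "z = c")
  case False
  then have "z < c" using assms by simp
  then obtain y where "y < c" "G c - G z = (c - z) * q y"
    using MVT2[of z c G q] assms(1) by blast
  with assms(2)[of y] show ?thesis by simp
qed simp

section \<open>Test functions\<close>

lemma test_functionsD:
  assumes "\<phi> \<in> test_functions \<Omega>"
  shows "C_k k \<phi>" "GDERIV \<phi> x :> grad \<phi> x" "continuous_on UNIV \<phi>" "continuous_on UNIV (grad \<phi>)"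
    "\<exists>K. compact K \<and> K \<subseteq> \<Omega> \<and> (\<forall>x. x \<notin> K \<longrightarrow> \<phi> x = 0 \<and> grad \<phi> x = 0)"
proof -
  have C: "C_k k \<phi>" for k using assms by (simp add: test_functions_def)
  then show "C_k k \<phi>" .
  show G: "GDERIV \<phi> x :> grad \<phi> x" for x by (rule C_k_SucD[OF C[of 1, simplified One_nat_def]])
  show "continuous_on UNIV \<phi>" using C[of 0] by simp
  have "continuous_on UNIV (\<lambda>x. grad \<phi> x \<bullet> b)" if "b \<in> Basis" for b
    using C_k_SucD(2)[OF C[of "Suc 0"] that] by simp
  then show "continuous_on UNIV (grad \<phi>)"
    using continuous_on_componentwise[of UNIV "grad \<phi>"] by blast
  define K where "K = closure {x. \<phi> x \<noteq> 0}"
  have "compact K" "K \<subseteq> \<Omega>" using assms by (auto simp: test_functions_def K_def)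
  moreover have 0: "\<phi> x = 0" if "x \<notin> K" for x
    using that closure_subset[of "{x. \<phi> x \<noteq> 0}"] by (auto simp: K_def)
  moreover have "grad \<phi> x = 0" if "x \<notin> K" for x
  proof -
    have "GDERIV (\<lambda>x. 0) x :> 0" by (rule GDERIV_const)
    then have "GDERIV \<phi> x :> 0"
      unfolding gderiv_def
      by (rule has_derivative_transform_within_open[where s = "- K"]) (use that 0 \<open>compact K\<close> in \<open>auto simp: compact_imp_closed\<close>)
    then show ?thesis by (rule grad_eqI)
  qed
  ultimately show "\<exists>K. compact K \<and> K \<subseteq> \<Omega> \<and> (\<forall>x. x \<notin> K \<longrightarrow> \<phi> x = 0 \<and> grad \<phi> x = 0)" by blast
qed

lemma test_functions_measurable:
  assumes "\<phi> \<in> test_functions \<Omega>"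
  shows "\<phi> \<in> borel_measurable borel" "grad \<phi> \<in> borel_measurable borel"
  using test_functionsD(3,4)[OF assms] by (auto intro: borel_measurable_continuous_onI)

lemma test_functionsI:
  assumes "\<And>k. C_k k \<phi>" "compact K" "K \<subseteq> \<Omega>" "\<And>x. x \<notin> K \<Longrightarrow> \<phi> x = 0"
  shows "\<phi> \<in> test_functions \<Omega>"
proof -
  have "closure {x. \<phi> x \<noteq> 0} \<subseteq> K"
    by (rule closure_minimal) (use assms in \<open>auto simp: compact_imp_closed\<close>)
  then show ?thesis
    using assms by (auto simp: test_functions_def intro: compact_closure[THEN iffD2] bounded_subset[OF compact_imp_bounded])
qed

lemma test_functions_diff:
  assumes "\<phi> \<in> test_functions \<Omega>" "\<psi> \<in> test_functions \<Omega>"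
  shows "(\<lambda>x. \<phi> x - \<psi> x) \<in> test_functions \<Omega>"
proof -
  obtain K L where "compact K" "K \<subseteq> \<Omega>" "\<And>x. x \<notin> K \<Longrightarrow> \<phi> x = 0"
    "compact L" "L \<subseteq> \<Omega>" "\<And>x. x \<notin> L \<Longrightarrow> \<psi> x = 0"
    using test_functionsD(5)[OF assms(1)] test_functionsD(5)[OF assms(2)] by metis
  then show ?thesis
    by (intro test_functionsI[where K = "K \<union> L"] C_k_diff test_functionsD(1)[OF assms(1)] test_functionsD(1)[OF assms(2)]) auto
qed

lemma grad_diff:
  assumes "\<phi> \<in> test_functions \<Omega>" "\<psi> \<in> test_functions \<Omega>"
  shows "grad (\<lambda>x. \<phi> x - \<psi> x) x = grad \<phi> x - grad \<psi> x"
  by (intro grad_eqI GDERIV_diff test_functionsD(2)[OF assms(1)] test_functionsD(2)[OF assms(2)])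

section \<open>Integration by parts\<close>

text \<open>Translation invariance makes the integral of every difference quotient vanish; the
  difference quotients converge boundedly on a fixed ball.\<close>

lemma integral_directional_derivative_eq_0:
  fixes F :: "'a::euclidean_space \<Rightarrow> real"
  assumes F: "\<And>x. (F has_derivative F' x) (at x)"
    and cont: "continuous_on UNIV (\<lambda>x. F' x b)"
    and K: "compact K" "\<And>x. x \<notin> K \<Longrightarrow> F x = 0"
  shows "(\<integral>x. F' x b \<partial>lborel) = 0"
proof -
  obtain B where B: "\<And>x. x \<in> K \<Longrightarrow> norm x \<le> B"
    using compact_imp_bounded[OF K(1)] by (auto simp: bounded_iff)
  define S where "S = cball (0::'a) (B + norm b)"
  define T where "T = cball (0::'a) (B + norm b + norm b)"
  have "compact ((\<lambda>x. F' x b) ` T)"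
    unfolding T_def by (intro compact_continuous_image continuous_on_subset[OF cont]) auto
  then obtain M where M: "\<And>x. x \<in> T \<Longrightarrow> \<bar>F' x b\<bar> \<le> M"
    using compact_imp_bounded[of "(\<lambda>x. F' x b) ` T"] by (auto simp: bounded_iff)
  define h where "h n = 1 / real (Suc n)" for n
  have h: "h n > 0" "h n \<le> 1" for n by (auto simp: h_def)
  have h_lim: "h \<longlonglongrightarrow> 0"
    unfolding h_def[abs_def] by (rule LIMSEQ_Suc[OF lim_1_over_n])
  define D where "D n x = (F (x + h n *\<^sub>R b) - F x) / h n" for n x
  have Fcont: "continuous_on UNIV F"
    using F by (intro continuous_at_imp_continuous_on) (auto intro: has_derivative_continuous)
  have [measurable]: "F \<in> borel_measurable borel" "(\<lambda>x. F' x b) \<in> borel_measurable borel"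
    using Fcont cont by (auto intro: borel_measurable_continuous_onI)
  have path: "((\<lambda>t. F (x + t *\<^sub>R b)) has_real_derivative F' (x + t *\<^sub>R b) b) (at t)" for x t
  proof -
    have "((\<lambda>t. x + t *\<^sub>R b) has_derivative (\<lambda>s. s *\<^sub>R b)) (at t)"
      by (auto intro!: derivative_eq_intros)
    from has_derivative_compose[OF this F]
    have "((\<lambda>t. F (x + t *\<^sub>R b)) has_derivative (\<lambda>s. F' (x + t *\<^sub>R b) (s *\<^sub>R b))) (at t)" .
    moreover have "(\<lambda>s. F' (x + t *\<^sub>R b) (s *\<^sub>R b)) = (*) (F' (x + t *\<^sub>R b) b)"
      using linear_scale[OF has_derivative_linear[OF F]] by (auto simp: mult.commute)
    ultimately show ?thesis by (simp add: has_field_derivative_def)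
  qed
  have D_lim: "(\<lambda>n. D n x) \<longlonglongrightarrow> F' x b" for x
  proof -
    have "((\<lambda>t. (F (x + t *\<^sub>R b) - F x) / t) \<longlongrightarrow> F' x b) (at 0)"
      using path[of x 0] by (simp add: has_field_derivative_iff)
    moreover have "filterlim h (at 0) sequentially"
      using h_lim h by (auto simp: filterlim_at h_def)
    ultimately show ?thesis
      unfolding D_def by (rule filterlim_compose)
  qed
  have D_bound: "norm (D n x) \<le> indicator S x * M" for n x
  proof (cases "x \<in> S")
    case True
    obtain t where t: "0 < t" "t < h n" "F (x + h n *\<^sub>R b) - F (x + 0 *\<^sub>R b) = (h n - 0) * F' (x + t *\<^sub>R b) b"
      using MVT2[OF h(1)[of n], of "\<lambda>t. F (x + t *\<^sub>R b)" "\<lambda>t. F' (x + t *\<^sub>R b) b"] path by blast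
    have "norm (t *\<^sub>R b) \<le> norm b"
      using t h(2)[of n] by (simp add: mult_left_le_one_le)
    then have "x + t *\<^sub>R b \<in> T"
      using True norm_triangle_ineq[of x "t *\<^sub>R b"] by (simp add: S_def T_def)
    then show ?thesis
      using M t h(1)[of n] True by (simp add: D_def)
  next
    case False
    have "norm (h n *\<^sub>R b) \<le> norm b"
      using h(1,2)[of n] by (simp add: mult_left_le_one_le)
    then have "norm (x + h n *\<^sub>R b) > B" "norm x > B"
      using False norm_triangle_ineq[of "x + h n *\<^sub>R b" "- (h n *\<^sub>R b)"] 
      by (auto simp: S_def not_le) (smt (verit) norm_ge_zero)+
    then have "F (x + h n *\<^sub>R b) = 0" "F x = 0"
      using B K(2) by (meson not_le)+
    with False show ?thesis by (simp add: D_def)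
  qed
  have "integrable lborel (\<lambda>x. indicator S x * M)"
    by (intro integrable_mult_left integrable_real_indicator) (auto simp: S_def intro: emeasure_bounded_finite[unfolded infinity_ennreal_def])
  then have "(\<lambda>n. \<integral>x. D n x \<partial>lborel) \<longlonglongrightarrow> (\<integral>x. F' x b \<partial>lborel)"
    by (rule integral_dominated_convergence[rotated 2]) (use D_lim D_bound in \<open>auto simp: D_def[abs_def]\<close>)
  moreover have "(\<integral>x. D n x \<partial>lborel) = 0" for n
  proof -
    have int: "integrable lborel F"
      using borel_integrable_compact[OF K(1) continuous_on_subset[OF Fcont]]
      by (rule Bochner_Integration.integrable_cong[THEN iffD1, rotated -1])
         (use K(2) in \<open>auto simp: indicator_def\<close>)
    have eq: "(\<integral>x. F (x + h n *\<^sub>R b) \<partial>lborel) = (\<integral>x. F x \<partial>lborel)"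
    proof -
      have "(\<integral>x. F x \<partial>lborel) = (\<integral>x. F x \<partial>distr lborel borel ((+) (h n *\<^sub>R b)))"
        by (simp add: lborel_distr_plus)
      also have "\<dots> = (\<integral>x. F (h n *\<^sub>R b + x) \<partial>lborel)"
        by (subst integral_distr) auto
      finally show ?thesis by (simp add: add.commute)
    qed
    have int2: "integrable lborel (\<lambda>x. F (x + h n *\<^sub>R b))"
    proof -
      have "integrable (distr lborel borel ((+) (h n *\<^sub>R b))) F"
        using int by (simp add: lborel_distr_plus)
      then show ?thesis by (subst (asm) integrable_distr_eq) (auto simp: add.commute)
    qed
    show ?thesis
      unfolding D_def using int int2 eq by simp
  qed
  ultimately show ?thesis
    by (simp add: LIMSEQ_const_iff)
qed

lemma integrable_continuous_compact_support:
  fixes f :: "'a::euclidean_space \<Rightarrow> real"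
  assumes "continuous_on UNIV f" "compact K" "\<And>x. x \<notin> K \<Longrightarrow> f x = 0"
  shows "integrable lborel f"
proof -
  have "integrable lborel (\<lambda>x. indicator K x *\<^sub>R f x)"
    by (rule borel_integrable_compact[OF assms(2) continuous_on_subset[OF assms(1)]]) simp
  also have "(\<lambda>x. indicator K x *\<^sub>R f x) = f"
  proof
    show "indicator K x *\<^sub>R f x = f x" for x
      using assms(3)[of x] by (cases "x \<in> K") auto
  qed
  finally show ?thesis .
qed

text \<open>The gradient of the product of \<open>\<psi>\<close> with each component of the field \<open>w grad \<phi>\<close> integrates to zero.\<close>

lemma integration_by_parts_gradients:
  fixes \<phi> \<psi> w :: "'a::euclidean_space \<Rightarrow> real"
  assumes \<phi>: "\<phi> \<in> test_functions \<Omega>" and \<psi>: "\<psi> \<in> test_functions \<Omega>" and w: "C_k 1 w"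
  shows "(\<integral>x. w x * (grad \<phi> x \<bullet> grad \<psi> x) \<partial>lborel)
    = - (\<integral>x. \<psi> x * (\<Sum>b\<in>Basis. grad (\<lambda>x. w x * (grad \<phi> x \<bullet> b)) x \<bullet> b) \<partial>lborel)"
proof -
  obtain K where K: "compact K" "\<And>x. x \<notin> K \<Longrightarrow> \<psi> x = 0 \<and> grad \<psi> x = 0"
    using test_functionsD(5)[OF \<psi>] by blast
  define f where "f b x = w x * (grad \<phi> x \<bullet> b)" for b x
  have f: "C_k 1 (f b)" if "b \<in> Basis" for b
    unfolding f_def using C_k_SucD(2)[OF test_functionsD(1)[OF \<phi>, of "Suc 1"] that] by (intro C_k_mult w)
  have fG: "GDERIV (f b) x :> grad (f b) x" if "b \<in> Basis" for b x
    using C_k_SucD(1)[of 0 "f b"] f[OF that] by simp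
  have f_cont: "continuous_on UNIV (f b)" if "b \<in> Basis" for b
    using C_k_Suc_imp[of 0 "f b"] f[OF that] by simp
  have fb_cont: "continuous_on UNIV (\<lambda>x. grad (f b) x \<bullet> b)" if "b \<in> Basis" for b
    using C_k_SucD(2)[of 0 "f b" b] f[OF that] that by simp
  have int1: "integrable lborel (\<lambda>x. \<psi> x * (grad (f b) x \<bullet> b))" if "b \<in> Basis" for b
    by (rule integrable_continuous_compact_support[OF _ K(1)])
       (use K(2) in \<open>auto intro!: continuous_intros test_functionsD(3)[OF \<psi>] fb_cont that\<close>)
  have int2: "integrable lborel (\<lambda>x. f b x * (grad \<psi> x \<bullet> b))" if "b \<in> Basis" for b
    by (rule integrable_continuous_compact_support[OF _ K(1)])
       (use K(2) in \<open>auto intro!: continuous_intros test_functionsD(4)[OF \<psi>] f_cont that\<close>)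
  have eq: "(\<integral>x. f b x * (grad \<psi> x \<bullet> b) \<partial>lborel) = - (\<integral>x. \<psi> x * (grad (f b) x \<bullet> b) \<partial>lborel)" if b: "b \<in> Basis" for b
  proof -
    have G: "GDERIV (\<lambda>x. \<psi> x * f b x) x :> \<psi> x *\<^sub>R grad (f b) x + f b x *\<^sub>R grad \<psi> x" for x
      by (intro GDERIV_mult test_functionsD(2)[OF \<psi>] fG b)
    have "(\<integral>x. b \<bullet> (\<psi> x *\<^sub>R grad (f b) x + f b x *\<^sub>R grad \<psi> x) \<partial>lborel) = 0"
    proof (rule integral_directional_derivative_eq_0[where F = "\<lambda>x. \<psi> x * f b x" and b = b
          and F' = "\<lambda>x h. h \<bullet> (\<psi> x *\<^sub>R grad (f b) x + f b x *\<^sub>R grad \<psi> x)", OF _ _ K(1)])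
      show "((\<lambda>x. \<psi> x * f b x) has_derivative (\<lambda>h. h \<bullet> (\<psi> x *\<^sub>R grad (f b) x + f b x *\<^sub>R grad \<psi> x))) (at x)" for x
        using G unfolding gderiv_def .
      have "continuous_on UNIV (\<lambda>x. \<psi> x * (grad (f b) x \<bullet> b) + f b x * (grad \<psi> x \<bullet> b))"
        by (intro continuous_intros test_functionsD(3,4)[OF \<psi>] f_cont fb_cont b)
      then show "continuous_on UNIV (\<lambda>x. b \<bullet> (\<psi> x *\<^sub>R grad (f b) x + f b x *\<^sub>R grad \<psi> x))"
        by (simp add: inner_add_right inner_commute)
      show "\<psi> x * f b x = 0" if "x \<notin> K" for x using K(2) that by simp
    qed
    also have "(\<lambda>x. b \<bullet> (\<psi> x *\<^sub>R grad (f b) x + f b x *\<^sub>R grad \<psi> x)) = (\<lambda>x. \<psi> x * (grad (f b) x \<bullet> b) + f b x * (grad \<psi> x \<bullet> b))"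
      by (simp add: inner_add_right inner_commute)
    finally show ?thesis using int1[OF b] int2[OF b] by simp
  qed
  have "(\<integral>x. w x * (grad \<phi> x \<bullet> grad \<psi> x) \<partial>lborel) = (\<integral>x. (\<Sum>b\<in>Basis. f b x * (grad \<psi> x \<bullet> b)) \<partial>lborel)"
  proof (rule Bochner_Integration.integral_cong)
    fix x
    have "w x * (grad \<phi> x \<bullet> grad \<psi> x) = w x * (\<Sum>b\<in>Basis. (grad \<phi> x \<bullet> b) * (grad \<psi> x \<bullet> b))"
      by (subst euclidean_inner) rule
    then show "w x * (grad \<phi> x \<bullet> grad \<psi> x) = (\<Sum>b\<in>Basis. f b x * (grad \<psi> x \<bullet> b))"
      by (simp only: f_def sum_distrib_left mult.assoc)
  qed rule
  also have "\<dots> = (\<Sum>b\<in>Basis. \<integral>x. f b x * (grad \<psi> x \<bullet> b) \<partial>lborel)"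
    by (rule Bochner_Integration.integral_sum[OF int2])
  also have "\<dots> = - (\<Sum>b\<in>Basis. \<integral>x. \<psi> x * (grad (f b) x \<bullet> b) \<partial>lborel)"
    by (simp add: eq sum_negf)
  also have "(\<Sum>b\<in>Basis. \<integral>x. \<psi> x * (grad (f b) x \<bullet> b) \<partial>lborel) = (\<integral>x. (\<Sum>b\<in>Basis. \<psi> x * (grad (f b) x \<bullet> b)) \<partial>lborel)"
    by (rule Bochner_Integration.integral_sum[OF int1, symmetric])
  finally show ?thesis
    by (simp add: f_def[abs_def] sum_distrib_left)
qed

text \<open>After integration by parts \<open>\<theta> n\<close> is paired with the divergence of \<open>w grad \<phi>\<close>, which is bounded
  and supported in the support of \<open>\<phi>\<close>; hence convergence in \<open>L\<^sup>1\<close> on that one compact set suffices.\<close>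

lemma gradient_pairing_tendsto_0:
  fixes \<phi> w :: "'a::euclidean_space \<Rightarrow> real"
  assumes \<phi>: "\<phi> \<in> test_functions \<Omega>" and \<theta>: "\<And>n. \<theta> n \<in> test_functions \<Omega>" and w: "C_k 1 w"
    and lim: "\<And>K. compact K \<Longrightarrow> K \<subseteq> \<Omega> \<Longrightarrow> (\<lambda>n. LINT x:K|lebesgue. \<bar>\<theta> n x\<bar>) \<longlonglongrightarrow> 0"
  shows "(\<lambda>n. \<integral>x. w x * (grad \<phi> x \<bullet> grad (\<theta> n) x) \<partial>lborel) \<longlonglongrightarrow> 0"
proof -
  obtain K where K: "compact K" "K \<subseteq> \<Omega>" "\<And>x. x \<notin> K \<Longrightarrow> \<phi> x = 0 \<and> grad \<phi> x = 0"
    using test_functionsD(5)[OF \<phi>] by blast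
  have [measurable]: "K \<in> sets borel" by (rule borel_compact[OF K(1)])
  note [measurable] = test_functions_measurable(1)[OF \<theta>]
  define D where "D x = (\<Sum>b\<in>Basis. grad (\<lambda>x. w x * (grad \<phi> x \<bullet> b)) x \<bullet> b)" for x
  have D_cont: "continuous_on UNIV D"
    unfolding D_def
  proof (rule continuous_on_sum)
    fix b :: 'a assume b: "b \<in> Basis"
    have "C_k (Suc 0) (\<lambda>x. w x * (grad \<phi> x \<bullet> b))"
      using C_k_SucD(2)[OF test_functionsD(1)[OF \<phi>, of "Suc 1"] b] w by (intro C_k_mult) auto
    from C_k_SucD(2)[OF this b] show "continuous_on UNIV (\<lambda>x. grad (\<lambda>x. w x * (grad \<phi> x \<bullet> b)) x \<bullet> b)"
      by simp
  qed
  have D0: "D x = 0" if "x \<notin> K" for x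
  proof -
    have "grad (\<lambda>x. w x * (grad \<phi> x \<bullet> b)) x = 0" for b
    proof (rule grad_eqI)
      have "((\<lambda>x. 0) has_derivative (\<lambda>h. h \<bullet> (0::'a))) (at x)" by simp
      then show "GDERIV (\<lambda>x. w x * (grad \<phi> x \<bullet> b)) x :> 0"
        unfolding gderiv_def
        by (rule has_derivative_transform_within_open[where s = "- K"])
           (use that K in \<open>auto simp: compact_imp_closed\<close>)
    qed
    then show ?thesis by (simp add: D_def)
  qed
  obtain M where M: "\<And>x. x \<in> K \<Longrightarrow> \<bar>D x\<bar> \<le> M"
    using compact_imp_bounded[OF compact_continuous_image[OF continuous_on_subset[OF D_cont] K(1)]]
    by (auto simp: bounded_iff)
  have DM: "\<bar>D x\<bar> \<le> indicator K x * \<bar>M\<bar>" for x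
    using M[of x] D0[of x] by (cases "x \<in> K") auto
  have bound: "\<bar>\<integral>x. w x * (grad \<phi> x \<bullet> grad (\<theta> n) x) \<partial>lborel\<bar> \<le> \<bar>M\<bar> * (LINT x:K|lebesgue. \<bar>\<theta> n x\<bar>)" for n
  proof -
    have K\<theta>: "integrable lborel (\<lambda>x. indicator K x * \<bar>\<theta> n x\<bar>)"
      using borel_integrable_compact[OF K(1), of "\<lambda>x. \<bar>\<theta> n x\<bar>"] continuous_on_subset[OF test_functionsD(3)[OF \<theta>[of n]]]
      by (auto intro: continuous_on_rabs)
    have "\<bar>\<integral>x. w x * (grad \<phi> x \<bullet> grad (\<theta> n) x) \<partial>lborel\<bar> = \<bar>\<integral>x. \<theta> n x * D x \<partial>lborel\<bar>"
      by (simp add: integration_by_parts_gradients[OF \<phi> \<theta> w] D_def)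
    also have "\<dots> \<le> (\<integral>x. \<bar>M\<bar> * (indicator K x * \<bar>\<theta> n x\<bar>) \<partial>lborel)"
    proof (rule order_trans[OF integral_abs_bound integral_mono])
      show "integrable lborel (\<lambda>x. \<bar>\<theta> n x * D x\<bar>)"
        by (intro integrable_abs integrable_continuous_compact_support[OF _ K(1)] continuous_intros D_cont test_functionsD(3)[OF \<theta>])
           (simp add: D0)
      show "integrable lborel (\<lambda>x. \<bar>M\<bar> * (indicator K x * \<bar>\<theta> n x\<bar>))" using K\<theta> by simp
      show "\<bar>\<theta> n x * D x\<bar> \<le> \<bar>M\<bar> * (indicator K x * \<bar>\<theta> n x\<bar>)" for x
        using mult_left_mono[OF DM[of x], of "\<bar>\<theta> n x\<bar>"] by (simp add: abs_mult mult_ac)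
    qed
    also have "\<dots> = \<bar>M\<bar> * (LINT x:K|lebesgue. \<bar>\<theta> n x\<bar>)"
      unfolding set_lebesgue_integral_def by (subst integral_completion) auto
    finally show ?thesis .
  qed
  have "(\<lambda>n. \<bar>M\<bar> * (LINT x:K|lebesgue. \<bar>\<theta> n x\<bar>)) \<longlonglongrightarrow> \<bar>M\<bar> * 0"
    by (intro tendsto_intros lim K)
  then have "(\<lambda>n. \<bar>M\<bar> * (LINT x:K|lebesgue. \<bar>\<theta> n x\<bar>)) \<longlonglongrightarrow> 0" by simp
  then show ?thesis
    by (rule Lim_null_comparison[rotated]) (simp add: bound)
qed

section \<open>Square-integrable functions\<close>

definition sq_integrable :: "'b measure \<Rightarrow> ('b \<Rightarrow> 'a::euclidean_space) \<Rightarrow> bool" where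
  "sq_integrable M f \<longleftrightarrow> f \<in> borel_measurable M \<and> integrable M (\<lambda>x. (norm (f x))\<^sup>2)"

definition l2 :: "'b measure \<Rightarrow> ('b \<Rightarrow> 'a::euclidean_space) \<Rightarrow> real" where
  "l2 M f = sqrt (\<integral>x. (norm (f x))\<^sup>2 \<partial>M)"

lemma l2_nonneg: "l2 M f \<ge> 0"
  by (simp add: l2_def)

lemma l2_sq: "(l2 M f)\<^sup>2 = (\<integral>x. (norm (f x))\<^sup>2 \<partial>M)"
  by (simp add: l2_def)

lemma l2_minus_commute: "l2 M (\<lambda>x. f x - g x) = l2 M (\<lambda>x. g x - f x)"
  by (simp add: l2_def norm_minus_commute)

lemma nn_integral_sq: "sq_integrable M f \<Longrightarrow> (\<integral>\<^sup>+x. ennreal ((norm (f x))\<^sup>2) \<partial>M) = ennreal ((l2 M f)\<^sup>2)"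
  unfolding l2_sq sq_integrable_def by (intro nn_integral_eq_integral) auto

lemma l2_Cauchy_Schwarz:
  assumes "sq_integrable M f" "sq_integrable M g"
  shows "integrable M (\<lambda>x. norm (f x) * norm (g x))"
    and "(\<integral>x. norm (f x) * norm (g x) \<partial>M) \<le> l2 M f * l2 M g"
proof -
  have [measurable]: "f \<in> borel_measurable M" "g \<in> borel_measurable M"
    using assms by (auto simp: sq_integrable_def)
  have "(\<integral>\<^sup>+x. ennreal (norm (f x)) * ennreal (norm (g x)) \<partial>M)\<^sup>2
      \<le> (\<integral>\<^sup>+x. ennreal (norm (f x)) ^ 2 \<partial>M) * (\<integral>\<^sup>+x. ennreal (norm (g x)) ^ 2 \<partial>M)"
    by (rule Cauchy_Schwarz_nn_integral) auto
  also have "\<dots> = (ennreal (l2 M f * l2 M g))\<^sup>2"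
    by (simp add: ennreal_power nn_integral_sq assms l2_nonneg ennreal_mult power_mult_distrib)
  finally have sq: "(\<integral>\<^sup>+x. ennreal (norm (f x)) * ennreal (norm (g x)) \<partial>M)\<^sup>2 \<le> (ennreal (l2 M f * l2 M g))\<^sup>2" .
  have *: "(\<integral>\<^sup>+x. ennreal (norm (f x) * norm (g x)) \<partial>M) \<le> ennreal (l2 M f * l2 M g)"
  proof (cases "(\<integral>\<^sup>+x. ennreal (norm (f x)) * ennreal (norm (g x)) \<partial>M)")
    case (real r)
    then have "ennreal (r\<^sup>2) \<le> ennreal ((l2 M f * l2 M g)\<^sup>2)"
      using sq by (simp add: ennreal_power l2_nonneg)
    then have "r\<^sup>2 \<le> (l2 M f * l2 M g)\<^sup>2"
      by (simp add: ennreal_le_iff)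
    then have "r \<le> l2 M f * l2 M g"
      by (rule power2_le_imp_le) (simp add: l2_nonneg)
    with real show ?thesis by (simp add: ennreal_mult ennreal_leI)
  next
    case top
    then show ?thesis
      using sq by (simp add: ennreal_power l2_nonneg top_unique)
  qed
  then have "(\<integral>\<^sup>+x. ennreal (norm (f x) * norm (g x)) \<partial>M) < \<infinity>"
    using le_less_trans by fastforce
  then show int: "integrable M (\<lambda>x. norm (f x) * norm (g x))"
    by (intro integrableI_nonneg) auto
  show "(\<integral>x. norm (f x) * norm (g x) \<partial>M) \<le> l2 M f * l2 M g"
    using * nn_integral_eq_integral[OF int] by (simp add: l2_nonneg)
qed

lemma sq_integrable_diff:
  assumes "sq_integrable M f" "sq_integrable M g"
  shows "sq_integrable M (\<lambda>x. f x - g x)"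
proof -
  have [measurable]: "f \<in> borel_measurable M" "g \<in> borel_measurable M"
    using assms by (auto simp: sq_integrable_def)
  have "integrable M (\<lambda>x. (norm (f x))\<^sup>2 + 2 * (norm (f x) * norm (g x)) + (norm (g x))\<^sup>2)"
    using assms l2_Cauchy_Schwarz(1)[OF assms] by (auto simp: sq_integrable_def)
  then have "integrable M (\<lambda>x. (norm (f x - g x))\<^sup>2)"
  proof (rule Bochner_Integration.integrable_bound)
    show "AE x in M. norm ((norm (f x - g x))\<^sup>2) \<le> norm ((norm (f x))\<^sup>2 + 2 * (norm (f x) * norm (g x)) + (norm (g x))\<^sup>2)"
    proof (intro AE_I2)
      fix x
      have "(norm (f x - g x))\<^sup>2 \<le> (norm (f x) + norm (g x))\<^sup>2"
        by (intro power_mono norm_triangle_ineq4) auto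
      then show "norm ((norm (f x - g x))\<^sup>2) \<le> norm ((norm (f x))\<^sup>2 + 2 * (norm (f x) * norm (g x)) + (norm (g x))\<^sup>2)"
        by (simp add: power2_sum algebra_simps)
    qed
  qed auto
  then show ?thesis by (auto simp: sq_integrable_def)
qed

lemma l2_triangle:
  assumes "sq_integrable M f" "sq_integrable M g"
  shows "l2 M (\<lambda>x. f x - g x) \<le> l2 M f + l2 M g"
proof -
  have "(l2 M (\<lambda>x. f x - g x))\<^sup>2 \<le> (\<integral>x. (norm (f x))\<^sup>2 + 2 * (norm (f x) * norm (g x)) + (norm (g x))\<^sup>2 \<partial>M)"
    unfolding l2_sq
  proof (rule integral_mono)
    show "(norm (f x - g x))\<^sup>2 \<le> (norm (f x))\<^sup>2 + 2 * (norm (f x) * norm (g x)) + (norm (g x))\<^sup>2" for x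
    proof -
      have "(norm (f x - g x))\<^sup>2 \<le> (norm (f x) + norm (g x))\<^sup>2"
        by (intro power_mono norm_triangle_ineq4) auto
      then show ?thesis by (simp add: power2_sum algebra_simps)
    qed
  qed (use assms l2_Cauchy_Schwarz(1)[OF assms] sq_integrable_diff[OF assms] in \<open>auto simp: sq_integrable_def\<close>)
  also have "\<dots> = (l2 M f)\<^sup>2 + 2 * (\<integral>x. norm (f x) * norm (g x) \<partial>M) + (l2 M g)\<^sup>2"
    using assms l2_Cauchy_Schwarz(1)[OF assms] by (simp add: l2_sq sq_integrable_def)
  also have "\<dots> \<le> (l2 M f + l2 M g)\<^sup>2"
    using l2_Cauchy_Schwarz(2)[OF assms] by (simp add: power2_sum)
  finally show ?thesis
    by (rule power2_le_imp_le) (simp add: l2_nonneg)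
qed

lemma l2_triangle3:
  assumes "sq_integrable M f" "sq_integrable M g" "sq_integrable M h"
  shows "l2 M (\<lambda>x. f x - h x) \<le> l2 M (\<lambda>x. f x - g x) + l2 M (\<lambda>x. g x - h x)"
proof -
  have "l2 M (\<lambda>x. (f x - g x) - (h x - g x)) \<le> l2 M (\<lambda>x. f x - g x) + l2 M (\<lambda>x. h x - g x)"
    by (intro l2_triangle sq_integrable_diff assms)
  then show ?thesis by (simp add: l2_minus_commute[of M h])
qed

lemma l2_diff_abs:
  assumes "sq_integrable M f" "sq_integrable M g"
  shows "\<bar>l2 M f - l2 M g\<bar> \<le> l2 M (\<lambda>x. f x - g x)"
proof -
  have z: "sq_integrable M (\<lambda>x. 0 :: 'b)" by (simp add: sq_integrable_def)
  show ?thesis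
    using l2_triangle3[OF assms z] l2_triangle3[OF assms(2,1) z] l2_minus_commute[of M f g] by simp
qed

definition l2_Cauchy :: "'b measure \<Rightarrow> (nat \<Rightarrow> 'b \<Rightarrow> 'a::euclidean_space) \<Rightarrow> bool" where
  "l2_Cauchy M f \<longleftrightarrow> (\<forall>e>0. \<exists>n0. \<forall>m\<ge>n0. \<forall>n\<ge>n0. l2 M (\<lambda>x. f m x - f n x) < e)"

lemma l2_Cauchy_convergent:
  assumes "l2_Cauchy M f" "\<And>n. sq_integrable M (f n)"
  shows "convergent (\<lambda>n. l2 M (f n))"
proof -
  have "Cauchy (\<lambda>n. l2 M (f n))"
    unfolding Cauchy_def dist_real_def
  proof (intro allI impI)
    fix e :: real assume "e > 0"
    then obtain n0 where "\<And>m n. m \<ge> n0 \<Longrightarrow> n \<ge> n0 \<Longrightarrow> l2 M (\<lambda>x. f m x - f n x) < e"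
      using assms(1) unfolding l2_Cauchy_def by blast
    then show "\<exists>n0. \<forall>m\<ge>n0. \<forall>n\<ge>n0. \<bar>l2 M (f m) - l2 M (f n)\<bar> < e"
      using l2_diff_abs[OF assms(2) assms(2)] le_less_trans by blast
  qed
  then show ?thesis by (rule Cauchy_convergent)
qed

lemma l2_limit_transfer:
  assumes "(\<lambda>n. l2 M (f n)) \<longlonglongrightarrow> l" "(\<lambda>n. l2 M (\<lambda>x. f n x - g n x)) \<longlonglongrightarrow> 0"
    and "\<And>n. sq_integrable M (f n)" "\<And>n. sq_integrable M (g n)"
  shows "(\<lambda>n. l2 M (g n)) \<longlonglongrightarrow> l"
proof -
  have "(\<lambda>n. l2 M (f n) - l2 M (g n)) \<longlonglongrightarrow> 0"
    by (rule Lim_null_comparison[OF _ assms(2)])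
       (use l2_diff_abs[OF assms(3,4)] in \<open>auto\<close>)
  from tendsto_diff[OF assms(1) this] show ?thesis by simp
qed

lemma l2_Cauchy_transfer:
  assumes f: "l2_Cauchy M f" and d: "(\<lambda>n. l2 M (\<lambda>x. f n x - g n x)) \<longlonglongrightarrow> 0"
    and int: "\<And>n. sq_integrable M (f n)" "\<And>n. sq_integrable M (g n)"
  shows "l2_Cauchy M g"
  unfolding l2_Cauchy_def
proof (intro allI impI)
  fix e :: real assume e: "e > 0"
  obtain n1 where n1: "\<And>m n. m \<ge> n1 \<Longrightarrow> n \<ge> n1 \<Longrightarrow> l2 M (\<lambda>x. f m x - f n x) < e / 3"
    using f e unfolding l2_Cauchy_def by (meson divide_pos_pos zero_less_numeral)
  have "eventually (\<lambda>n. l2 M (\<lambda>x. f n x - g n x) < e / 3) sequentially"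
    using e by (intro order_tendstoD(2)[OF d]) auto
  then obtain n2 where n2: "\<And>n. n \<ge> n2 \<Longrightarrow> l2 M (\<lambda>x. f n x - g n x) < e / 3"
    by (auto simp: eventually_sequentially)
  show "\<exists>n0. \<forall>m\<ge>n0. \<forall>n\<ge>n0. l2 M (\<lambda>x. g m x - g n x) < e"
  proof (intro exI allI impI)
    fix m n assume mn: "max n1 n2 \<le> m" "max n1 n2 \<le> n"
    have "l2 M (\<lambda>x. g m x - g n x) \<le> l2 M (\<lambda>x. g m x - f m x) + l2 M (\<lambda>x. f m x - g n x)"
      by (intro l2_triangle3 int)
    also have "l2 M (\<lambda>x. f m x - g n x) \<le> l2 M (\<lambda>x. f m x - f n x) + l2 M (\<lambda>x. f n x - g n x)"
      by (intro l2_triangle3 int)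
    also have "l2 M (\<lambda>x. g m x - f m x) = l2 M (\<lambda>x. f m x - g m x)"
      by (rule l2_minus_commute)
    finally show "l2 M (\<lambda>x. g m x - g n x) < e"
      using n1[of m n] n2[of m] n2[of n] mn by simp
  qed
qed

lemma l2_Cauchy_diff:
  assumes "l2_Cauchy M f" "l2_Cauchy M g" and int: "\<And>n. sq_integrable M (f n)" "\<And>n. sq_integrable M (g n)"
  shows "l2_Cauchy M (\<lambda>n x. f n x - g n x)"
  unfolding l2_Cauchy_def
proof (intro allI impI)
  fix e :: real assume "e > 0"
  then have e: "e / 2 > 0" by simp
  obtain n1 where n1: "\<And>m n. m \<ge> n1 \<Longrightarrow> n \<ge> n1 \<Longrightarrow> l2 M (\<lambda>x. f m x - f n x) < e / 2"
    using assms(1) e unfolding l2_Cauchy_def by blast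
  obtain n2 where n2: "\<And>m n. m \<ge> n2 \<Longrightarrow> n \<ge> n2 \<Longrightarrow> l2 M (\<lambda>x. g m x - g n x) < e / 2"
    using assms(2) e unfolding l2_Cauchy_def by blast
  have "l2 M (\<lambda>x. (f m x - g m x) - (f n x - g n x)) < e" if "m \<ge> max n1 n2" "n \<ge> max n1 n2" for m n
  proof -
    have "l2 M (\<lambda>x. (f m x - f n x) - (g m x - g n x)) \<le> l2 M (\<lambda>x. f m x - f n x) + l2 M (\<lambda>x. g m x - g n x)"
      by (intro l2_triangle sq_integrable_diff int)
    also have "(\<lambda>x. (f m x - f n x) - (g m x - g n x)) = (\<lambda>x. (f m x - g m x) - (f n x - g n x))"
      by (simp add: algebra_simps)
    finally show ?thesis using n1[of m n] n2[of m n] that by simp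
  qed
  then show "\<exists>n0. \<forall>m\<ge>n0. \<forall>n\<ge>n0. l2 M (\<lambda>x. f m x - g m x - (f n x - g n x)) < e" by blast
qed

section \<open>Finite-energy profiles on the half-line\<close>

text \<open>A profile \<open>u\<close> in the variable \<open>s\<close> with derivative \<open>p\<close>. It vanishes near \<open>s = 0\<close>, which is the boundary
  of the ball or infinity; as \<open>s \<rightarrow> \<infinity>\<close>, which is the origin, finite energy is the only condition.
  Both functions live on the whole line so that differentiability and Lebesgue integrals need
  no one-sided variants.\<close>

definition admissible :: "(real \<Rightarrow> real) \<Rightarrow> (real \<Rightarrow> real) \<Rightarrow> bool" where
  "admissible u p \<longleftrightarrow> continuous_on UNIV p \<and> (\<forall>s. (u has_real_derivative p s) (at s)) \<and>
     sq_integrable lborel p \<and> (\<exists>a>0. \<forall>s\<le>a. u s = 0 \<and> p s = 0)"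

lemma admissible_exists:
  assumes "continuous_on UNIV p" "sq_integrable lborel p" "a > 0" "\<And>s. s \<le> a \<Longrightarrow> p s = 0"
  shows "\<exists>u. admissible u p"
proof -
  obtain u where u: "\<And>s. (u has_real_derivative p s) (at s)" "u a = 0"
    using antiderivative_exists[OF assms(1)] by blast
  have "u s = 0" if "s \<le> a" for s
    using DERIV_zero_on_Iic[of u p a s] u assms that by simp
  then show ?thesis
    using u assms unfolding admissible_def
    by (intro exI[of _ u] conjI allI exI[of _ a] impI) auto
qed

lemma admissible_sq_integrable: "admissible u p \<Longrightarrow> sq_integrable lborel p"
  by (simp add: admissible_def)

lemma admissible_diff:
  assumes "admissible u p" "admissible v q"
  shows "admissible (\<lambda>s. u s - v s) (\<lambda>s. p s - q s)"
proof -
  obtain a where "0 < a" "\<And>s. s \<le> a \<Longrightarrow> u s = 0 \<and> p s = 0"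
    using assms(1) unfolding admissible_def by blast
  moreover obtain c where "0 < c" "\<And>s. s \<le> c \<Longrightarrow> v s = 0 \<and> q s = 0"
    using assms(2) unfolding admissible_def by blast
  ultimately have "\<exists>a>0. \<forall>s\<le>a. u s - v s = 0 \<and> p s - q s = 0"
    by (intro exI[of _ "min a c"]) auto
  then show ?thesis
    using assms unfolding admissible_def by (auto intro!: continuous_intros DERIV_diff sq_integrable_diff)
qed

lemma sq_integrable_continuous_support:
  fixes p :: "real \<Rightarrow> real"
  assumes p: "continuous_on UNIV p" and supp: "\<And>s. s \<notin> {a..b} \<Longrightarrow> p s = 0"
  shows "sq_integrable lborel p"
proof -
  have "integrable lborel (\<lambda>s. indicator {a..b} s *\<^sub>R (p s)\<^sup>2)"
    by (rule borel_integrable_compact) (auto intro!: continuous_intros continuous_on_subset[OF p])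
  also have "(\<lambda>s. indicator {a..b} s *\<^sub>R (p s)\<^sup>2) = (\<lambda>s. (p s)\<^sup>2)"
    using supp by (intro ext) (auto simp: indicator_def)
  finally show ?thesis
    using p by (simp add: sq_integrable_def borel_measurable_continuous_onI)
qed

text \<open>The derivative is cut off, not the profile: the truncated profile becomes constant for
  large \<open>s\<close> and so belongs to a function which is constant near the origin.\<close>

lemma admissible_truncation:
  assumes "admissible u p" "e > 0"
  shows "\<exists>v q b. admissible v q \<and> (\<forall>s\<ge>b. q s = 0) \<and> l2 lborel (\<lambda>s. p s - q s) < e"
proof -
  have cont: "continuous_on UNIV p" and int: "sq_integrable lborel p"
    using assms by (auto simp: admissible_def)
  obtain a where a: "0 < a" "\<And>s. s \<le> a \<Longrightarrow> u s = 0 \<and> p s = 0"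
    using assms(1) unfolding admissible_def by blast
  have [measurable]: "p \<in> borel_measurable borel"
    using cont by (rule borel_measurable_continuous_onI)
  \<comment> \<open>a continuous cut-off, equal to 1 up to \<open>n\<close> and to 0 from \<open>n + 1\<close> on\<close>
  define cut where "cut n s = max 0 (min 1 (real n + 1 - s))" for n s
  define q where "q n s = p s * cut n s" for n s
  have q_cont: "continuous_on UNIV (q n)" for n
    unfolding q_def cut_def by (intro continuous_intros cont)
  have [measurable]: "q n \<in> borel_measurable borel" for n
    using q_cont by (rule borel_measurable_continuous_onI)
  have "(\<lambda>n. \<integral>s. (p s - q n s)\<^sup>2 \<partial>lborel) \<longlonglongrightarrow> (\<integral>s. 0 \<partial>(lborel :: real measure))"
  proof (rule integral_dominated_convergence[where w = "\<lambda>s. (p s)\<^sup>2"])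
    show "integrable lborel (\<lambda>s. (p s)\<^sup>2)" using int by (simp add: sq_integrable_def)
    show "AE s in lborel. (\<lambda>n. (p s - q n s)\<^sup>2) \<longlonglongrightarrow> 0"
    proof (intro AE_I2 tendsto_eventually)
      fix s
      have "eventually (\<lambda>n. s \<le> real n) sequentially"
        using real_arch_simple[of s] by (metis (mono_tags, lifting) eventually_sequentiallyI of_nat_mono order_trans)
      then show "eventually (\<lambda>n. (p s - q n s)\<^sup>2 = 0) sequentially"
        by eventually_elim (simp add: q_def cut_def)
    qed
    show "AE s in lborel. norm ((p s - q n s)\<^sup>2) \<le> (p s)\<^sup>2" for n
    proof (intro AE_I2)
      fix s
      have "p s - q n s = p s * (1 - cut n s)" by (simp add: q_def algebra_simps)
      moreover have "0 \<le> 1 - cut n s" "1 - cut n s \<le> 1" by (auto simp: cut_def)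
      ultimately show "norm ((p s - q n s)\<^sup>2) \<le> (p s)\<^sup>2"
        by (simp add: power_mult_distrib mult_left_le power_le_one)
    qed
  qed auto
  then have "(\<lambda>n. sqrt (\<integral>s. (p s - q n s)\<^sup>2 \<partial>lborel)) \<longlonglongrightarrow> 0"
    using tendsto_real_sqrt by fastforce
  then have "eventually (\<lambda>n. sqrt (\<integral>s. (p s - q n s)\<^sup>2 \<partial>lborel) < e) sequentially"
    using assms(2) by (intro order_tendstoD(2))
  then obtain n where n: "sqrt (\<integral>s. (p s - q n s)\<^sup>2 \<partial>lborel) < e"
    using eventually_sequentially by auto
  have q0: "q n s = 0" if "s \<ge> real n + 1" for s
    using that by (simp add: q_def cut_def)
  have "sq_integrable lborel (q n)"
  proof (rule sq_integrable_continuous_support[OF q_cont])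
    show "q n s = 0" if "s \<notin> {a..real n + 1}" for s
      using that q0[of s] a(2)[of s] by (cases "s \<le> a") (auto simp: q_def[of n s])
  qed
  then obtain v where "admissible v (q n)"
    using admissible_exists[OF q_cont _ a(1)] a by (auto simp: q_def)
  then show ?thesis
    using q0 n by (auto simp: l2_def)
qed

text \<open>Cauchy-Schwarz on \<open>[0, s]\<close> gives the factor \<open>sqrt s\<close>. The linear bound is weaker but makes
  local integrability of \<open>s(|x|)\<close> enough later on.\<close>

lemma admissible_bound:
  assumes "admissible u p" "s \<ge> 0"
  shows "\<bar>u s\<bar> \<le> (1 + s) * l2 lborel p"
proof -
  have cont: "continuous_on UNIV p" and der: "\<And>s. (u has_real_derivative p s) (at s)" and u0: "u 0 = 0"
    using assms(1) unfolding admissible_def by (auto simp: less_imp_le)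
  have "u s - u 0 = (\<integral>t. p t * indicator {0..s} t \<partial>lborel)"
    using integral_FTC_Icc_real[of 0 s u p] assms(2) der cont
    by (simp add: continuous_on_eq_continuous_at)
  then have "\<bar>u s\<bar> \<le> (\<integral>t. norm (indicator {0..s} t :: real) * norm (p t) \<partial>lborel)"
    using u0 integral_norm_bound[of lborel "\<lambda>t. p t * indicator {0..s} t"] by (simp add: abs_mult mult.commute)
  have ind: "(\<lambda>t. (norm (indicator {0..s} t :: real))\<^sup>2) = (\<lambda>t. indicator {0..s} t)"
    by (auto simp: indicator_def)
  have ind_int: "sq_integrable lborel (indicator {0..s} :: real \<Rightarrow> real)"
    unfolding sq_integrable_def ind using assms(2) by (auto intro!: integrable_real_indicator)
  note \<open>\<bar>u s\<bar> \<le> _\<close>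
  also have "(\<integral>t. norm (indicator {0..s} t :: real) * norm (p t) \<partial>lborel) \<le> l2 lborel (indicator {0..s} :: real \<Rightarrow> real) * l2 lborel p"
    by (rule l2_Cauchy_Schwarz(2)[OF ind_int admissible_sq_integrable[OF assms(1)]])
  also have "l2 lborel (indicator {0..s} :: real \<Rightarrow> real) = sqrt s"
    using assms(2) unfolding l2_def ind by simp
  also have "sqrt s \<le> 1 + s"
    by (rule real_le_lsqrt[THEN order_trans[OF _ order_refl]]) (use assms(2) in \<open>auto simp: power2_sum\<close>)
  finally show ?thesis
    by (simp add: l2_nonneg mult_right_mono)
qed

text \<open>\<open>U\<close> and \<open>P\<close> witness that \<open>u\<close> belongs to the one-dimensional energy space to which both completions
  reduce. The notion mentions
  neither a domain nor a weight, which is what makes it transferable from one weight to the other.\<close>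

definition approximates :: "(real \<Rightarrow> real) \<Rightarrow> (nat \<Rightarrow> real \<Rightarrow> real) \<Rightarrow> (nat \<Rightarrow> real \<Rightarrow> real) \<Rightarrow> bool" where
  "approximates u U P \<longleftrightarrow> (\<forall>n. admissible (U n) (P n)) \<and> l2_Cauchy lborel P \<and>
     (AE s in lborel. s > 0 \<longrightarrow> (\<lambda>n. U n s) \<longlonglongrightarrow> u s)"

lemma approximates_perturb:
  assumes UP: "approximates u U P" and VQ: "\<And>n. admissible (V n) (Q n)"
    and d: "(\<lambda>n. l2 lborel (\<lambda>s. P n s - Q n s)) \<longlonglongrightarrow> 0"
  shows "approximates u V Q"
proof -
  have ad: "\<And>n. admissible (U n) (P n)" using UP by (simp add: approximates_def)
  have "l2_Cauchy lborel Q"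
    by (rule l2_Cauchy_transfer[OF _ d]) (use UP ad VQ in \<open>auto simp: approximates_def intro: admissible_sq_integrable\<close>)
  moreover have "(\<lambda>n. V n s) \<longlonglongrightarrow> u s" if "s > 0" "(\<lambda>n. U n s) \<longlonglongrightarrow> u s" for s
  proof -
    have "(\<lambda>n. (1 + s) * l2 lborel (\<lambda>s. P n s - Q n s)) \<longlonglongrightarrow> 0"
      using tendsto_mult[OF tendsto_const d, of "1 + s"] by simp
    then have "(\<lambda>n. U n s - V n s) \<longlonglongrightarrow> 0"
      by (rule Lim_null_comparison[rotated])
         (use admissible_bound[OF admissible_diff[OF ad VQ]] that in auto)
    from tendsto_diff[OF that(2) this] show ?thesis by simp
  qed
  ultimately show ?thesis
    using UP VQ unfolding approximates_def by (auto elim!: eventually_mono)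
qed

lemma l2_Cauchy_profile_converges:
  assumes ad: "\<And>n. admissible (U n) (P n)" and C: "l2_Cauchy lborel P" and s: "s \<ge> 0"
  shows "convergent (\<lambda>n. U n s)"
proof -
  have "Cauchy (\<lambda>n. U n s)"
    unfolding Cauchy_def dist_real_def
  proof (intro allI impI)
    fix e :: real assume "e > 0"
    then have "e / (1 + s) > 0" using s by simp
    then obtain n0 where n0: "\<And>m n. m \<ge> n0 \<Longrightarrow> n \<ge> n0 \<Longrightarrow> l2 lborel (\<lambda>x. P m x - P n x) < e / (1 + s)"
      using C unfolding l2_Cauchy_def by blast
    show "\<exists>n0. \<forall>m\<ge>n0. \<forall>n\<ge>n0. \<bar>U m s - U n s\<bar> < e"
    proof (intro exI allI impI)
      fix m n assume "n0 \<le> m" "n0 \<le> n"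
      then have "(1 + s) * l2 lborel (\<lambda>x. P m x - P n x) < e"
        using n0[of m n] s by (simp add: field_simps)
      with admissible_bound[OF admissible_diff[OF ad ad] s, of m n] show "\<bar>U m s - U n s\<bar> < e"
        by simp
    qed
  qed
  then show ?thesis by (rule Cauchy_convergent)
qed

section \<open>Differentiation under the integral sign\<close>

lemma continuous_under_integral:
  fixes f :: "real \<Rightarrow> 'b \<Rightarrow> real"
  assumes cont: "\<And>y. continuous_on S (\<lambda>s. f s y)"
    and meas: "\<And>s. s \<in> S \<Longrightarrow> f s \<in> borel_measurable M"
    and bound: "\<And>s y. s \<in> S \<Longrightarrow> \<bar>f s y\<bar> \<le> B y" and B: "integrable M B"
  shows "continuous_on S (\<lambda>s. \<integral>y. f s y \<partial>M)"
  unfolding continuous_on_sequentially o_def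
proof safe
  fix X s assume X: "\<forall>n. X n \<in> S" "X \<longlonglongrightarrow> s" and s: "s \<in> S"
  show "(\<lambda>n. \<integral>y. f (X n) y \<partial>M) \<longlonglongrightarrow> (\<integral>y. f s y \<partial>M)"
  proof (rule integral_dominated_convergence[OF _ _ B])
    show "AE y in M. (\<lambda>n. f (X n) y) \<longlonglongrightarrow> f s y"
      using cont X s unfolding continuous_on_sequentially o_def by auto
  qed (use meas X s bound in auto)
qed

text \<open>By the mean value theorem the bound on the derivative dominates the difference quotients.\<close>

lemma DERIV_under_integral:
  fixes f f' :: "real \<Rightarrow> 'b \<Rightarrow> real"
  assumes S: "s0 \<in> {c<..<d}"
    and der: "\<And>s y. s \<in> {c<..<d} \<Longrightarrow> ((\<lambda>s. f s y) has_real_derivative f' s y) (at s)"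
    and int: "\<And>s. s \<in> {c<..<d} \<Longrightarrow> integrable M (f s)"
    and meas: "f' s0 \<in> borel_measurable M"
    and bound: "\<And>s y. s \<in> {c<..<d} \<Longrightarrow> \<bar>f' s y\<bar> \<le> B y" and B: "integrable M B"
  shows "((\<lambda>s. \<integral>y. f s y \<partial>M) has_real_derivative (\<integral>y. f' s0 y \<partial>M)) (at s0)"
proof -
  have quot: "\<bar>(f t y - f s0 y) / (t - s0)\<bar> \<le> B y" if "t \<in> {c<..<d} - {s0}" for t y
  proof -
    have t: "t \<in> {c<..<d}" "t \<noteq> s0" using that by auto
    have "\<exists>z\<in>{c<..<d}. f t y - f s0 y = (t - s0) * f' z y"
    proof (cases "t < s0")
      case True
      have "\<exists>z. t < z \<and> z < s0 \<and> f s0 y - f t y = (s0 - t) * f' z y"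
        by (rule MVT2[OF True]) (use t S der in auto)
      then obtain z where "t < z" "z < s0" "f s0 y - f t y = (s0 - t) * f' z y" by blast
      then show ?thesis using t S by (intro bexI[of _ z]) (auto simp: algebra_simps)
    next
      case False
      then have "s0 < t" using t by simp
      then have "\<exists>z. s0 < z \<and> z < t \<and> f t y - f s0 y = (t - s0) * f' z y"
        by (rule MVT2) (use t S der in auto)
      then show ?thesis using t S by auto
    qed
    then obtain z where "z \<in> {c<..<d}" "f t y - f s0 y = (t - s0) * f' z y" by blast
    then show ?thesis using t bound[of z y] by simp
  qed
  have "((\<lambda>t. ((\<integral>y. f t y \<partial>M) - (\<integral>y. f s0 y \<partial>M)) / (t - s0)) \<longlongrightarrow> (\<integral>y. f' s0 y \<partial>M)) (at s0 within {c<..<d})"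
    unfolding tendsto_at_iff_sequentially o_def
  proof (intro allI impI)
    fix X :: "nat \<Rightarrow> real" assume X: "\<forall>n. X n \<in> {c<..<d} - {s0}" "X \<longlonglongrightarrow> s0"
    have "(\<lambda>n. \<integral>y. (f (X n) y - f s0 y) / (X n - s0) \<partial>M) \<longlonglongrightarrow> (\<integral>y. f' s0 y \<partial>M)"
    proof (rule integral_dominated_convergence[OF _ _ B])
      show "AE y in M. (\<lambda>n. (f (X n) y - f s0 y) / (X n - s0)) \<longlonglongrightarrow> f' s0 y"
      proof (intro AE_I2)
        fix y
        have "((\<lambda>t. (f t y - f s0 y) / (t - s0)) \<longlongrightarrow> f' s0 y) (at s0)"
          using der[OF S, of y] by (simp add: has_field_derivative_iff)
        then show "(\<lambda>n. (f (X n) y - f s0 y) / (X n - s0)) \<longlonglongrightarrow> f' s0 y"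
          by (rule filterlim_compose) (use X in \<open>auto simp: filterlim_at\<close>)
      qed
      show "AE y in M. norm ((f (X n) y - f s0 y) / (X n - s0)) \<le> B y" for n
        using quot X by auto
      show "(\<lambda>y. (f (X n) y - f s0 y) / (X n - s0)) \<in> borel_measurable M" for n
        using int[of "X n"] int[OF S] X(1) by (auto intro!: borel_measurable_divide borel_measurable_diff dest: borel_measurable_integrable)
    qed (rule meas)
    moreover have "(\<integral>y. (f (X n) y - f s0 y) / (X n - s0) \<partial>M) = ((\<integral>y. f (X n) y \<partial>M) - (\<integral>y. f s0 y \<partial>M)) / (X n - s0)" for n
    proof -
      have "X n \<in> {c<..<d}" using X(1) by blast
      from Bochner_Integration.integral_diff[OF int[OF this] int[OF S]] show ?thesis by simp
    qed
    ultimately show "(\<lambda>n. ((\<integral>y. f (X n) y \<partial>M) - (\<integral>y. f s0 y \<partial>M)) / (X n - s0)) \<longlonglongrightarrow> (\<integral>y. f' s0 y \<partial>M)"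
      by (simp only:)
  qed
  moreover have "at s0 within {c<..<d} = at s0"
    by (rule at_within_open[OF S]) simp
  ultimately show ?thesis
    by (simp add: has_field_derivative_iff)
qed

section \<open>Radial weights\<close>

lemma shell_finite: "emeasure lborel (shell :: 'a::euclidean_space set) < \<infinity>"
  by (rule emeasure_bounded_finite) (auto simp: shell_def bounded_iff)

lemma emeasure_shell: "emeasure lborel (shell :: 'a::euclidean_space set) = ennreal (measure lborel (shell :: 'a set))"
  using shell_finite[where 'a = 'a] by (simp add: emeasure_eq_ennreal_measure)

lemma measure_shell_pos: "measure lborel (shell :: 'a::euclidean_space set) > 0"
proof -
  obtain b :: 'a where b: "b \<in> Basis" using nonempty_Basis by blast
  have "ball ((3/2) *\<^sub>R b) (1/2) \<subseteq> (shell :: 'a set)"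
  proof
    fix y assume "y \<in> ball ((3/2) *\<^sub>R b) (1/2)"
    then have "norm ((3/2) *\<^sub>R b - y) < 1/2" by (simp add: dist_norm)
    moreover have "norm ((3/2) *\<^sub>R b) = 3/2" using b by simp
    ultimately show "y \<in> shell"
      unfolding shell_def using norm_triangle_ineq3[of "(3/2) *\<^sub>R b" y] by auto
  qed
  then have "measure lborel (ball ((3/2) *\<^sub>R b) (1/2) :: 'a set) \<le> measure lborel (shell :: 'a set)"
    by (intro measure_mono_fmeasurable fmeasurableI shell_finite) auto
  then show ?thesis
    by (rule less_le_trans[rotated]) (simp add: content_ball_pos)
qed

definition polar_factor :: "nat \<Rightarrow> real" where
  "polar_factor n = enn2real (polar_const n)"

lemma polar_const_eq: "polar_const n = ennreal (polar_factor n)"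
  using polar_const_finite[of n] by (simp add: polar_factor_def)

lemma polar_factor_pos: "polar_factor n > 0"
  using polar_const_pos[of n] by (simp add: polar_const_eq)

text \<open>The parameter \<open>s\<close> is chosen so that the energy of a radial function is \<open>\<integral> u'(s)\<^sup>2 ds\<close> up to a
  constant: this is the equation for \<open>\<rho>\<close>. The approximating weights of the last assumption serve to
  integrate by parts across the origin, where \<open>\<rho>\<close> may be singular.\<close>

locale radial_weight =
  fixes \<Omega> :: "'a::euclidean_space set" and \<rho> :: "'a \<Rightarrow> real" and r r' \<sigma> :: "real \<Rightarrow> real" and \<kappa> :: real
  assumes open_\<Omega>: "open \<Omega>" and zero_\<Omega>: "0 \<in> \<Omega>"
    and \<Omega>_iff: "\<And>x. x \<noteq> 0 \<Longrightarrow> x \<in> \<Omega> \<longleftrightarrow> norm x \<in> r ` {0<..}"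
    and r_pos: "\<And>s. s > 0 \<Longrightarrow> r s > 0"
    and r_deriv: "\<And>s. s > 0 \<Longrightarrow> (r has_real_derivative r' s) (at s)"
    and r'_neg: "\<And>s. s > 0 \<Longrightarrow> r' s < 0"
    and r'_cont: "continuous_on {0<..} r'"
    and \<sigma>_r: "\<And>s. s > 0 \<Longrightarrow> \<sigma> (r s) = s"
    and \<sigma>_cont: "continuous_on (r ` {0<..}) \<sigma>"
    and \<kappa>_pos: "\<kappa> > 0"
    and \<rho>_eq: "\<And>s x. s > 0 \<Longrightarrow> norm x = r s \<Longrightarrow> \<rho> x * r s ^ (DIM('a) - 1) = - \<kappa> * r' s"
    and \<rho>_meas [measurable]: "\<rho> \<in> borel_measurable borel"
    and \<rho>_nonneg: "\<And>x. \<rho> x \<ge> 0"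
    and \<rho>_int: "\<And>K. compact K \<Longrightarrow> K \<subseteq> \<Omega> \<Longrightarrow> set_integrable lborel K \<rho>"
    and \<sigma>_int: "\<And>K. compact K \<Longrightarrow> K \<subseteq> \<Omega> \<Longrightarrow> set_integrable lborel K (\<lambda>x. \<sigma> (norm x))"
    and \<rho>_approx: "\<exists>\<rho>'. (\<forall>k. C_k 1 (\<rho>' k)) \<and> (\<forall>k x. x \<in> \<Omega> - {0} \<longrightarrow> 0 \<le> \<rho>' k x \<and> \<rho>' k x \<le> \<rho> x)
        \<and> (\<forall>x\<in>\<Omega> - {0}. (\<lambda>k. \<rho>' k x) \<longlonglongrightarrow> \<rho> x)"
begin

lemma r_cont: "continuous_on {0<..} r"
  by (intro DERIV_continuous_on[of _ r r']) (auto intro: r_deriv has_field_derivative_at_within)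

lemma r_antimono: "0 < s \<Longrightarrow> s < t \<Longrightarrow> r t < r s"
  by (rule DERIV_neg_imp_decreasing[of s t r]) (use r_deriv r'_neg in \<open>meson order_less_le_trans\<close>)+

lemma r_antimono_le: "0 < s \<Longrightarrow> s \<le> t \<Longrightarrow> r t \<le> r s"
  using r_antimono[of s t] by (cases "s = t") auto

lemma r_le_iff: "0 < s \<Longrightarrow> 0 < t \<Longrightarrow> r s \<le> r t \<longleftrightarrow> t \<le> s"
  using r_antimono[of s t] r_antimono_le[of t s] by linarith

lemma \<Omega>_polar: "x \<in> \<Omega> \<Longrightarrow> x \<noteq> 0 \<Longrightarrow> \<sigma> (norm x) > 0 \<and> r (\<sigma> (norm x)) = norm x"
  using \<Omega>_iff \<sigma>_r by force

lemma \<Omega>_I: "s > 0 \<Longrightarrow> norm x = r s \<Longrightarrow> x \<in> \<Omega> - {0}"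
  using \<Omega>_iff[of x] r_pos[of s] by (metis DiffI greaterThan_iff image_eqI norm_zero order_less_irrefl singletonD)

lemma r_image_open: "open (r ` {0<..})"
proof -
  \<comment> \<open>on a fixed ray, the radii of \<open>\<Omega>\<close> form a preimage of \<open>\<Omega>\<close>\<close>
  obtain b :: 'a where b: "b \<in> Basis" using nonempty_Basis by blast
  have "r ` {0<..} = {0<..} \<inter> (\<lambda>t. t *\<^sub>R b) -` \<Omega>"
  proof -
    have "t \<in> r ` {0<..} \<longleftrightarrow> t > 0 \<and> t *\<^sub>R b \<in> \<Omega>" for t
      using b r_pos \<Omega>_iff[of "t *\<^sub>R b"] by (cases "t > 0") (auto simp: nonzero_Basis)
    then show ?thesis by blast
  qed
  moreover have "open ((\<lambda>t. t *\<^sub>R b) -` \<Omega>)"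
    by (intro open_vimage open_\<Omega> continuous_intros)
  ultimately show ?thesis by auto
qed

lemma cball_subset: 
  assumes "s > 0"
  shows "cball 0 (r s) \<subseteq> \<Omega>"
proof
  fix y :: 'a assume y: "y \<in> cball 0 (r s)"
  show "y \<in> \<Omega>"
  proof (cases "y = 0")
    case False
    obtain e where e: "e > 0" "ball 0 e \<subseteq> \<Omega>"
      using open_\<Omega> zero_\<Omega> open_contains_ball by blast
    \<comment> \<open>a point of \<open>\<Omega>\<close> on the ray through \<open>y\<close> with smaller norm; the intermediate value theorem applies between it and \<open>r s\<close>\<close>
    define x where "x = (min (1/2) (e / (2 * norm y))) *\<^sub>R y"
    have nx: "norm x = min (norm y / 2) (e / 2)"
      using False e(1) by (simp add: x_def min_mult_distrib_right)
    then have "x \<in> \<Omega>" "x \<noteq> 0" "norm x \<le> norm y"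
      using e False by (auto simp: min_def split: if_splits)
    then obtain t where t: "t > 0" "norm x = r t"
      using \<Omega>_iff[of x] by auto
    have "s \<le> t" using r_le_iff[of t s] t assms \<open>norm x \<le> norm y\<close> y by simp
    have "\<exists>z\<ge>s. z \<le> t \<and> r z = norm y"
      by (rule IVT2') (use t \<open>norm x \<le> norm y\<close> y assms \<open>s \<le> t\<close> in \<open>auto intro!: continuous_on_subset[OF r_cont]\<close>)
    then obtain z where "z \<ge> s" "r z = norm y" by blast
    then show ?thesis using \<Omega>_I[of z y] assms by simp
  qed (simp add: zero_\<Omega>)
qed

lemma AE_nonzero: "AE x in lborel. x \<noteq> (0::'a)"
  by (rule AE_lborel_singleton)

lemma nn_integral_polar_weighted:
  fixes h :: "'a \<Rightarrow> ennreal"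
  assumes [measurable]: "h \<in> borel_measurable borel"
  shows "(\<integral>\<^sup>+s. indicator {0<..} s * ennreal (- r' s) * (\<integral>\<^sup>+y. indicator (shell :: 'a set) y
            * ennreal (r s ^ (DIM('a) - 1)) * h (r s *\<^sub>R sgn y) \<partial>lborel) \<partial>lborel)
         = ennreal (polar_factor DIM('a)) * (\<integral>\<^sup>+x. indicator \<Omega> x * h x \<partial>lborel)"
proof -
  have [measurable]: "\<Omega> \<in> sets borel" using open_\<Omega> by simp
  define k where "k t = (\<integral>\<^sup>+y. indicator (shell :: 'a set) y * ennreal (t ^ (DIM('a) - 1)) * h (t *\<^sub>R sgn y) \<partial>lborel)" for t
  have [measurable]: "k \<in> borel_measurable borel"
    unfolding k_def by measurable
  have "ennreal (polar_factor DIM('a)) * (\<integral>\<^sup>+x. indicator \<Omega> x * h x \<partial>lborel)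
     = (\<integral>\<^sup>+t. \<integral>\<^sup>+y. indicator {0<..} t * indicator (shell :: 'a set) y
            * ennreal (t ^ (DIM('a) - 1)) * (indicator \<Omega> (t *\<^sub>R sgn y) * h (t *\<^sub>R sgn y)) \<partial>lborel \<partial>lborel)"
    by (subst nn_integral_polar) (auto simp: polar_const_eq)
  also have "\<dots> = (\<integral>\<^sup>+t. indicator (r ` {0<..}) t * k t \<partial>lborel)"
  proof (rule nn_integral_cong)
    fix t :: real
    have *: "indicator {0<..} t * indicator shell y * ennreal (t ^ (DIM('a) - 1)) * (indicator \<Omega> (t *\<^sub>R sgn y) * h (t *\<^sub>R sgn y))
      = indicator (r ` {0<..}) t * (indicator shell y * ennreal (t ^ (DIM('a) - 1)) * h (t *\<^sub>R sgn y))" for y :: 'a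
    proof (cases "t > 0 \<and> y \<in> shell")
      case True
      then have "norm (t *\<^sub>R sgn y) = t" "t *\<^sub>R sgn y \<noteq> 0"
        by (auto simp: shell_def norm_sgn sgn_zero_iff)
      then have "t *\<^sub>R sgn y \<in> \<Omega> \<longleftrightarrow> t \<in> r ` {0<..}"
        using \<Omega>_iff[of "t *\<^sub>R sgn y"] by simp
      then show ?thesis using True by (auto split: split_indicator)
    next
      case False
      then show ?thesis using r_pos by (auto split: split_indicator)
    qed
    show "(\<integral>\<^sup>+y. indicator {0<..} t * indicator shell y * ennreal (t ^ (DIM('a) - 1)) * (indicator \<Omega> (t *\<^sub>R sgn y) * h (t *\<^sub>R sgn y)) \<partial>lborel)
       = indicator (r ` {0<..}) t * k t"
      unfolding * k_def by (rule nn_integral_cmult) measurable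
  qed
  also have "\<dots> = (\<integral>\<^sup>+s. indicator {0<..} s * ennreal (- r' s) * k (r s) \<partial>lborel)"
    by (rule nn_integral_substitution_antimono) (auto intro: r_deriv r'_neg r'_cont)
  finally show ?thesis
    unfolding k_def ..
qed

text \<open>The functions \<open>r\<close> and \<open>r'\<close> are only known on the half-line, so their values elsewhere are
  replaced by zero.\<close>

lemma half_line_measurable:
  fixes k :: "real \<Rightarrow> ennreal"
  assumes [measurable]: "k \<in> borel_measurable borel"
  shows "(\<lambda>s. indicator {0<..} s * ennreal (- r' s) * k (r s)) \<in> borel_measurable borel"
proof -
  have [measurable]: "(\<lambda>s. indicator {0<..} s *\<^sub>R r s) \<in> borel_measurable borel"
    "(\<lambda>s. indicator {0<..} s *\<^sub>R r' s) \<in> borel_measurable borel"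
    by (intro borel_measurable_continuous_on_indicator r_cont r'_cont; simp)+
  have "(\<lambda>s. indicator {0<..} s * ennreal (- (indicator {0<..} s *\<^sub>R r' s)) * k (indicator {0<..} s *\<^sub>R r s)) \<in> borel_measurable borel"
    by measurable
  also have "(\<lambda>s. indicator {0<..} s * ennreal (- (indicator {0<..} s *\<^sub>R r' s)) * k (indicator {0<..} s *\<^sub>R r s))
    = (\<lambda>s. indicator {0<..} s * ennreal (- r' s) * k (r s))"
    by (auto split: split_indicator)
  finally show ?thesis .
qed

text \<open>For a radial integrand the integral over directions is the measure of the shell.\<close>

lemma nn_integral_radial:
  fixes h :: "'a \<Rightarrow> ennreal" and H :: "real \<Rightarrow> ennreal"
  assumes [measurable]: "h \<in> borel_measurable borel"
    and [measurable]: "(\<lambda>s. indicator {0<..} s * H s) \<in> borel_measurable borel"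
    and H: "\<And>s x. s > 0 \<Longrightarrow> norm x = r s \<Longrightarrow> ennreal (r s ^ (DIM('a) - 1) * (- r' s)) * h x = H s"
  shows "ennreal (measure lborel (shell :: 'a set)) * (\<integral>\<^sup>+s. indicator {0<..} s * H s \<partial>lborel) = ennreal (polar_factor DIM('a)) * (\<integral>\<^sup>+x. indicator \<Omega> x * h x \<partial>lborel)"
proof -
  have "(\<integral>\<^sup>+s. indicator {0<..} s * ennreal (- r' s) * (\<integral>\<^sup>+y. indicator (shell :: 'a set) y
            * ennreal (r s ^ (DIM('a) - 1)) * h (r s *\<^sub>R sgn y) \<partial>lborel) \<partial>lborel)
      = (\<integral>\<^sup>+s. ennreal (measure lborel (shell :: 'a set)) * (indicator {0<..} s * H s) \<partial>lborel)"
  proof (rule nn_integral_cong)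
    fix s :: real
    show "indicator {0<..} s * ennreal (- r' s) * (\<integral>\<^sup>+y. indicator (shell :: 'a set) y
            * ennreal (r s ^ (DIM('a) - 1)) * h (r s *\<^sub>R sgn y) \<partial>lborel) = ennreal (measure lborel (shell :: 'a set)) * (indicator {0<..} s * H s)"
    proof (cases "s > 0")
      case True
      have "ennreal (- r' s) * (\<integral>\<^sup>+y. indicator (shell :: 'a set) y
            * ennreal (r s ^ (DIM('a) - 1)) * h (r s *\<^sub>R sgn y) \<partial>lborel)
          = (\<integral>\<^sup>+y. ennreal (- r' s) * (indicator (shell :: 'a set) y
            * ennreal (r s ^ (DIM('a) - 1)) * h (r s *\<^sub>R sgn y)) \<partial>lborel)"
        by (rule nn_integral_cmult[symmetric]) measurable
      also have "\<dots> = (\<integral>\<^sup>+y. H s * indicator (shell :: 'a set) y \<partial>lborel)"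
      proof (rule nn_integral_cong)
        fix y :: 'a
        show "ennreal (- r' s) * (indicator (shell :: 'a set) y
            * ennreal (r s ^ (DIM('a) - 1)) * h (r s *\<^sub>R sgn y)) = H s * indicator (shell :: 'a set) y"
        proof (cases "y \<in> shell")
          case yT: True
          then have "norm (r s *\<^sub>R sgn y) = r s"
            using r_pos[OF True] by (auto simp: shell_def norm_sgn)
          note H[OF True this]
          moreover have "ennreal (r s ^ (DIM('a) - 1) * (- r' s)) = ennreal (r s ^ (DIM('a) - 1)) * ennreal (- r' s)"
            using r_pos[OF True] r'_neg[OF True] by (intro ennreal_mult) auto
          ultimately show ?thesis
            using yT by (simp add: mult_ac)
        qed simp
      qed
      also have "\<dots> = H s * ennreal (measure lborel (shell :: 'a set))"
        by (simp add: nn_integral_cmult_indicator emeasure_shell)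
      finally show ?thesis using True by (simp add: mult.commute)
    qed simp
  qed
  moreover have "(\<integral>\<^sup>+s. ennreal (measure lborel (shell :: 'a set)) * (indicator {0<..} s * H s) \<partial>lborel) = ennreal (measure lborel (shell :: 'a set)) * (\<integral>\<^sup>+s. indicator {0<..} s * H s \<partial>lborel)"
    by (rule nn_integral_cmult) simp
  ultimately show ?thesis
    using nn_integral_polar_weighted[OF assms(1)] by simp
qed

lemma \<Omega>_borel [measurable]: "\<Omega> \<in> sets borel"
  using open_\<Omega> by simp

section \<open>The Dirichlet norm as an L2 norm\<close>

text \<open>With the square root of the weight absorbed into the gradient, Dirichlet norms become plain
  \<open>L\<^sup>2\<close> norms, and \<open>wgrad\<close> is linear.\<close>

definition wgrad :: "('a \<Rightarrow> real) \<Rightarrow> 'a \<Rightarrow> 'a" where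
  "wgrad \<phi> x = (indicator \<Omega> x * sqrt (\<rho> x)) *\<^sub>R grad \<phi> x"

lemma norm_wgrad: "(norm (wgrad \<phi> x))\<^sup>2 = indicator \<Omega> x * (\<rho> x * (norm (grad \<phi> x))\<^sup>2)"
  using \<rho>_nonneg[of x] by (simp add: wgrad_def power_mult_distrib indicator_def)

lemma sq_integrable_wgrad:
  assumes "\<phi> \<in> test_functions \<Omega>"
  shows "sq_integrable lborel (wgrad \<phi>)"
proof -
  note [measurable] = test_functions_measurable(2)[OF assms]
  obtain K where K: "compact K" "K \<subseteq> \<Omega>" "\<And>x. x \<notin> K \<Longrightarrow> grad \<phi> x = 0"
    using test_functionsD(5)[OF assms] by blast
  have "compact (grad \<phi> ` K)"
    by (intro compact_continuous_image continuous_on_subset[OF test_functionsD(4)[OF assms]] K) auto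
  then obtain M where M: "\<And>x. x \<in> K \<Longrightarrow> norm (grad \<phi> x) \<le> M"
    using compact_imp_bounded[of "grad \<phi> ` K"] by (auto simp: bounded_iff)
  have "integrable lborel (\<lambda>x. M\<^sup>2 * (indicator K x *\<^sub>R \<rho> x))"
    using \<rho>_int[OF K(1,2)] by (auto simp: set_integrable_def)
  then have "integrable lborel (\<lambda>x. (norm (wgrad \<phi> x))\<^sup>2)"
  proof (rule Bochner_Integration.integrable_bound)
    show "(\<lambda>x. (norm (wgrad \<phi> x))\<^sup>2) \<in> borel_measurable lborel"
      unfolding norm_wgrad by measurable
    show "AE x in lborel. norm ((norm (wgrad \<phi> x))\<^sup>2) \<le> norm (M\<^sup>2 * (indicator K x *\<^sub>R \<rho> x))"
    proof (intro AE_I2)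
      fix x
      show "norm ((norm (wgrad \<phi> x))\<^sup>2) \<le> norm (M\<^sup>2 * (indicator K x *\<^sub>R \<rho> x))"
      proof (cases "x \<in> K")
        case True
        then have "\<rho> x * (norm (grad \<phi> x))\<^sup>2 \<le> \<rho> x * M\<^sup>2"
          using M \<rho>_nonneg by (intro mult_left_mono power_mono) auto
        then show ?thesis
          using True K(2) \<rho>_nonneg[of x] unfolding norm_wgrad by (auto simp: mult.commute)
      qed (simp add: norm_wgrad K)
    qed
  qed
  moreover have "wgrad \<phi> \<in> borel_measurable lborel"
    unfolding wgrad_def[abs_def] by measurable
  ultimately show ?thesis by (simp add: sq_integrable_def)
qed

lemma dirichlet_norm_eq_l2:
  assumes "\<phi> \<in> test_functions \<Omega>"
  shows "dirichlet_norm \<rho> \<Omega> \<phi> = l2 lborel (wgrad \<phi>)"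
proof -
  note [measurable] = test_functions_measurable(2)[OF assms]
  have "(LINT x:\<Omega>|lebesgue. \<rho> x * (norm (grad \<phi> x))\<^sup>2) = (\<integral>x. (norm (wgrad \<phi> x))\<^sup>2 \<partial>lborel)"
    unfolding set_lebesgue_integral_def norm_wgrad by (subst integral_completion) auto
  then show ?thesis by (simp add: dirichlet_norm_def l2_def)
qed

lemma wgrad_diff:
  assumes "\<phi> \<in> test_functions \<Omega>" "\<psi> \<in> test_functions \<Omega>"
  shows "wgrad (\<lambda>x. \<phi> x - \<psi> x) = (\<lambda>x. wgrad \<phi> x - wgrad \<psi> x)"
  by (auto simp: wgrad_def grad_diff[OF assms] scaleR_diff_right)

lemma dirichlet_Cauchy_iff:
  assumes "\<And>n. \<phi> n \<in> test_functions \<Omega>"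
  shows "(\<forall>e>0. \<exists>M. \<forall>m\<ge>M. \<forall>n\<ge>M. dirichlet_norm \<rho> \<Omega> (\<lambda>x. \<phi> m x - \<phi> n x) < e)
    \<longleftrightarrow> l2_Cauchy lborel (\<lambda>n. wgrad (\<phi> n))"
  by (simp add: l2_Cauchy_def dirichlet_norm_eq_l2 test_functions_diff assms wgrad_diff)

lemma nn_integral_energy:
  assumes "\<phi> \<in> test_functions \<Omega>"
  shows "(\<integral>\<^sup>+x. indicator \<Omega> x * ennreal (\<rho> x * (norm (grad \<phi> x))\<^sup>2) \<partial>lborel) = ennreal ((l2 lborel (wgrad \<phi>))\<^sup>2)"
  unfolding nn_integral_sq[OF sq_integrable_wgrad[OF assms], symmetric] norm_wgrad
  by (auto intro!: nn_integral_cong split: split_indicator)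

section \<open>Spherical means\<close>

text \<open>Spherical means are zero near \<open>s = 0\<close>, because the support of a test function keeps away from the
  boundary and from infinity; so continuing them by zero to \<open>s \<le> 0\<close> keeps them differentiable.\<close>

definition smean :: "('a \<Rightarrow> real) \<Rightarrow> real \<Rightarrow> real" where
  "smean \<phi> s = (if s > 0 then (\<integral>y. indicator shell y * \<phi> (r s *\<^sub>R sgn y) \<partial>lborel) / measure lborel (shell :: 'a set) else 0)"

definition dsmean :: "('a \<Rightarrow> real) \<Rightarrow> real \<Rightarrow> real" where
  "dsmean \<phi> s = (if s > 0 then (\<integral>y. indicator shell y * ((grad \<phi> (r s *\<^sub>R sgn y) \<bullet> sgn y) * r' s) \<partial>lborel)
      / measure lborel (shell :: 'a set) else 0)"

lemma norm_polar: "y \<in> shell \<Longrightarrow> s > 0 \<Longrightarrow> norm (r s *\<^sub>R sgn (y::'a)) = r s"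
  using r_pos[of s] by (auto simp: shell_def norm_sgn)

lemma integrable_on_shell:
  fixes f :: "'a \<Rightarrow> real"
  assumes [measurable]: "f \<in> borel_measurable borel" and B: "\<And>y. \<bar>f y\<bar> \<le> B"
  shows "integrable lborel (\<lambda>y. indicator shell y * f y)"
proof (rule Bochner_Integration.integrable_bound)
  show "integrable lborel (\<lambda>y. indicator (shell :: 'a set) y * B)"
    using shell_finite[where 'a = 'a] by (intro integrable_mult_left integrable_real_indicator) auto
  show "AE y in lborel. norm (indicator shell y * f y) \<le> norm (indicator (shell :: 'a set) y * B)"
    using B by (intro AE_I2) (auto split: split_indicator intro: order_trans[OF _ abs_ge_self])
qed measurable

lemma test_function_bounds:
  assumes "\<phi> \<in> test_functions \<Omega>"
  shows "\<exists>M\<ge>0. (\<forall>x. \<bar>\<phi> x\<bar> \<le> M) \<and> (\<forall>x. norm (grad \<phi> x) \<le> M)"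
proof -
  obtain K where K: "compact K" "\<And>x. x \<notin> K \<Longrightarrow> \<phi> x = 0 \<and> grad \<phi> x = 0"
    using test_functionsD(5)[OF assms] by blast
  have "compact (grad \<phi> ` K)" "compact (\<phi> ` K)"
    by (intro compact_continuous_image continuous_on_subset[OF test_functionsD(4)[OF assms]]
        continuous_on_subset[OF test_functionsD(3)[OF assms]] K; simp)+
  then obtain M1 M2 where M: "\<And>x. x \<in> K \<Longrightarrow> norm (grad \<phi> x) \<le> M1" "\<And>x. x \<in> K \<Longrightarrow> norm (\<phi> x) \<le> M2"
    using compact_imp_bounded[of "grad \<phi> ` K"] compact_imp_bounded[of "\<phi> ` K"] by (auto simp: bounded_iff)
  have "\<bar>\<phi> x\<bar> \<le> max 0 (max M1 M2) \<and> norm (grad \<phi> x) \<le> max 0 (max M1 M2)" for x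
    using M(1)[of x] M(2)[of x] K(2)[of x] by (cases "x \<in> K") auto
  then show ?thesis
    by (intro exI[of _ "max 0 (max M1 M2)"]) auto
qed

lemma DERIV_along_ray:
  assumes "\<phi> \<in> test_functions \<Omega>" "s > 0"
  shows "((\<lambda>s. \<phi> (r s *\<^sub>R e)) has_real_derivative (grad \<phi> (r s *\<^sub>R e) \<bullet> e) * r' s) (at s)"
proof -
  have "((\<lambda>s. r s *\<^sub>R e) has_derivative (\<lambda>h. (h * r' s) *\<^sub>R e)) (at s)"
    using r_deriv[OF assms(2)] unfolding has_field_derivative_def
    by (auto intro!: derivative_eq_intros simp: mult.commute)
  from has_derivative_compose[OF this] test_functionsD(2)[OF assms(1), of "r s *\<^sub>R e"]
  have "((\<lambda>s. \<phi> (r s *\<^sub>R e)) has_derivative (\<lambda>h. ((h * r' s) *\<^sub>R e) \<bullet> grad \<phi> (r s *\<^sub>R e))) (at s)"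
    unfolding gderiv_def by blast
  then show ?thesis
    unfolding has_field_derivative_def
    by (rule has_derivative_eq_rhs) (auto simp: mult_ac inner_commute)
qed

lemma ray_derivative_bound:
  "\<bar>(grad \<phi> (r s *\<^sub>R sgn y) \<bullet> sgn (y::'a)) * r' s\<bar> \<le> norm (grad \<phi> (r s *\<^sub>R sgn y)) * \<bar>r' s\<bar>"
proof -
  have "\<bar>grad \<phi> (r s *\<^sub>R sgn y) \<bullet> sgn y\<bar> \<le> norm (grad \<phi> (r s *\<^sub>R sgn y)) * norm (sgn y)"
    by (rule Cauchy_Schwarz_ineq2)
  also have "\<dots> \<le> norm (grad \<phi> (r s *\<^sub>R sgn y)) * 1"
    by (intro mult_left_mono) (auto simp: norm_sgn)
  finally show ?thesis by (simp add: abs_mult mult_right_mono)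
qed

lemma dsmean_integrand_bound:
  assumes "\<And>x. norm (grad \<phi> x) \<le> M"
  shows "\<bar>(grad \<phi> (r s *\<^sub>R sgn y) \<bullet> sgn (y::'a)) * r' s\<bar> \<le> M * \<bar>r' s\<bar>"
  using ray_derivative_bound[of \<phi> s y] assms[of "r s *\<^sub>R sgn y"]
  by (meson abs_ge_zero mult_right_mono order_trans)

lemma r'_locally_bounded:
  assumes "s0 > 0"
  shows "\<exists>c d B. 0 < c \<and> s0 \<in> {c<..<d} \<and> (\<forall>s\<in>{c<..<d}. \<bar>r' s\<bar> \<le> B)"
proof -
  have "compact (r' ` {s0/2..2 * s0})"
    using assms by (intro compact_continuous_image continuous_on_subset[OF r'_cont]) auto
  then obtain B where "\<And>s. s \<in> {s0/2..2 * s0} \<Longrightarrow> \<bar>r' s\<bar> \<le> B"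
    using compact_imp_bounded[of "r' ` {s0/2..2 * s0}"] by (metis bounded_iff image_eqI real_norm_def)
  then show ?thesis
    using assms by (intro exI[of _ "s0/2"] exI[of _ "2 * s0"] exI[of _ B]) auto
qed

lemma DERIV_smean:
  assumes \<phi>: "\<phi> \<in> test_functions \<Omega>" and s0: "s0 > 0"
  shows "(smean \<phi> has_real_derivative dsmean \<phi> s0) (at s0)"
proof -
  note [measurable] = test_functions_measurable[OF \<phi>]
  obtain M where M: "M \<ge> 0" "\<And>x. \<bar>\<phi> x\<bar> \<le> M" "\<And>x. norm (grad \<phi> x) \<le> M"
    using test_function_bounds[OF \<phi>] by blast
  obtain c d B where cd: "0 < c" "s0 \<in> {c<..<d}" "\<And>s. s \<in> {c<..<d} \<Longrightarrow> \<bar>r' s\<bar> \<le> B"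
    using r'_locally_bounded[OF s0] by blast
  have "((\<lambda>s. \<integral>y. indicator shell y * \<phi> (r s *\<^sub>R sgn y) \<partial>lborel) has_real_derivative
      (\<integral>y. indicator shell y * ((grad \<phi> (r s0 *\<^sub>R sgn y) \<bullet> sgn y) * r' s0) \<partial>lborel)) (at s0)"
  proof (rule DERIV_under_integral[OF cd(2), where B = "\<lambda>y. indicator shell y * (M * B)"])
    show "((\<lambda>s. indicator shell y * \<phi> (r s *\<^sub>R sgn y)) has_real_derivative
        indicator shell y * ((grad \<phi> (r s *\<^sub>R sgn y) \<bullet> sgn y) * r' s)) (at s)" if "s \<in> {c<..<d}" for s y
      using DERIV_along_ray[OF \<phi>, of s "sgn y"] that cd(1) by (intro DERIV_cmult) auto
    show "integrable lborel (\<lambda>y. indicator shell y * \<phi> (r s *\<^sub>R sgn y))" for s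
      by (rule integrable_on_shell) (use M(2) in auto)
    show "\<bar>indicator shell y * ((grad \<phi> (r s *\<^sub>R sgn y) \<bullet> sgn y) * r' s)\<bar> \<le> indicator shell y * (M * B)"
      if "s \<in> {c<..<d}" for s y
      using order_trans[OF dsmean_integrand_bound[OF M(3), of s y] mult_left_mono[OF cd(3)[OF that] M(1)]]
      by (auto split: split_indicator)
    show "integrable lborel (\<lambda>y::'a. indicator shell y * (M * B))"
      by (rule integrable_on_shell) auto
  qed auto
  from DERIV_cdivide[OF this, of "measure lborel (shell :: 'a set)"]
  have "((\<lambda>s. (\<integral>y. indicator shell y * \<phi> (r s *\<^sub>R sgn y) \<partial>lborel) / measure lborel (shell :: 'a set))
      has_real_derivative dsmean \<phi> s0) (at s0)"
    using s0 by (simp add: dsmean_def)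
  then show ?thesis
    by (rule has_field_derivative_transform_within_open[where S = "{0<..}"])
       (use s0 in \<open>auto simp: smean_def\<close>)
qed

lemma dsmean_continuous:
  assumes \<phi>: "\<phi> \<in> test_functions \<Omega>"
  shows "continuous_on {0<..} (dsmean \<phi>)"
proof -
  note [measurable] = test_functions_measurable[OF \<phi>]
  obtain M where M: "M \<ge> 0" "\<And>x. \<bar>\<phi> x\<bar> \<le> M" "\<And>x. norm (grad \<phi> x) \<le> M"
    using test_function_bounds[OF \<phi>] by blast
  have "continuous (at s0) (dsmean \<phi>)" if s0: "s0 > 0" for s0
  proof -
    obtain c d B where cd: "0 < c" "s0 \<in> {c<..<d}" "\<And>s. s \<in> {c<..<d} \<Longrightarrow> \<bar>r' s\<bar> \<le> B"
      using r'_locally_bounded[OF s0] by blast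
    have "continuous_on {c<..<d} (\<lambda>s. \<integral>y. indicator shell y * ((grad \<phi> (r s *\<^sub>R sgn y) \<bullet> sgn y) * r' s) \<partial>lborel)"
    proof (rule continuous_under_integral[where B = "\<lambda>y. indicator shell y * (M * B)"])
      show "continuous_on {c<..<d} (\<lambda>s. indicator shell y * ((grad \<phi> (r s *\<^sub>R sgn y) \<bullet> sgn y) * r' s))" for y
        by (intro continuous_intros continuous_on_compose2[OF test_functionsD(4)[OF \<phi>]]
            continuous_on_subset[OF r'_cont] continuous_on_subset[OF r_cont]) (use cd(1) in auto)
      show "\<bar>indicator shell y * ((grad \<phi> (r s *\<^sub>R sgn y) \<bullet> sgn y) * r' s)\<bar> \<le> indicator shell y * (M * B)"
        if "s \<in> {c<..<d}" for s y
        using order_trans[OF dsmean_integrand_bound[OF M(3), of s y] mult_left_mono[OF cd(3)[OF that] M(1)]]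
        by (auto split: split_indicator)
      show "integrable lborel (\<lambda>y::'a. indicator shell y * (M * B))"
        by (rule integrable_on_shell) auto
    qed auto
    then have "continuous_on {c<..<d} (\<lambda>s. (\<integral>y. indicator shell y * ((grad \<phi> (r s *\<^sub>R sgn y) \<bullet> sgn y) * r' s) \<partial>lborel) / measure lborel (shell :: 'a set))"
      using measure_shell_pos[where 'a = 'a] by (intro continuous_intros) auto
    then have "continuous_on {c<..<d} (dsmean \<phi>)"
      by (rule continuous_on_eq) (use cd(1) in \<open>auto simp: dsmean_def\<close>)
    then show ?thesis
      using cd(2) by (simp add: continuous_on_eq_continuous_at)
  qed
  then show ?thesis
    by (simp add: continuous_at_imp_continuous_on)
qed

text \<open>A point of largest norm in \<open>K\<close> still lies in \<open>\<Omega>\<close>, so its parameter is positive.\<close>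

lemma compact_avoids_boundary:
  assumes "compact K" "K \<subseteq> \<Omega>"
  shows "\<exists>a>0. \<forall>s x. 0 < s \<longrightarrow> s \<le> a \<longrightarrow> norm x = r s \<longrightarrow> x \<notin> K"
proof (cases "\<exists>x\<in>K. x \<noteq> 0")
  case True
  then obtain x0 where x0: "x0 \<in> K" "\<And>x. x \<in> K \<Longrightarrow> norm x \<le> norm x0"
    using continuous_attains_sup[of K norm] assms(1) by (auto intro: continuous_intros)
  then have "x0 \<noteq> 0" using True by force
  with x0 assms(2) have s: "\<sigma> (norm x0) > 0" "r (\<sigma> (norm x0)) = norm x0"
    using \<Omega>_polar[of x0] by auto
  show ?thesis
  proof (intro exI[of _ "\<sigma> (norm x0) / 2"] conjI allI impI)
    fix s and x :: 'a assume "0 < s" "s \<le> \<sigma> (norm x0) / 2" "norm x = r s"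
    then have "norm x0 < norm x" using r_antimono[of s "\<sigma> (norm x0)"] s by simp
    then show "x \<notin> K" using x0(2) by (auto simp: not_le[symmetric])
  qed (use s in simp)
next
  case False
  show ?thesis
    by (rule exI[of _ 1]) (use False \<Omega>_I in auto)
qed

lemma smean_zero:
  assumes \<phi>: "\<phi> \<in> test_functions \<Omega>"
  shows "\<exists>a>0. \<forall>s\<le>a. smean \<phi> s = 0 \<and> dsmean \<phi> s = 0"
proof -
  obtain K where K: "compact K" "K \<subseteq> \<Omega>" "\<And>x. x \<notin> K \<Longrightarrow> \<phi> x = 0 \<and> grad \<phi> x = 0"
    using test_functionsD(5)[OF \<phi>] by blast
  obtain a where a: "a > 0" "\<And>s x. 0 < s \<Longrightarrow> s \<le> a \<Longrightarrow> norm x = r s \<Longrightarrow> x \<notin> K"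
    using compact_avoids_boundary[OF K(1,2)] by blast
  have "smean \<phi> s = 0 \<and> dsmean \<phi> s = 0" if "s \<le> a" for s
  proof (cases "s > 0")
    case True
    have "indicator shell y * \<phi> (r s *\<^sub>R sgn y) = 0" "indicator shell y * ((grad \<phi> (r s *\<^sub>R sgn y) \<bullet> sgn y) * r' s) = 0" for y :: 'a
      using K(3)[of "r s *\<^sub>R sgn y"] a(2)[OF True that, of "r s *\<^sub>R sgn y"] norm_polar[of y s] True
      by (auto split: split_indicator)
    then show ?thesis by (simp only: smean_def dsmean_def Bochner_Integration.integral_zero) simp
  qed (simp add: smean_def dsmean_def)
  then show ?thesis using a(1) by blast
qed

text \<open>Jensen's inequality, in the form of Cauchy-Schwarz against the indicator of the shell.\<close>

lemma dsmean_sq_bound: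
  assumes \<phi>: "\<phi> \<in> test_functions \<Omega>" and s: "s > 0"
  shows "ennreal ((dsmean \<phi> s)\<^sup>2) \<le> ennreal (1 / measure lborel (shell :: 'a set))
    * (\<integral>\<^sup>+y. indicator (shell :: 'a set) y * ennreal ((norm (grad \<phi> (r s *\<^sub>R sgn y)))\<^sup>2 * (r' s)\<^sup>2) \<partial>lborel)"
    (is "_ \<le> _ * ?E")
proof -
  define A where "A = measure lborel (shell :: 'a set)"
  have A: "A > 0" "emeasure lborel (shell :: 'a set) = ennreal A"
    using measure_shell_pos emeasure_shell by (auto simp: A_def)
  note [measurable] = test_functions_measurable(2)[OF \<phi>]
  obtain M where M: "M \<ge> 0" "\<And>x. \<bar>\<phi> x\<bar> \<le> M" "\<And>x. norm (grad \<phi> x) \<le> M"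
    using test_function_bounds[OF \<phi>] by blast
  define g where "g y = (grad \<phi> (r s *\<^sub>R sgn y) \<bullet> sgn y) * r' s" for y :: 'a
  have [measurable]: "g \<in> borel_measurable borel" unfolding g_def by measurable
  have g: "\<bar>g y\<bar> \<le> norm (grad \<phi> (r s *\<^sub>R sgn y)) * \<bar>r' s\<bar>" for y
    unfolding g_def by (rule ray_derivative_bound)
  have "ennreal ((A * dsmean \<phi> s)\<^sup>2) = (ennreal (norm (\<integral>y. indicator shell y * g y \<partial>lborel)))\<^sup>2"
    using s A by (simp add: dsmean_def g_def A_def[symmetric] ennreal_power)
  also have "\<dots> \<le> (\<integral>\<^sup>+y. ennreal (norm (indicator shell y * g y)) \<partial>lborel)\<^sup>2"
    by (intro power_mono integral_norm_bound_ennreal integrable_on_shell[where B = "M * \<bar>r' s\<bar>"])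
       (auto simp: g_def intro: dsmean_integrand_bound M)
  also have "(\<integral>\<^sup>+y. ennreal (norm (indicator shell y * g y)) \<partial>lborel)
      = (\<integral>\<^sup>+y. indicator (shell :: 'a set) y * (indicator shell y * ennreal \<bar>g y\<bar>) \<partial>lborel)"
    by (intro nn_integral_cong) (auto split: split_indicator)
  also have "(\<integral>\<^sup>+y. indicator (shell :: 'a set) y * (indicator shell y * ennreal \<bar>g y\<bar>) \<partial>lborel)\<^sup>2
      \<le> (\<integral>\<^sup>+y. (indicator (shell :: 'a set) y)\<^sup>2 \<partial>lborel) * (\<integral>\<^sup>+y. (indicator shell y * ennreal \<bar>g y\<bar>)\<^sup>2 \<partial>lborel)"
    by (rule Cauchy_Schwarz_nn_integral) auto
  also have "(\<integral>\<^sup>+y. (indicator shell y)\<^sup>2 \<partial>(lborel :: 'a measure)) = (\<integral>\<^sup>+y. indicator shell y \<partial>(lborel :: 'a measure))"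
    by (intro nn_integral_cong) (auto split: split_indicator)
  also have "\<dots> = ennreal A" using A by simp
  also have "(\<integral>\<^sup>+y. (indicator shell y * ennreal \<bar>g y\<bar>)\<^sup>2 \<partial>lborel)
      \<le> ?E"
  proof (intro nn_integral_mono)
    fix y :: 'a
    have "\<bar>g y\<bar>\<^sup>2 \<le> (norm (grad \<phi> (r s *\<^sub>R sgn y)) * \<bar>r' s\<bar>)\<^sup>2"
      using g[of y] by (intro power_mono) auto
    then show "(indicator shell y * ennreal \<bar>g y\<bar>)\<^sup>2 \<le> indicator shell y * ennreal ((norm (grad \<phi> (r s *\<^sub>R sgn y)))\<^sup>2 * (r' s)\<^sup>2)"
      by (auto split: split_indicator simp: ennreal_power power_mult_distrib intro!: ennreal_leI)
  qed
  finally have *: "ennreal ((A * dsmean \<phi> s)\<^sup>2) \<le> ennreal A * ?E"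
    by (simp add: mult_left_mono)
  have "ennreal ((dsmean \<phi> s)\<^sup>2) = ennreal (1 / A\<^sup>2) * ennreal ((A * dsmean \<phi> s)\<^sup>2)"
    using A by (subst ennreal_mult[symmetric]) (auto simp: power_mult_distrib)
  also have "\<dots> \<le> ennreal (1 / A\<^sup>2) * (ennreal A * ?E)"
    by (intro mult_left_mono *) auto
  also have "\<dots> = ennreal (1 / A) * ?E"
    using A by (simp add: mult.assoc[symmetric] ennreal_mult[symmetric] power2_eq_square)
  finally show ?thesis by (simp add: A_def)
qed

text \<open>The constant that relates the energy on \<open>\<Omega>\<close> to the energy of the profile on the half-line.\<close>

definition mean_const :: real where
  "mean_const = polar_factor DIM('a) / (\<kappa> * measure lborel (shell :: 'a set))"

text \<open>In the polar formula for the energy the factor \<open>\<rho> r\<^sup>N\<^sup>-\<^sup>1\<close> equals \<open>- \<kappa> r'\<close>, which leaves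
  exactly the \<open>r'\<^sup>2\<close> that the chain rule produces in the derivative of the mean.\<close>

lemma nn_integral_dsmean_sq:
  assumes \<phi>: "\<phi> \<in> test_functions \<Omega>"
  shows "(\<integral>\<^sup>+s. ennreal ((dsmean \<phi> s)\<^sup>2) \<partial>lborel) \<le> ennreal (mean_const * (l2 lborel (wgrad \<phi>))\<^sup>2)"
proof -
  define A where "A = measure lborel (shell :: 'a set)"
  have A: "A > 0" using measure_shell_pos by (auto simp: A_def)
  note [measurable] = test_functions_measurable(2)[OF \<phi>]
  define h where "h x = ennreal (\<rho> x * (norm (grad \<phi> x))\<^sup>2)" for x
  have [measurable]: "h \<in> borel_measurable borel" unfolding h_def by measurable
  define E where "E s = indicator {0<..} s * ennreal (- r' s) * (\<integral>\<^sup>+y. indicator (shell :: 'a set) y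
            * ennreal (r s ^ (DIM('a) - 1)) * h (r s *\<^sub>R sgn y) \<partial>lborel)" for s
  have "(\<integral>\<^sup>+s. ennreal ((dsmean \<phi> s)\<^sup>2) \<partial>lborel) \<le> (\<integral>\<^sup>+s. ennreal (1 / (\<kappa> * A)) * E s \<partial>lborel)"
  proof (intro nn_integral_mono)
    fix s :: real
    show "ennreal ((dsmean \<phi> s)\<^sup>2) \<le> ennreal (1 / (\<kappa> * A)) * E s"
    proof (cases "s > 0")
      case True
      have "E s = (\<integral>\<^sup>+y. ennreal (- r' s) * (indicator (shell :: 'a set) y
            * ennreal (r s ^ (DIM('a) - 1)) * h (r s *\<^sub>R sgn y)) \<partial>lborel)"
        using True unfolding E_def by (simp add: nn_integral_cmult)
      also have "\<dots> = (\<integral>\<^sup>+y. ennreal \<kappa> * (indicator (shell :: 'a set) y * ennreal ((norm (grad \<phi> (r s *\<^sub>R sgn y)))\<^sup>2 * (r' s)\<^sup>2)) \<partial>lborel)"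
      proof (rule nn_integral_cong)
        fix y :: 'a
        show "ennreal (- r' s) * (indicator shell y * ennreal (r s ^ (DIM('a) - 1)) * h (r s *\<^sub>R sgn y))
           = ennreal \<kappa> * (indicator shell y * ennreal ((norm (grad \<phi> (r s *\<^sub>R sgn y)))\<^sup>2 * (r' s)\<^sup>2))"
        proof (cases "y \<in> shell")
          case yT: True
          let ?x = "r s *\<^sub>R sgn y"
          have eq: "(- r' s) * (r s ^ (DIM('a) - 1) * (\<rho> ?x * (norm (grad \<phi> ?x))\<^sup>2)) = \<kappa> * ((norm (grad \<phi> ?x))\<^sup>2 * (r' s)\<^sup>2)"
          proof -
            have "(- r' s) * (r s ^ (DIM('a) - 1) * (\<rho> ?x * (norm (grad \<phi> ?x))\<^sup>2))
               = (- r' s) * (norm (grad \<phi> ?x))\<^sup>2 * (\<rho> ?x * r s ^ (DIM('a) - 1))"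
              by (simp add: mult_ac)
            also have "\<dots> = \<kappa> * ((norm (grad \<phi> ?x))\<^sup>2 * (r' s)\<^sup>2)"
              unfolding \<rho>_eq[OF True norm_polar[OF yT True]] by (simp add: power2_eq_square mult_ac)
            finally show ?thesis .
          qed
          have "ennreal (- r' s) * (ennreal (r s ^ (DIM('a) - 1)) * h ?x) = ennreal ((- r' s) * (r s ^ (DIM('a) - 1) * (\<rho> ?x * (norm (grad \<phi> ?x))\<^sup>2)))"
            unfolding h_def using r_pos[OF True] r'_neg[OF True] \<rho>_nonneg[of ?x]
            by (subst ennreal_mult, simp, simp, subst ennreal_mult) auto
          also have "\<dots> = ennreal \<kappa> * ennreal ((norm (grad \<phi> ?x))\<^sup>2 * (r' s)\<^sup>2)"
            unfolding eq using \<kappa>_pos by (subst ennreal_mult) auto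
          finally show ?thesis using yT by simp
        qed simp
      qed
      also have "\<dots> = ennreal \<kappa> * (\<integral>\<^sup>+y. indicator (shell :: 'a set) y * ennreal ((norm (grad \<phi> (r s *\<^sub>R sgn y)))\<^sup>2 * (r' s)\<^sup>2) \<partial>lborel)"
        by (rule nn_integral_cmult) measurable
      finally have "ennreal (1 / (\<kappa> * A)) * E s = ennreal (1 / A) * (\<integral>\<^sup>+y. indicator (shell :: 'a set) y * ennreal ((norm (grad \<phi> (r s *\<^sub>R sgn y)))\<^sup>2 * (r' s)\<^sup>2) \<partial>lborel)"
        using A \<kappa>_pos by (simp add: mult.assoc[symmetric] ennreal_mult[symmetric])
      then show ?thesis
        using dsmean_sq_bound[OF \<phi> True] by (simp add: A_def)
    qed (simp add: dsmean_def)
  qed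
  also have "\<dots> = ennreal (1 / (\<kappa> * A)) * (\<integral>\<^sup>+s. E s \<partial>lborel)"
  proof (rule nn_integral_cmult)
    define k where "k t = (\<integral>\<^sup>+y. indicator (shell :: 'a set) y * ennreal (t ^ (DIM('a) - 1)) * h (t *\<^sub>R sgn y) \<partial>lborel)" for t
    have "k \<in> borel_measurable borel" unfolding k_def by measurable
    from half_line_measurable[OF this] show "E \<in> borel_measurable lborel"
      by (simp add: E_def[abs_def] k_def)
  qed
  also have "(\<integral>\<^sup>+s. E s \<partial>lborel) = ennreal (polar_factor DIM('a)) * (\<integral>\<^sup>+x. indicator \<Omega> x * h x \<partial>lborel)"
    unfolding E_def by (rule nn_integral_polar_weighted) measurable
  also have "(\<integral>\<^sup>+x. indicator \<Omega> x * h x \<partial>lborel) = ennreal ((l2 lborel (wgrad \<phi>))\<^sup>2)"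
    unfolding h_def by (rule nn_integral_energy[OF \<phi>])
  also have "ennreal (1 / (\<kappa> * A)) * (ennreal (polar_factor DIM('a)) * ennreal ((l2 lborel (wgrad \<phi>))\<^sup>2)) = ennreal (mean_const * (l2 lborel (wgrad \<phi>))\<^sup>2)"
    using A \<kappa>_pos polar_factor_pos[of "DIM('a)"]
    by (simp add: ennreal_mult[symmetric] mean_const_def A_def[symmetric] divide_simps)
  finally show ?thesis .
qed

lemma mean_const_pos: "mean_const > 0"
  using \<kappa>_pos polar_factor_pos measure_shell_pos[where 'a = 'a] by (simp add: mean_const_def zero_less_divide_iff zero_less_mult_iff)

lemma admissible_smean:
  assumes \<phi>: "\<phi> \<in> test_functions \<Omega>"
  shows "admissible (smean \<phi>) (dsmean \<phi>)" "l2 lborel (dsmean \<phi>) \<le> sqrt mean_const * l2 lborel (wgrad \<phi>)"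
proof -
  obtain a where a: "a > 0" "\<And>s. s \<le> a \<Longrightarrow> smean \<phi> s = 0 \<and> dsmean \<phi> s = 0"
    using smean_zero[OF \<phi>] by blast
  have "continuous_on ({0<..} \<union> {..<a}) (dsmean \<phi>)"
  proof (rule continuous_on_open_Un)
    have "continuous_on {..<a} (\<lambda>s. 0 :: real)" by simp
    then show "continuous_on {..<a} (dsmean \<phi>)" by (rule continuous_on_eq) (use a in auto)
  qed (auto intro: dsmean_continuous[OF \<phi>])
  also have "{0<..} \<union> {..<a} = UNIV" using a by auto
  finally have cont: "continuous_on UNIV (dsmean \<phi>)" .
  have der: "(smean \<phi> has_real_derivative dsmean \<phi> s) (at s)" for s
  proof (cases "s > 0")
    case False
    have "((\<lambda>s. 0) has_real_derivative dsmean \<phi> s) (at s)" using False a by simp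
    then show ?thesis
      by (rule has_field_derivative_transform_within_open[where S = "{..<a}"]) (use False a in auto)
  qed (rule DERIV_smean[OF \<phi>])
  have [measurable]: "dsmean \<phi> \<in> borel_measurable borel"
    using cont by (rule borel_measurable_continuous_onI)
  have "integrable lborel (\<lambda>s. (dsmean \<phi> s)\<^sup>2)"
    using nn_integral_dsmean_sq[OF \<phi>] by (intro integrableI_nonneg) (auto intro: le_less_trans)
  then have sq: "sq_integrable lborel (dsmean \<phi>)" by (simp add: sq_integrable_def)
  then show "admissible (smean \<phi>) (dsmean \<phi>)"
    using cont der a unfolding admissible_def by blast
  have "(l2 lborel (dsmean \<phi>))\<^sup>2 \<le> mean_const * (l2 lborel (wgrad \<phi>))\<^sup>2"
    using nn_integral_dsmean_sq[OF \<phi>] nn_integral_sq[OF sq] mean_const_pos by simp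
  also have "\<dots> = (sqrt mean_const * l2 lborel (wgrad \<phi>))\<^sup>2"
    using mean_const_pos by (simp add: power_mult_distrib)
  finally show "l2 lborel (dsmean \<phi>) \<le> sqrt mean_const * l2 lborel (wgrad \<phi>)"
    by (rule power2_le_imp_le) (use mean_const_pos in \<open>simp add: l2_nonneg\<close>)
qed

section \<open>Null sets in polar coordinates\<close>

text \<open>Fubini for null sets: almost every sphere meets a null set in a null set of directions.\<close>

lemma AE_polar:
  assumes "AE x in lborel. P x"
  shows "AE s in lborel. s > 0 \<longrightarrow> (AE y in lborel. y \<in> shell \<longrightarrow> P (r s *\<^sub>R sgn (y :: 'a)))"
proof -
  obtain Z where Z: "{x. \<not> P x} \<subseteq> Z" "emeasure lborel Z = 0" "Z \<in> sets borel"
    using assms by (auto elim: AE_E)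
  then have [measurable]: "Z \<in> sets borel" by simp
  define k where "k t = (\<integral>\<^sup>+y. indicator (shell :: 'a set) y * ennreal (t ^ (DIM('a) - 1)) * indicator Z (t *\<^sub>R sgn y) \<partial>lborel)" for t
  have [measurable]: "k \<in> borel_measurable borel" unfolding k_def by measurable
  have "AE x in lborel. x \<notin> Z"
    using Z by (intro AE_not_in) (simp add: null_sets_def)
  then have "AE x in lborel. indicator \<Omega> x * (indicator Z x :: ennreal) = 0"
    by eventually_elim simp
  then have "(\<integral>\<^sup>+x. indicator \<Omega> x * indicator Z x \<partial>lborel) = 0"
    by (subst nn_integral_0_iff_AE) auto
  then have "(\<integral>\<^sup>+s. indicator {0<..} s * ennreal (- r' s) * k (r s) \<partial>lborel) = 0"
    using nn_integral_polar_weighted[of "indicator Z"] by (simp add: k_def)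
  then have "AE s in lborel. indicator {0<..} s * ennreal (- r' s) * k (r s) = 0"
    using half_line_measurable[of k] by (subst (asm) nn_integral_0_iff_AE) auto
  then show ?thesis
  proof eventually_elim
    case (elim s)
    show ?case
    proof
      assume s: "s > 0"
      then have "k (r s) = 0" using elim r'_neg[OF s] by (auto simp: ennreal_eq_0_iff)
      then have "AE y in lborel. indicator (shell :: 'a set) y * ennreal (r s ^ (DIM('a) - 1)) * indicator Z (r s *\<^sub>R sgn y) = 0"
        unfolding k_def by (subst (asm) nn_integral_0_iff_AE) auto
      then show "AE y in lborel. y \<in> shell \<longrightarrow> P (r s *\<^sub>R sgn (y :: 'a))"
      proof eventually_elim
        case (elim y)
        have "0 < r s ^ (DIM('a) - 1)" using r_pos[OF s] by simp
        then have "ennreal (r s ^ (DIM('a) - 1)) \<noteq> 0" by (simp add: ennreal_eq_0_iff)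
        then show ?case using elim Z(1) by (auto simp: indicator_def split: if_splits)
      qed
    qed
  qed
qed

lemma \<sigma>_norm_measurable: "(\<lambda>x. indicator (\<Omega> - {0}) x * \<sigma> (norm x)) \<in> borel_measurable (borel :: 'a measure)"
proof -
  have "continuous_on (\<Omega> - {0}) (\<lambda>x. \<sigma> (norm x))"
  proof (rule continuous_on_compose2[OF \<sigma>_cont])
    show "norm ` (\<Omega> - {0}) \<subseteq> r ` {0<..}" using \<Omega>_iff by auto
  qed (intro continuous_intros)
  from borel_measurable_continuous_on_indicator[OF _ this] show ?thesis by simp
qed

text \<open>The converse direction, from null sets of radii to null sets of points.\<close>

lemma AE_radial:
  assumes "AE s in lborel. s > 0 \<longrightarrow> Q s"
  shows "AE x in lborel. x \<in> \<Omega> - {0} \<longrightarrow> Q (\<sigma> (norm (x :: 'a)))"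
proof -
  obtain Z where Z: "{s. \<not> (s > 0 \<longrightarrow> Q s)} \<subseteq> Z" "emeasure lborel Z = 0" "Z \<in> sets borel"
    using assms by (auto elim: AE_E)
  then have [measurable]: "Z \<in> sets borel" by simp
  define h :: "'a \<Rightarrow> ennreal" where "h x = indicator (\<Omega> - {0}) x * indicator Z (indicator (\<Omega> - {0}) x * \<sigma> (norm x))" for x
  have [measurable]: "h \<in> borel_measurable borel"
    unfolding h_def using \<sigma>_norm_measurable by measurable
  define H where "H s = ennreal (r s ^ (DIM('a) - 1) * (- r' s)) * indicator Z s" for s
  have H_eq: "indicator {0<..} s * H s = indicator {0<..} s * ennreal (- r' s) * ennreal (r s ^ (DIM('a) - 1)) * indicator Z s" for s
    using r_pos[of s] r'_neg[of s] by (cases "s > 0") (auto simp: H_def ennreal_mult[symmetric] mult.commute)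
  have H_meas: "(\<lambda>s. indicator {0<..} s * H s) \<in> borel_measurable borel"
    unfolding H_eq using half_line_measurable[of "\<lambda>t. ennreal (t ^ (DIM('a) - 1))"] by measurable
  have "ennreal (measure lborel (shell :: 'a set)) * (\<integral>\<^sup>+s. indicator {0<..} s * H s \<partial>lborel) = ennreal (polar_factor DIM('a)) * (\<integral>\<^sup>+x. indicator \<Omega> x * h x \<partial>lborel)"
  proof (rule nn_integral_radial[OF _ H_meas])
    fix s and x :: 'a assume s: "s > 0" "norm x = r s"
    have "indicator (\<Omega> - {0}) x = (1::real)" "indicator (\<Omega> - {0}) x = (1::ennreal)" using \<Omega>_I[OF s] by auto
    then show "ennreal (r s ^ (DIM('a) - 1) * (- r' s)) * h x = H s"
      using \<sigma>_r[OF s(1)] s(2) by (simp add: h_def H_def)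
  qed measurable
  moreover have "(\<integral>\<^sup>+s. indicator {0<..} s * H s \<partial>lborel) = 0"
  proof -
    have "AE s in lborel. s \<notin> Z"
      using Z by (intro AE_not_in) (simp add: null_sets_def)
    then have "AE s in lborel. indicator {0<..} s * H s = 0"
      by eventually_elim (simp add: H_def)
    then show ?thesis using H_meas by (subst nn_integral_0_iff_AE) auto
  qed
  ultimately have "(\<integral>\<^sup>+x. indicator \<Omega> x * h x \<partial>lborel) = 0"
    using polar_factor_pos[of "DIM('a)"] by (auto simp: ennreal_eq_0_iff)
  then have "AE x in lborel. indicator \<Omega> x * h x = 0"
    by (subst (asm) nn_integral_0_iff_AE) auto
  then show ?thesis
  proof eventually_elim
    case (elim x)
    show ?case
    proof
      assume x: "x \<in> \<Omega> - {0}"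
      then have "\<sigma> (norm x) \<notin> Z" "\<sigma> (norm x) > 0"
        using elim \<Omega>_polar[of x] by (auto simp: h_def indicator_def split: if_splits)
      then show "Q (\<sigma> (norm x))" using Z(1) by blast
    qed
  qed
qed

section \<open>Spherical means of an approximating sequence\<close>

lemma dsmean_diff:
  assumes \<phi>: "\<phi> \<in> test_functions \<Omega>" and \<psi>: "\<psi> \<in> test_functions \<Omega>"
  shows "dsmean (\<lambda>x. \<phi> x - \<psi> x) = (\<lambda>s. dsmean \<phi> s - dsmean \<psi> s)"
proof
  fix s
  have int: "integrable lborel (\<lambda>y. indicator (shell :: 'a set) y * ((grad \<phi> (r s *\<^sub>R sgn y) \<bullet> sgn y) * r' s))"
    if \<phi>: "\<phi> \<in> test_functions \<Omega>" for \<phi>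
  proof -
    note [measurable] = test_functions_measurable(2)[OF \<phi>]
    obtain M where "\<And>x. norm (grad \<phi> x) \<le> M"
      using test_function_bounds[OF \<phi>] by blast
    then show ?thesis
      by (intro integrable_on_shell[where B = "M * \<bar>r' s\<bar>"] dsmean_integrand_bound) auto
  qed
  have "(\<integral>y. indicator (shell :: 'a set) y * ((grad (\<lambda>x. \<phi> x - \<psi> x) (r s *\<^sub>R sgn y) \<bullet> sgn y) * r' s) \<partial>lborel)
      = (\<integral>y. indicator (shell :: 'a set) y * ((grad \<phi> (r s *\<^sub>R sgn y) \<bullet> sgn y) * r' s)
           - indicator (shell :: 'a set) y * ((grad \<psi> (r s *\<^sub>R sgn y) \<bullet> sgn y) * r' s) \<partial>lborel)"
    by (simp add: grad_diff[OF assms] inner_diff_left algebra_simps)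
  also have "\<dots> = (\<integral>y. indicator (shell :: 'a set) y * ((grad \<phi> (r s *\<^sub>R sgn y) \<bullet> sgn y) * r' s) \<partial>lborel)
      - (\<integral>y. indicator (shell :: 'a set) y * ((grad \<psi> (r s *\<^sub>R sgn y) \<bullet> sgn y) * r' s) \<partial>lborel)"
    by (rule Bochner_Integration.integral_diff[OF int[OF \<phi>] int[OF \<psi>]])
  finally show "dsmean (\<lambda>x. \<phi> x - \<psi> x) s = dsmean \<phi> s - dsmean \<psi> s"
    by (simp add: dsmean_def diff_divide_distrib)
qed

lemma dsmean_Cauchy:
  assumes \<phi>: "\<And>n. \<phi> n \<in> test_functions \<Omega>" and C: "l2_Cauchy lborel (\<lambda>n. wgrad (\<phi> n))"
  shows "l2_Cauchy lborel (\<lambda>n. dsmean (\<phi> n))"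
  unfolding l2_Cauchy_def
proof (intro allI impI)
  fix e :: real assume "e > 0"
  then have "e / sqrt mean_const > 0" using mean_const_pos by simp
  then obtain n0 where n0: "\<And>m n. m \<ge> n0 \<Longrightarrow> n \<ge> n0 \<Longrightarrow> l2 lborel (\<lambda>x. wgrad (\<phi> m) x - wgrad (\<phi> n) x) < e / sqrt mean_const"
    using C unfolding l2_Cauchy_def by blast
  show "\<exists>n0. \<forall>m\<ge>n0. \<forall>n\<ge>n0. l2 lborel (\<lambda>s. dsmean (\<phi> m) s - dsmean (\<phi> n) s) < e"
  proof (intro exI allI impI)
    fix m n assume "n0 \<le> m" "n0 \<le> n"
    have "l2 lborel (\<lambda>s. dsmean (\<phi> m) s - dsmean (\<phi> n) s) \<le> sqrt mean_const * l2 lborel (\<lambda>x. wgrad (\<phi> m) x - wgrad (\<phi> n) x)"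
      using admissible_smean(2)[OF test_functions_diff[OF \<phi> \<phi>]] by (simp add: dsmean_diff \<phi> wgrad_diff)
    also have "\<dots> < e"
      using n0[OF \<open>n0 \<le> m\<close> \<open>n0 \<le> n\<close>] mean_const_pos by (simp add: pos_less_divide_eq mult.commute)
    finally show "l2 lborel (\<lambda>s. dsmean (\<phi> m) s - dsmean (\<phi> n) s) < e" .
  qed
qed

lemma smean_diff_bound:
  assumes \<phi>: "\<phi> \<in> test_functions \<Omega>" and s: "s > 0"
  shows "ennreal (measure lborel (shell :: 'a set) * \<bar>smean \<phi> s - c\<bar>)
    \<le> (\<integral>\<^sup>+y. indicator (shell :: 'a set) y * ennreal \<bar>\<phi> (r s *\<^sub>R sgn y) - c\<bar> \<partial>lborel)"
proof -
  define A where "A = measure lborel (shell :: 'a set)"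
  have A: "A > 0" using measure_shell_pos by (auto simp: A_def)
  note [measurable] = test_functions_measurable(1)[OF \<phi>]
  obtain M where M: "\<And>x. \<bar>\<phi> x\<bar> \<le> M"
    using test_function_bounds[OF \<phi>] by blast
  have int: "integrable lborel (\<lambda>y. indicator (shell :: 'a set) y * \<phi> (r s *\<^sub>R sgn y))"
    by (rule integrable_on_shell[where B = M]) (use M in auto)
  have int2: "integrable lborel (\<lambda>y. indicator (shell :: 'a set) y * c)"
    by (rule integrable_on_shell[where B = "\<bar>c\<bar>"]) auto
  have "A * (smean \<phi> s - c) = (\<integral>y. indicator (shell :: 'a set) y * \<phi> (r s *\<^sub>R sgn y) \<partial>lborel) - (\<integral>y. indicator (shell :: 'a set) y * c \<partial>lborel)"
    using A s shell_finite[where 'a = 'a] by (simp add: smean_def A_def right_diff_distrib)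
  also have "\<dots> = (\<integral>y. indicator (shell :: 'a set) y * (\<phi> (r s *\<^sub>R sgn y) - c) \<partial>lborel)"
    by (subst Bochner_Integration.integral_diff[OF int int2, symmetric]) (simp add: right_diff_distrib)
  finally have "ennreal (A * \<bar>smean \<phi> s - c\<bar>) = ennreal (norm (\<integral>y. indicator (shell :: 'a set) y * (\<phi> (r s *\<^sub>R sgn y) - c) \<partial>lborel))"
    using A by (metis abs_mult abs_of_pos real_norm_def)
  also have "\<dots> \<le> (\<integral>\<^sup>+y. ennreal (norm (indicator (shell :: 'a set) y * (\<phi> (r s *\<^sub>R sgn y) - c))) \<partial>lborel)"
    using Bochner_Integration.integrable_diff[OF int int2] by (intro integral_norm_bound_ennreal) (simp add: right_diff_distrib)
  also have "\<dots> = (\<integral>\<^sup>+y. indicator (shell :: 'a set) y * ennreal \<bar>\<phi> (r s *\<^sub>R sgn y) - c\<bar> \<partial>lborel)"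
    by (intro nn_integral_cong) (auto split: split_indicator)
  finally show ?thesis by (simp add: A_def)
qed

text \<open>Convergence in \<open>L\<^sup>1\<close> on an annulus, written in polar coordinates, controls the averages of
  \<open>|\<phi> n - v|\<close> over spheres in \<open>L\<^sup>1\<close> of the parameter. These averages dominate \<open>|smean (\<phi> n) s - u s|\<close>,
  which converges for every \<open>s\<close>; by Fatou's lemma its limit is zero for almost every \<open>s\<close>. The
  profile \<open>u\<close> is not known to be measurable, so the argument runs with a Borel version of \<open>v\<close>.\<close>

lemma smean_limit_on_interval:
  assumes rep: "represents \<rho> \<Omega> \<phi> v"
    and prof: "AE x in lebesgue. x \<in> \<Omega> - {0} \<longrightarrow> v x = u (\<sigma> (norm x))"
    and ab: "0 < a"
  shows "AE s in lborel. s \<in> {a..b} \<longrightarrow> (\<lambda>n. smean (\<phi> n) s) \<longlonglongrightarrow> u s"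
proof -
  have \<phi>: "\<phi> n \<in> test_functions \<Omega>" for n using rep by (simp add: represents_def)
  have C: "l2_Cauchy lborel (\<lambda>n. dsmean (\<phi> n))"
    using rep by (intro dsmean_Cauchy \<phi>) (simp add: represents_def dirichlet_Cauchy_iff[OF \<phi>, symmetric])
  note [measurable] = test_functions_measurable(1)[OF \<phi>]
  define K where "K = {x::'a. r b \<le> norm x \<and> norm x \<le> r a}"
  have K: "compact K" "K \<subseteq> \<Omega>"
  proof -
    have "K = cball 0 (r a) - ball 0 (r b)" by (auto simp: K_def)
    then show "compact K" by (simp add: compact_diff)
    show "K \<subseteq> \<Omega>" using cball_subset[OF ab] by (auto simp: K_def)
  qed
  have K_borel [measurable]: "K \<in> sets borel" by (rule borel_compact[OF K(1)])
  have "set_integrable lebesgue K v" and lim: "(\<lambda>n. LINT x:K|lebesgue. \<bar>\<phi> n x - v x\<bar>) \<longlonglongrightarrow> 0"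
    using rep K by (auto simp: represents_def)
  then have Kv: "integrable lebesgue (\<lambda>x. indicator K x * v x)" by (simp add: set_integrable_def)
  then obtain v' where v' [measurable]: "v' \<in> borel_measurable borel" and v'_eq: "AE x in lborel. indicator K x * v x = v' x"
    using completion_ex_borel_measurable_real[of "\<lambda>x. indicator K x * v x" lborel] by (auto dest: borel_measurable_integrable)
  have K\<phi>: "integrable lebesgue (\<lambda>x. indicator K x * \<phi> n x)" for n
  proof -
    have "integrable lborel (\<lambda>x. indicator K x *\<^sub>R \<phi> n x)"
      by (intro borel_integrable_compact K(1) continuous_on_subset[OF test_functionsD(3)[OF \<phi>]]) simp
    then show ?thesis by (simp add: integrable_completion)
  qed
  define h where "h n x = indicator K x * ennreal \<bar>\<phi> n x - v' x\<bar>" for n x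
  have [measurable]: "h n \<in> borel_measurable borel" for n unfolding h_def by measurable
  have h_int: "(\<integral>\<^sup>+x. indicator \<Omega> x * h n x \<partial>lborel) = ennreal (LINT x:K|lebesgue. \<bar>\<phi> n x - v x\<bar>)" for n
  proof -
    have "(\<integral>\<^sup>+x. indicator \<Omega> x * h n x \<partial>lborel) = (\<integral>\<^sup>+x. ennreal \<bar>indicator K x * \<phi> n x - indicator K x * v x\<bar> \<partial>lborel)"
    proof (rule nn_integral_cong_AE)
      show "AE x in lborel. indicator \<Omega> x * h n x = ennreal \<bar>indicator K x * \<phi> n x - indicator K x * v x\<bar>"
        using v'_eq by eventually_elim (use K(2) in \<open>auto simp: h_def split: split_indicator\<close>)
    qed
    also have "\<dots> = (\<integral>\<^sup>+x. ennreal \<bar>indicator K x * \<phi> n x - indicator K x * v x\<bar> \<partial>lebesgue)"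
      by (simp add: nn_integral_completion)
    also have "\<dots> = ennreal (\<integral>x. \<bar>indicator K x * \<phi> n x - indicator K x * v x\<bar> \<partial>lebesgue)"
      using K\<phi>[of n] Kv by (intro nn_integral_eq_integral) auto
    also have "(\<integral>x. \<bar>indicator K x * \<phi> n x - indicator K x * v x\<bar> \<partial>lebesgue) = (LINT x:K|lebesgue. \<bar>\<phi> n x - v x\<bar>)"
      unfolding set_lebesgue_integral_def by (intro Bochner_Integration.integral_cong) (auto split: split_indicator)
    finally show ?thesis .
  qed
  define k where "k n t = (\<integral>\<^sup>+y. indicator (shell :: 'a set) y * ennreal (t ^ (DIM('a) - 1)) * h n (t *\<^sub>R sgn y) \<partial>lborel)" for n t
  have [measurable]: "k n \<in> borel_measurable borel" for n unfolding k_def by measurable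
  define E where "E n s = indicator {0<..} s * ennreal (- r' s) * k n (r s)" for n s
  have E_meas: "E n \<in> borel_measurable lborel" for n
    unfolding E_def using half_line_measurable[of "k n"] by simp
  have E_int: "(\<integral>\<^sup>+s. E n s \<partial>lborel) = ennreal (polar_factor DIM('a) * (LINT x:K|lebesgue. \<bar>\<phi> n x - v x\<bar>))" for n
    unfolding E_def k_def using polar_factor_pos[of "DIM('a)"]
    by (subst nn_integral_polar_weighted) (auto simp: h_int ennreal_mult' less_imp_le)
  have "(\<lambda>n. \<integral>\<^sup>+s. E n s \<partial>lborel) \<longlonglongrightarrow> ennreal (polar_factor DIM('a) * 0)"
    unfolding E_int by (intro tendsto_ennrealI tendsto_intros lim)
  then have "liminf (\<lambda>n. \<integral>\<^sup>+s. E n s \<partial>lborel) = 0"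
    using lim_imp_Liminf[OF sequentially_bot] by fastforce
  moreover have "(\<integral>\<^sup>+s. liminf (\<lambda>n. E n s) \<partial>lborel) \<le> liminf (\<lambda>n. \<integral>\<^sup>+s. E n s \<partial>lborel)"
    by (rule nn_integral_liminf[OF E_meas])
  ultimately have "(\<integral>\<^sup>+s. liminf (\<lambda>n. E n s) \<partial>lborel) = 0" by simp
  then have E0: "AE s in lborel. liminf (\<lambda>n. E n s) = 0"
    using E_meas by (subst (asm) nn_integral_0_iff_AE) auto
  have "AE x in lborel. x \<in> K - {0} \<longrightarrow> v' x = u (\<sigma> (norm x))"
    using v'_eq prof[unfolded AE_completion_iff] by eventually_elim (use K(2) in auto)
  from AE_polar[OF this] E0 show ?thesis
  proof eventually_elim
    case (elim s)
    show ?case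
    proof
      assume sab: "s \<in> {a..b}"
      then have s: "s > 0" using ab by simp
      define A where "A = measure lborel (shell :: 'a set)"
      have A: "A > 0" using measure_shell_pos by (auto simp: A_def)
      define J where "J = - r' s * r s ^ (DIM('a) - 1)"
      have J: "J > 0" using r'_neg[OF s] r_pos[OF s] by (simp add: J_def mult_neg_pos)
      obtain W where W: "(\<lambda>n. smean (\<phi> n) s) \<longlonglongrightarrow> W"
        using l2_Cauchy_profile_converges[OF admissible_smean(1)[OF \<phi>] C, of s] s by (auto simp: convergent_def)
      \<comment> \<open>for almost every direction \<open>v'\<close> takes the value \<open>u s\<close> on this sphere\<close>
      have good: "AE y in lborel. y \<in> shell \<longrightarrow> v' (r s *\<^sub>R sgn y) = u s"
      proof -
        have "AE y in lborel. y \<in> shell \<longrightarrow> r s *\<^sub>R sgn y \<in> K - {0} \<longrightarrow> v' (r s *\<^sub>R sgn y) = u (\<sigma> (norm (r s *\<^sub>R sgn y)))"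
          using elim(1) s by blast
        then show ?thesis
        proof eventually_elim
          case (elim y)
          show ?case
          proof
            assume y: "y \<in> shell"
            have n: "norm (r s *\<^sub>R sgn y) = r s" by (rule norm_polar[OF y s])
            have "r s *\<^sub>R sgn y \<in> K - {0}"
              using n r_pos[OF s] r_antimono_le[of a s] r_antimono_le[of s b] sab ab s \<Omega>_I[OF s n] by (auto simp: K_def)
            with elim y n show "v' (r s *\<^sub>R sgn y) = u s" using \<sigma>_r[OF s] by simp
          qed
        qed
      qed
      have low: "ennreal (J * (A * \<bar>smean (\<phi> n) s - u s\<bar>)) \<le> E n s" for n
      proof -
        have "k n (r s) = (\<integral>\<^sup>+y. ennreal (r s ^ (DIM('a) - 1)) * (indicator (shell :: 'a set) y * ennreal \<bar>\<phi> n (r s *\<^sub>R sgn y) - u s\<bar>) \<partial>lborel)"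
          unfolding k_def
        proof (rule nn_integral_cong_AE)
          show "AE y in lborel. indicator (shell :: 'a set) y * ennreal (r s ^ (DIM('a) - 1)) * h n (r s *\<^sub>R sgn y)
            = ennreal (r s ^ (DIM('a) - 1)) * (indicator shell y * ennreal \<bar>\<phi> n (r s *\<^sub>R sgn y) - u s\<bar>)"
            using good
          proof eventually_elim
            case (elim y)
            show ?case
            proof (cases "y \<in> shell")
              case y: True
              have n: "norm (r s *\<^sub>R sgn y) = r s" by (rule norm_polar[OF y s])
              have "r s *\<^sub>R sgn y \<in> K"
                using n r_antimono_le[of a s] r_antimono_le[of s b] sab ab s by (auto simp: K_def)
              then show ?thesis using y elim by (simp add: h_def)
            qed simp
          qed
        qed
        also have "\<dots> = ennreal (r s ^ (DIM('a) - 1)) * (\<integral>\<^sup>+y. indicator (shell :: 'a set) y * ennreal \<bar>\<phi> n (r s *\<^sub>R sgn y) - u s\<bar> \<partial>lborel)"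
          by (rule nn_integral_cmult) measurable
        finally have "E n s = ennreal J * (\<integral>\<^sup>+y. indicator (shell :: 'a set) y * ennreal \<bar>\<phi> n (r s *\<^sub>R sgn y) - u s\<bar> \<partial>lborel)"
          using s r'_neg[OF s] r_pos[OF s] unfolding E_def J_def by (simp add: mult.assoc[symmetric] ennreal_mult'[symmetric])
        moreover have "ennreal J * ennreal (A * \<bar>smean (\<phi> n) s - u s\<bar>) \<le> ennreal J * (\<integral>\<^sup>+y. indicator (shell :: 'a set) y * ennreal \<bar>\<phi> n (r s *\<^sub>R sgn y) - u s\<bar> \<partial>lborel)"
          using smean_diff_bound[OF \<phi> s, of n "u s"] by (intro mult_left_mono) (auto simp: A_def)
        ultimately show ?thesis using J A by (simp add: ennreal_mult')
      qed
      have "(\<lambda>n. ennreal (J * (A * \<bar>smean (\<phi> n) s - u s\<bar>))) \<longlonglongrightarrow> ennreal (J * (A * \<bar>W - u s\<bar>))"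
        by (intro tendsto_ennrealI tendsto_intros W)
      then have "ennreal (J * (A * \<bar>W - u s\<bar>)) = liminf (\<lambda>n. ennreal (J * (A * \<bar>smean (\<phi> n) s - u s\<bar>)))"
        by (rule lim_imp_Liminf[OF sequentially_bot, symmetric])
      also have "\<dots> \<le> liminf (\<lambda>n. E n s)"
        by (intro Liminf_mono always_eventually allI low)
      finally have "J * (A * \<bar>W - u s\<bar>) \<le> 0"
        using elim(2) by (simp add: ennreal_eq_0_iff)
      then have "W = u s" using J A by (simp add: mult_le_0_iff)
      with W show "(\<lambda>n. smean (\<phi> n) s) \<longlonglongrightarrow> u s" by simp
    qed
  qed
qed

lemma represents_imp_approximates:
  assumes rep: "represents \<rho> \<Omega> \<phi> v"
    and prof: "AE x in lebesgue. x \<in> \<Omega> - {0} \<longrightarrow> v x = u (\<sigma> (norm x))"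
  shows "approximates u (\<lambda>n. smean (\<phi> n)) (\<lambda>n. dsmean (\<phi> n))"
proof -
  have \<phi>: "\<phi> n \<in> test_functions \<Omega>" for n using rep by (simp add: represents_def)
  have C: "l2_Cauchy lborel (\<lambda>n. dsmean (\<phi> n))"
    using rep by (intro dsmean_Cauchy \<phi>) (simp add: represents_def dirichlet_Cauchy_iff[OF \<phi>, symmetric])
  have "AE s in lborel. \<forall>j::nat. s \<in> {1 / real (Suc j)..real (Suc j)} \<longrightarrow> (\<lambda>n. smean (\<phi> n) s) \<longlonglongrightarrow> u s"
    unfolding AE_all_countable by (intro allI smean_limit_on_interval[OF rep prof]) simp
  then have "AE s in lborel. s > 0 \<longrightarrow> (\<lambda>n. smean (\<phi> n) s) \<longlonglongrightarrow> u s"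
  proof eventually_elim
    case (elim s)
    show ?case
    proof
      assume "s > 0"
      then obtain n1 where n1: "1 / real (Suc n1) < s" using nat_approx_posE by blast
      obtain n2 where n2: "s < real n2" using reals_Archimedean2 by blast
      have "1 / real (Suc (max n1 n2)) \<le> 1 / real (Suc n1)"
        by (intro divide_left_mono) auto
      then have "s \<in> {1 / real (Suc (max n1 n2))..real (Suc (max n1 n2))}"
        using n1 n2 by auto
      with elim show "(\<lambda>n. smean (\<phi> n) s) \<longlonglongrightarrow> u s" by blast
    qed
  qed
  then show ?thesis
    using C admissible_smean(1)[OF \<phi>] by (simp add: approximates_def)
qed

section \<open>Radial test functions\<close>

text \<open>Test functions whose profile is a given admissible pair. The origin is excluded because the
  parameter is infinite there.\<close>

definition radial_test :: "('a \<Rightarrow> real) \<Rightarrow> (real \<Rightarrow> real) \<Rightarrow> (real \<Rightarrow> real) \<Rightarrow> bool" where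
  "radial_test \<phi> u p \<longleftrightarrow> \<phi> \<in> test_functions \<Omega> \<and> admissible u p \<and> (\<forall>x\<in>\<Omega> - {0}. \<phi> x = u (\<sigma> (norm x)))"

lemma radial_test_diff:
  "radial_test \<phi> u p \<Longrightarrow> radial_test \<psi> v q \<Longrightarrow> radial_test (\<lambda>x. \<phi> x - \<psi> x) (\<lambda>s. u s - v s) (\<lambda>s. p s - q s)"
  by (auto simp: radial_test_def intro: test_functions_diff admissible_diff)

lemma DERIV_\<sigma>:
  assumes "s > 0"
  shows "(\<sigma> has_real_derivative inverse (r' s)) (at (r s))"
proof -
  obtain e where e: "e > 0" "ball (r s) e \<subseteq> r ` {0<..}"
    using r_image_open assms open_contains_ball by (metis greaterThan_iff image_eqI)
  show ?thesis
  proof (rule DERIV_inverse_function[where f = r and a = "r s - e" and b = "r s + e"])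
    show "(r has_real_derivative r' s) (at (\<sigma> (r s)))"
      using r_deriv[OF assms] by (simp add: \<sigma>_r[OF assms])
    show "r (\<sigma> y) = y" if "r s - e < y" "y < r s + e" for y
    proof -
      have "y \<in> ball (r s) e" using that by (simp add: dist_real_def abs_less_iff)
      then obtain t where "t > 0" "y = r t" using e by auto
      then show ?thesis by (simp add: \<sigma>_r)
    qed
    show "isCont \<sigma> (r s)"
      using \<sigma>_cont r_image_open assms by (simp add: continuous_on_eq_continuous_at)
  qed (use e r'_neg[OF assms] in auto)
qed

lemma norm_grad_radial:
  assumes t: "radial_test \<phi> u p" and s: "s > 0" "norm x = r s"
  shows "(norm (grad \<phi> x))\<^sup>2 * (r' s)\<^sup>2 = (p s)\<^sup>2"
proof -
  have x: "x \<in> \<Omega> - {0}" using \<Omega>_I[OF s] .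
  have "((\<lambda>x. norm x) has_derivative (\<lambda>h. h \<bullet> sgn x)) (at x)"
    using x by (intro has_derivative_norm) auto
  moreover have "((\<lambda>t. u (\<sigma> t)) has_real_derivative p s * inverse (r' s)) (at (norm x))"
    using t DERIV_\<sigma>[OF s(1)] s \<sigma>_r[OF s(1)] unfolding radial_test_def admissible_def
    by (intro DERIV_chain2) auto
  ultimately have "((\<lambda>x. u (\<sigma> (norm x))) has_derivative (\<lambda>h. (p s * inverse (r' s)) * (h \<bullet> sgn x))) (at x)"
    unfolding has_field_derivative_def by (rule has_derivative_compose)
  then have "GDERIV (\<lambda>x. u (\<sigma> (norm x))) x :> (p s * inverse (r' s)) *\<^sub>R sgn x"
    unfolding gderiv_def by simp
  then have "GDERIV \<phi> x :> (p s * inverse (r' s)) *\<^sub>R sgn x"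
    unfolding gderiv_def
    by (rule has_derivative_transform_within_open[where s = "\<Omega> - {0}"])
       (use x t open_\<Omega> in \<open>auto simp: radial_test_def open_Diff\<close>)
  then have "grad \<phi> x = (p s * inverse (r' s)) *\<^sub>R sgn x" by (rule grad_eqI)
  then have "norm (grad \<phi> x) = \<bar>p s\<bar> / \<bar>r' s\<bar>"
    using x by (simp add: norm_sgn abs_mult divide_inverse)
  then show ?thesis
    using r'_neg[OF s(1)] by (simp add: power_divide)
qed

text \<open>For radial functions the estimate of \<open>nn_integral_dsmean_sq\<close> is an equality.\<close>

lemma radial_test_energy:
  assumes t: "radial_test \<phi> u p"
  shows "l2 lborel p = sqrt mean_const * l2 lborel (wgrad \<phi>)"
proof -
  define A where "A = measure lborel (shell :: 'a set)"
  have A: "A > 0" using measure_shell_pos by (auto simp: A_def)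
  have \<phi>: "\<phi> \<in> test_functions \<Omega>" and ad: "admissible u p" using t by (auto simp: radial_test_def)
  note [measurable] = test_functions_measurable(2)[OF \<phi>]
  have [measurable]: "p \<in> borel_measurable borel"
    using ad by (simp add: admissible_def sq_integrable_def)
  have p0: "p s = 0" if "s \<le> 0" for s
    using ad that unfolding admissible_def by force
  have "ennreal A * (\<integral>\<^sup>+s. indicator {0<..} s * ennreal (\<kappa> * (p s)\<^sup>2) \<partial>lborel)
      = ennreal (polar_factor DIM('a)) * (\<integral>\<^sup>+x. indicator \<Omega> x * ennreal (\<rho> x * (norm (grad \<phi> x))\<^sup>2) \<partial>lborel)"
    unfolding A_def
  proof (rule nn_integral_radial)
    fix s and x :: 'a assume s: "s > 0" "norm x = r s"
    have "(r s ^ (DIM('a) - 1) * (- r' s)) * (\<rho> x * (norm (grad \<phi> x))\<^sup>2)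
        = (\<rho> x * r s ^ (DIM('a) - 1)) * (- r' s) * (norm (grad \<phi> x))\<^sup>2"
      by (simp add: mult_ac)
    also have "\<dots> = \<kappa> * ((norm (grad \<phi> x))\<^sup>2 * (r' s)\<^sup>2)"
      unfolding \<rho>_eq[OF s] by (simp add: power2_eq_square mult_ac)
    also have "\<dots> = \<kappa> * (p s)\<^sup>2" unfolding norm_grad_radial[OF t s] ..
    finally show "ennreal (r s ^ (DIM('a) - 1) * (- r' s)) * ennreal (\<rho> x * (norm (grad \<phi> x))\<^sup>2) = ennreal (\<kappa> * (p s)\<^sup>2)"
      using r_pos[OF s(1)] r'_neg[OF s(1)] \<rho>_nonneg[of x] by (subst ennreal_mult[symmetric]) (auto simp: mult_nonneg_nonpos)
  qed measurable
  also have "(\<integral>\<^sup>+s. indicator {0<..} s * ennreal (\<kappa> * (p s)\<^sup>2) \<partial>lborel) = (\<integral>\<^sup>+s. ennreal \<kappa> * ennreal ((norm (p s))\<^sup>2) \<partial>lborel)"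
    using p0 \<kappa>_pos by (intro nn_integral_cong) (auto simp: ennreal_mult not_less split: split_indicator)
  also have "\<dots> = ennreal \<kappa> * ennreal ((l2 lborel p)\<^sup>2)"
    by (subst nn_integral_cmult) (simp_all add: nn_integral_sq[OF admissible_sq_integrable[OF ad], simplified])
  also have "(\<integral>\<^sup>+x. indicator \<Omega> x * ennreal (\<rho> x * (norm (grad \<phi> x))\<^sup>2) \<partial>lborel) = ennreal ((l2 lborel (wgrad \<phi>))\<^sup>2)"
    by (rule nn_integral_energy[OF \<phi>])
  finally have "A * (\<kappa> * (l2 lborel p)\<^sup>2) = polar_factor DIM('a) * (l2 lborel (wgrad \<phi>))\<^sup>2"
    using A \<kappa>_pos polar_factor_pos[of "DIM('a)"] by (simp add: ennreal_mult[symmetric])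
  then have "(l2 lborel p)\<^sup>2 = mean_const * (l2 lborel (wgrad \<phi>))\<^sup>2"
    using A \<kappa>_pos by (simp add: mean_const_def A_def[symmetric] field_simps)
  also have "\<dots> = (sqrt mean_const * l2 lborel (wgrad \<phi>))\<^sup>2"
    using mean_const_pos by (simp add: power_mult_distrib)
  finally show ?thesis
    using mean_const_pos by (simp add: l2_nonneg power2_eq_iff_nonneg)
qed

text \<open>Truncation makes the derivative \<open>q\<close> compactly supported in \<open>s\<close>. Smoothing takes place in the
  variable \<open>z = |x|\<^sup>2\<close>, in which radial test functions are smooth functions of one variable: the
  transformed derivative \<open>Q\<close> is approximated uniformly, with support in a slightly larger interval,
  and the antiderivative \<open>G\<close> of the approximation gives the test function \<open>G(|x|\<^sup>2)\<close>. Going back to \<open>s\<close>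
  multiplies by \<open>2 r r'\<close>, which is bounded on the interval in question.\<close>

lemma radial_test_density:
  assumes ad: "admissible u p" and e: "e > 0"
  shows "\<exists>\<phi> v q. radial_test \<phi> v q \<and> l2 lborel (\<lambda>s. p s - q s) < e"
proof -
  obtain v q b where vq: "admissible v q" and b: "\<And>s. s \<ge> b \<Longrightarrow> q s = 0" and pq: "l2 lborel (\<lambda>s. p s - q s) < e / 2"
    using admissible_truncation[OF ad, of "e/2"] e by auto
  obtain a where a: "a > 0" "\<And>s. s \<le> a \<Longrightarrow> q s = 0"
    using vq unfolding admissible_def by blast
  define d where "d = max b (a + 1)"
  have d: "a < d" "\<And>s. s \<ge> d \<Longrightarrow> q s = 0" using b by (auto simp: d_def)
  have q_cont: "continuous_on UNIV q" using vq by (simp add: admissible_def)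
  define S where "S = {z. z > 0 \<and> sqrt z \<in> r ` {0<..}}"
  define Q where "Q z = (if z \<in> S then q (\<sigma> (sqrt z)) / (2 * sqrt z * r' (\<sigma> (sqrt z))) else 0)" for z
  have S_sq: "(r s)\<^sup>2 \<in> S" "sqrt ((r s)\<^sup>2) = r s" if "s > 0" for s
    using r_pos[OF that] that by (auto simp: S_def)
  have S_E: "\<exists>s>0. z = (r s)\<^sup>2" if "z \<in> S" for z
    using that by (auto simp: S_def) (metis greaterThan_iff less_imp_le real_sqrt_pow2)
  have Q_r: "Q ((r s)\<^sup>2) * (2 * r s * r' s) = q s" if "s > 0" for s
    using S_sq[OF that] \<sigma>_r[OF that] r_pos[OF that] r'_neg[OF that] by (simp add: Q_def)
  have sq_less: "(r s)\<^sup>2 < (r t)\<^sup>2 \<longleftrightarrow> t < s" if "s > 0" "t > 0" for s t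
    using r_pos[OF that(1)] r_pos[OF that(2)] r_le_iff[OF that(2,1)]
      abs_le_square_iff[of "r t" "r s"] by (simp add: not_le[symmetric])
  have Q0: "Q z = 0" if "z \<notin> {(r d)\<^sup>2..(r a)\<^sup>2}" for z
  proof (cases "z \<in> S")
    case True
    then obtain s where s: "s > 0" "z = (r s)\<^sup>2" using S_E by blast
    with that have "s > d \<or> s < a" using sq_less[of s d] sq_less[of a s] a d by (auto simp: not_le)
    then have "q s = 0" using a d by auto
    then show ?thesis using S_sq[OF s(1)] s \<sigma>_r by (simp add: Q_def)
  qed (simp add: Q_def)
  have "continuous_on (S \<union> - {(r d)\<^sup>2..(r a)\<^sup>2}) Q"
  proof (rule continuous_on_open_Un)
    have "S = {0<..} \<inter> sqrt -` (r ` {0<..})" by (auto simp: S_def)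
    then show "open S" using open_vimage[OF r_image_open continuous_on_real_sqrt[OF continuous_on_id]] by auto
    have \<sigma>S: "continuous_on S (\<lambda>z. \<sigma> (sqrt z))"
      by (rule continuous_on_compose2[OF \<sigma>_cont]) (auto simp: S_def intro!: continuous_intros)
    have \<sigma>_pos: "\<sigma> (sqrt z) > 0" if "z \<in> S" for z
      using that \<sigma>_r by (auto simp: S_def)
    have "continuous_on S (\<lambda>z. q (\<sigma> (sqrt z)) / (2 * sqrt z * r' (\<sigma> (sqrt z))))"
    proof (intro continuous_intros continuous_on_compose2[OF q_cont \<sigma>S] continuous_on_compose2[OF r'_cont \<sigma>S])
      show "\<forall>z\<in>S. 2 * sqrt z * r' (\<sigma> (sqrt z)) \<noteq> 0"
        using \<sigma>_pos r'_neg by (fastforce simp: S_def)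
    qed (use \<sigma>_pos in auto)
    then show "continuous_on S Q" by (rule continuous_on_eq) (simp add: Q_def)
    have "continuous_on (- {(r d)\<^sup>2..(r a)\<^sup>2}) (\<lambda>z. 0 :: real)" by simp
    then show "continuous_on (- {(r d)\<^sup>2..(r a)\<^sup>2}) Q" by (rule continuous_on_eq) (use Q0 in auto)
  qed auto
  also have "S \<union> - {(r d)\<^sup>2..(r a)\<^sup>2} = UNIV"
  proof -
    have "z \<in> S" if z: "(r d)\<^sup>2 \<le> z" "z \<le> (r a)\<^sup>2" for z
    proof -
      have ra: "r a > 0" "r d > 0" using r_pos a d by auto
      have "z > 0" using z(1) ra by (meson less_le_trans zero_less_power)
      have 1: "r d \<le> sqrt z" using z ra by (simp add: real_le_rsqrt)
      have 2: "sqrt z \<le> r a" using z ra by (simp add: real_le_lsqrt \<open>z > 0\<close> less_imp_le)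
      have "\<exists>s\<ge>a. s \<le> d \<and> r s = sqrt z"
        by (rule IVT2') (use 1 2 a d in \<open>auto intro!: continuous_on_subset[OF r_cont]\<close>)
      then obtain s where "s \<ge> a" "r s = sqrt z" by blast
      then have "s > 0" "sqrt z = r s" using a by auto
      then show ?thesis using \<open>z > 0\<close> by (simp add: S_def)
    qed
    then show ?thesis by (auto simp: not_le)
  qed
  finally have Q_cont: "continuous_on UNIV Q" .
  define a1 where "a1 = a / 2"
  define d1 where "d1 = d + 1"
  have a1: "0 < a1" "a1 < a" "d < d1" "a1 < d1" using a d by (auto simp: a1_def d1_def)
  obtain M where M: "M \<ge> 0" "\<And>s. s \<in> {a1..d1} \<Longrightarrow> \<bar>2 * r s * r' s\<bar> \<le> M"
  proof -
    have "continuous_on {a1..d1} (\<lambda>s. 2 * r s * r' s)"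
      using a1 by (intro continuous_intros continuous_on_subset[OF r_cont] continuous_on_subset[OF r'_cont]) auto
    then have "bounded ((\<lambda>s. 2 * r s * r' s) ` {a1..d1})"
      by (intro compact_imp_bounded compact_continuous_image) auto
    then obtain M where "\<forall>x\<in>(\<lambda>s. 2 * r s * r' s) ` {a1..d1}. norm x \<le> M"
      unfolding bounded_iff by blast
    then have M: "norm (2 * r s * r' s) \<le> M" if "s \<in> {a1..d1}" for s
      by (rule bspec) (rule imageI[OF that])
    show ?thesis
    proof (rule that[of "max 0 M"])
      show "\<bar>2 * r s * r' s\<bar> \<le> max 0 M" if "s \<in> {a1..d1}" for s
        unfolding real_norm_def[symmetric] by (rule order_trans[OF M[OF that] max.cobounded2])
    qed simp
  qed
  define L where "L = d1 - a1"
  have L: "L > 0" using a1 by (simp add: L_def)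
  \<comment> \<open>so small that \<open>\<delta> M sqrt L\<close> stays below \<open>e / 2\<close>; the summand 1 covers \<open>M = 0\<close>\<close>
  define \<delta> where "\<delta> = e / (2 * ((M + 1) * sqrt L))"
  have \<delta>: "\<delta> > 0" using e L M by (simp add: \<delta>_def)
  have "\<exists>p0. (\<forall>k. C_k k p0) \<and> (\<forall>z. z \<notin> {(r d1)\<^sup>2<..<(r a1)\<^sup>2} \<longrightarrow> p0 z = 0) \<and> (\<forall>z. \<bar>p0 z - Q z\<bar> \<le> \<delta>)"
    using Q_cont Q0 \<delta> a1 a d sq_less[of d1 d] sq_less[of d a] sq_less[of a a1]
    by (intro smooth_approximation[where a' = "(r d)\<^sup>2" and b' = "(r a)\<^sup>2"]) auto
  then obtain p0 where p0: "\<And>k. C_k k p0" "\<And>z. z \<notin> {(r d1)\<^sup>2<..<(r a1)\<^sup>2} \<Longrightarrow> p0 z = 0" "\<And>z. \<bar>p0 z - Q z\<bar> \<le> \<delta>"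
    by blast
  have p0_cont: "continuous_on UNIV p0" using p0(1)[of 0] by simp
  obtain G where G: "\<And>z. (G has_real_derivative p0 z) (at z)" "G ((r a1)\<^sup>2) = 0"
    using antiderivative_exists[OF p0_cont] by blast
  have G0: "G z = 0" if "z \<ge> (r a1)\<^sup>2" for z
    using DERIV_zero_on_Ici[of G p0 "(r a1)\<^sup>2" z] G p0(2) that by simp
  have G_smooth: "C_k k G" for k
  proof (cases k)
    case 0
    then show ?thesis using G(1) by (auto intro!: DERIV_continuous_on)
  qed (use C_k_real_SucI[OF G(1) p0(1)] in simp)
  define \<phi> :: "'a \<Rightarrow> real" where "\<phi> x = G (x \<bullet> x)" for x
  have \<phi>: "\<phi> \<in> test_functions \<Omega>"
  proof (rule test_functionsI)
    show "C_k k \<phi>" for k unfolding \<phi>_def by (intro C_k_radial G_smooth)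
    show "cball 0 (r a1) \<subseteq> \<Omega>" using cball_subset a1 by auto
    show "\<phi> x = 0" if "x \<notin> cball 0 (r a1)" for x
    proof -
      have "(r a1)\<^sup>2 \<le> (norm x)\<^sup>2" using that r_pos[OF a1(1)] by (intro power_mono) auto
      then show ?thesis unfolding \<phi>_def by (intro G0) (simp add: power2_norm_eq_inner)
    qed
  qed auto
  define v1 where "v1 s = (if s > 0 then G ((r s)\<^sup>2) else 0)" for s
  define q1 where "q1 s = (if s > 0 then p0 ((r s)\<^sup>2) * (2 * r s * r' s) else 0)" for s
  have v10: "v1 s = 0" if "s \<le> a1" for s
    using that G0[of "(r s)\<^sup>2"] r_antimono_le[of s a1] r_pos[of a1] a1 by (auto simp: v1_def intro: power_mono)
  have q10: "q1 s = 0" if "s \<le> a1 \<or> s \<ge> d1" for s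
    using that p0(2)[of "(r s)\<^sup>2"] sq_less[of s a1] sq_less[of d1 s] a1 by (auto simp: q1_def)
  have v1_der: "(v1 has_real_derivative q1 s) (at s)" for s
  proof (cases "s > 0")
    case True
    have "((\<lambda>s. (r s)\<^sup>2) has_real_derivative (2 * r s * r' s)) (at s)"
      using r_deriv[OF True] by (auto intro!: derivative_eq_intros)
    from DERIV_chain2[OF G(1) this]
    have "((\<lambda>s. G ((r s)\<^sup>2)) has_real_derivative q1 s) (at s)"
      using True by (simp add: q1_def)
    then show ?thesis
      by (rule has_field_derivative_transform_within_open[where S = "{0<..}"]) (use True in \<open>auto simp: v1_def\<close>)
  next
    case False
    have "((\<lambda>s. 0) has_real_derivative q1 s) (at s)" using False by (simp add: q1_def)
    then show ?thesis
      by (rule has_field_derivative_transform_within_open[where S = "{..<a1}"]) (use False a1 v10 in auto)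
  qed
  have "continuous_on ({0<..} \<union> {..<a1}) q1"
  proof (rule continuous_on_open_Un)
    have "continuous_on {0<..} (\<lambda>s. p0 ((r s)\<^sup>2) * (2 * r s * r' s))"
      by (intro continuous_intros continuous_on_compose2[OF p0_cont] r_cont r'_cont) auto
    then show "continuous_on {0<..} q1" by (rule continuous_on_eq) (simp add: q1_def)
    have "continuous_on {..<a1} (\<lambda>s. 0 :: real)" by simp
    then show "continuous_on {..<a1} q1" by (rule continuous_on_eq) (use q10 in auto)
  qed auto
  also have "{0<..} \<union> {..<a1} = UNIV" using a1 by auto
  finally have q1_cont: "continuous_on UNIV q1" .
  have "sq_integrable lborel q1"
    by (rule sq_integrable_continuous_support[OF q1_cont, of a1 d1]) (use q10 in auto)
  then have ad1: "admissible v1 q1"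
    using q1_cont v1_der v10 q10 a1 unfolding admissible_def by blast
  have "radial_test \<phi> v1 q1"
    unfolding radial_test_def
  proof (intro conjI \<phi> ad1 ballI)
    fix x assume x: "x \<in> \<Omega> - {0}"
    then have "\<sigma> (norm x) > 0" "r (\<sigma> (norm x)) = norm x" using \<Omega>_polar[of x] by auto
    then show "\<phi> x = v1 (\<sigma> (norm x))"
      by (simp add: \<phi>_def v1_def power2_norm_eq_inner)
  qed
  moreover have "l2 lborel (\<lambda>s. p s - q1 s) < e"
  proof -
    have "l2 lborel (\<lambda>s. p s - q1 s) \<le> l2 lborel (\<lambda>s. p s - q s) + l2 lborel (\<lambda>s. q s - q1 s)"
      by (rule l2_triangle3) (auto intro: admissible_sq_integrable ad vq ad1)
    also have "l2 lborel (\<lambda>s. q s - q1 s) \<le> e / 2"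
    proof -
      have pt: "(norm (q s - q1 s))\<^sup>2 \<le> indicator {a1..d1} s * (\<delta> * M)\<^sup>2" for s
      proof (cases "s \<in> {a1..d1}")
        case True
        then have s: "s > 0" using a1 by simp
        have "q s - q1 s = (Q ((r s)\<^sup>2) - p0 ((r s)\<^sup>2)) * (2 * r s * r' s)"
          using Q_r[OF s] s by (simp add: q1_def left_diff_distrib)
        also have "\<bar>\<dots>\<bar> \<le> \<delta> * M"
          unfolding abs_mult[of "_ - _"] using p0(3)[of "(r s)\<^sup>2"] M(2)[OF True] M(1) \<delta>
          by (intro mult_mono) (auto simp: abs_minus_commute)
        finally have "\<bar>q s - q1 s\<bar> \<le> \<delta> * M" .
        then have "\<bar>q s - q1 s\<bar>\<^sup>2 \<le> (\<delta> * M)\<^sup>2" by (intro power_mono) auto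
        then show ?thesis using True by simp
      next
        case False
        then have "q s = 0" "q1 s = 0" using q10 a d a1 by auto
        then show ?thesis by simp
      qed
      have ind: "integrable lborel (\<lambda>s. indicator {a1..d1} s * (\<delta> * M)\<^sup>2 :: real)"
        using a1 by (intro integrable_mult_left integrable_real_indicator) auto
      have "(l2 lborel (\<lambda>s. q s - q1 s))\<^sup>2 \<le> (\<integral>s. indicator {a1..d1} s * (\<delta> * M)\<^sup>2 \<partial>lborel)"
        unfolding l2_sq
        by (rule integral_mono[OF _ ind pt])
           (use sq_integrable_diff[OF admissible_sq_integrable[OF vq] admissible_sq_integrable[OF ad1]] in \<open>simp add: sq_integrable_def\<close>)
      also have "\<dots> = (\<delta> * M * sqrt L)\<^sup>2"
        using a1 L by (simp add: L_def power_mult_distrib)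
      finally have "l2 lborel (\<lambda>s. q s - q1 s) \<le> \<delta> * M * sqrt L"
        by (rule power2_le_imp_le) (use \<delta> M L in auto)
      also have "\<dots> \<le> \<delta> * (M + 1) * sqrt L" using \<delta> L by (intro mult_right_mono mult_left_mono) auto
      also have "\<dots> = e / 2"
      proof -
        have "e / (2 * X) * X = e / 2" if "X > 0" for X :: real using that by simp
        from this[of "(M + 1) * sqrt L"] show ?thesis
          using L M by (simp add: \<delta>_def mult.assoc)
      qed
      finally show ?thesis .
    qed
    finally show ?thesis using pq by simp
  qed
  ultimately show ?thesis by blast
qed

section \<open>From profiles back to functions\<close>

lemma approximates_radial_test:
  assumes "approximates u U P"
  shows "\<exists>\<phi> V Q. (\<forall>n. radial_test (\<phi> n) (V n) (Q n)) \<and> (\<lambda>n. l2 lborel (\<lambda>s. P n s - Q n s)) \<longlonglongrightarrow> 0"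
proof -
  have "\<forall>n. \<exists>t. radial_test (fst t) (fst (snd t)) (snd (snd t)) \<and> l2 lborel (\<lambda>s. P n s - snd (snd t) s) < 1 / real (Suc n)"
  proof
    fix n
    have "admissible (U n) (P n)" using assms by (simp add: approximates_def)
    from radial_test_density[OF this, of "1 / real (Suc n)"]
    show "\<exists>t. radial_test (fst t) (fst (snd t)) (snd (snd t)) \<and> l2 lborel (\<lambda>s. P n s - snd (snd t) s) < 1 / real (Suc n)"
      by force
  qed
  from choice[OF this] obtain t where t: "\<And>n. radial_test (fst (t n)) (fst (snd (t n))) (snd (snd (t n)))"
    "\<And>n. l2 lborel (\<lambda>s. P n s - snd (snd (t n)) s) < 1 / real (Suc n)"
    by blast
  have "(\<lambda>n. l2 lborel (\<lambda>s. P n s - snd (snd (t n)) s)) \<longlonglongrightarrow> 0"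
  proof (rule tendsto_sandwich[OF _ _ tendsto_const LIMSEQ_Suc[OF lim_1_over_n]])
    show "\<forall>\<^sub>F n in sequentially. l2 lborel (\<lambda>s. P n s - snd (snd (t n)) s) \<le> 1 / real (Suc n)"
      using t(2) by (intro always_eventually allI less_imp_le)
  qed (simp add: l2_nonneg)
  with t(1) show ?thesis
    by (intro exI[of _ "\<lambda>n. fst (t n)"] exI[of _ "\<lambda>n. fst (snd (t n))"] exI[of _ "\<lambda>n. snd (snd (t n))"]) auto
qed

text \<open>The bound \<open>admissible_bound\<close> for differences makes the test functions converge uniformly relative
  to \<open>1 + s(|x|)\<close>, which is integrable on compact subsets of \<open>\<Omega>\<close>.\<close>

lemma radial_test_represents:
  assumes app: "approximates u V Q" and t: "\<And>n. radial_test (\<phi> n) (V n) (Q n)"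
    and prof: "AE x in lebesgue. x \<in> \<Omega> - {0} \<longrightarrow> v x = u (\<sigma> (norm x))"
  shows "represents \<rho> \<Omega> \<phi> v"
proof -
  have \<phi>: "\<phi> n \<in> test_functions \<Omega>" and ad: "admissible (V n) (Q n)" for n
    using t[of n] by (auto simp: radial_test_def)
  have C: "l2_Cauchy lborel Q" using app by (simp add: approximates_def)
  note [measurable] = test_functions_measurable(1)[OF \<phi>]
  have "l2_Cauchy lborel (\<lambda>n. wgrad (\<phi> n))"
    unfolding l2_Cauchy_def
  proof (intro allI impI)
    fix e :: real assume "e > 0"
    then have "sqrt mean_const * e > 0" using mean_const_pos by simp
    then obtain n0 where n0: "\<And>m n. m \<ge> n0 \<Longrightarrow> n \<ge> n0 \<Longrightarrow> l2 lborel (\<lambda>x. Q m x - Q n x) < sqrt mean_const * e"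
      using C unfolding l2_Cauchy_def by blast
    have "l2 lborel (\<lambda>x. wgrad (\<phi> m) x - wgrad (\<phi> n) x) < e" if "m \<ge> n0" "n \<ge> n0" for m n
      using n0[OF that] radial_test_energy[OF radial_test_diff[OF t t], of m n] mean_const_pos
      by (simp add: wgrad_diff \<phi>)
    then show "\<exists>n0. \<forall>m\<ge>n0. \<forall>n\<ge>n0. l2 lborel (\<lambda>x. wgrad (\<phi> m) x - wgrad (\<phi> n) x) < e"
      by blast
  qed
  then have Cauchy: "\<forall>e>0. \<exists>M. \<forall>m\<ge>M. \<forall>n\<ge>M. dirichlet_norm \<rho> \<Omega> (\<lambda>x. \<phi> m x - \<phi> n x) < e"
    by (simp only: dirichlet_Cauchy_iff[of \<phi>, OF \<phi>])
  define W where "W s = lim (\<lambda>n. V n s)" for s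
  have W: "(\<lambda>n. V n s) \<longlonglongrightarrow> W s" if "s > 0" for s
    using l2_Cauchy_profile_converges[OF ad C, of s] that by (simp add: W_def convergent_LIMSEQ_iff)
  have "AE s in lborel. s > 0 \<longrightarrow> u s = W s"
  proof -
    have "AE s in lborel. s > 0 \<longrightarrow> (\<lambda>n. V n s) \<longlonglongrightarrow> u s" using app by (simp add: approximates_def)
    then show ?thesis by eventually_elim (use W LIMSEQ_unique in blast)
  qed
  from AE_radial[OF this] prof[unfolded AE_completion_iff]
  have v_eq: "AE x in lborel. x \<in> \<Omega> - {0} \<longrightarrow> v x = W (\<sigma> (norm x))"
    by eventually_elim auto
  define v0 where "v0 x = lim (\<lambda>n. \<phi> n x)" for x
  have [measurable]: "v0 \<in> borel_measurable borel" unfolding v0_def by measurable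
  have v0_eq: "v0 x = W (\<sigma> (norm x))" if "x \<in> \<Omega> - {0}" for x
    using that t by (simp add: v0_def W_def radial_test_def)
  have v_v0: "AE x in lborel. x \<in> \<Omega> \<longrightarrow> v x = v0 x"
    using v_eq AE_nonzero by eventually_elim (use v0_eq in auto)
  have unif: "\<exists>n0. \<forall>n\<ge>n0. \<forall>x\<in>\<Omega> - {0}. \<bar>\<phi> n x - v0 x\<bar> \<le> e * (1 + \<sigma> (norm x))" if e: "e > 0" for e
  proof -
    obtain n0 where n0: "\<And>m n. m \<ge> n0 \<Longrightarrow> n \<ge> n0 \<Longrightarrow> l2 lborel (\<lambda>x. Q m x - Q n x) < e"
      using C e unfolding l2_Cauchy_def by blast
    have "\<bar>\<phi> n x - v0 x\<bar> \<le> e * (1 + \<sigma> (norm x))" if n: "n \<ge> n0" and x: "x \<in> \<Omega> - {0}" for n x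
    proof -
      define s where "s = \<sigma> (norm x)"
      have s: "s > 0" using \<Omega>_polar x by (simp add: s_def)
      have "\<bar>V n s - V m s\<bar> \<le> e * (1 + s)" if "m \<ge> n0" for m
      proof -
        have "\<bar>V n s - V m s\<bar> \<le> (1 + s) * l2 lborel (\<lambda>x. Q n x - Q m x)"
          by (rule admissible_bound[OF admissible_diff[OF ad ad]]) (use s in simp)
        also have "\<dots> \<le> (1 + s) * e" using n0[OF n that] s by (intro mult_left_mono) auto
        finally show ?thesis by (simp add: mult.commute)
      qed
      then have "\<bar>V n s - W s\<bar> \<le> e * (1 + s)"
        by (intro tendsto_upperbound[OF tendsto_rabs[OF tendsto_diff[OF tendsto_const W[OF s]]]])
           (auto simp: eventually_sequentially)
      then show ?thesis
        using v0_eq[OF x] t[of n] x by (simp add: radial_test_def s_def)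
    qed
    then show ?thesis by blast
  qed
  have "set_integrable lebesgue K v \<and> (\<lambda>n. LINT x:K|lebesgue. \<bar>\<phi> n x - v x\<bar>) \<longlonglongrightarrow> 0"
    if K: "compact K" "K \<subseteq> \<Omega>" for K
  proof -
    have [measurable]: "K \<in> sets borel" by (rule borel_compact[OF K(1)])
    define g where "g x = indicator K x * (1 + \<sigma> (norm x))" for x
    have g_int: "integrable lborel g"
    proof -
      have "integrable lborel (\<lambda>x. indicator K x *\<^sub>R (1::real))" by (rule borel_integrable_compact[OF K(1)]) simp
      then have "integrable lborel (\<lambda>x. indicator K x *\<^sub>R (1::real) + indicator K x *\<^sub>R \<sigma> (norm x))"
        using \<sigma>_int[OF K] unfolding set_integrable_def by (rule Bochner_Integration.integrable_add)
      then show ?thesis by (simp add: g_def[abs_def] distrib_left)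
    qed
    have \<phi>_int: "integrable lborel (\<lambda>x. indicator K x * \<phi> n x)" for n
      using borel_integrable_compact[OF K(1) continuous_on_subset[OF test_functionsD(3)[OF \<phi>[of n]]]] by simp
    have bound: "AE x in lborel. \<bar>indicator K x * \<phi> n x - indicator K x * v0 x\<bar> \<le> e * g x"
      if "\<forall>x\<in>\<Omega> - {0}. \<bar>\<phi> n x - v0 x\<bar> \<le> e * (1 + \<sigma> (norm x))" for n e
      using AE_nonzero by eventually_elim (use that K(2) in \<open>auto simp: g_def split: split_indicator\<close>)
    have diff_int: "integrable lborel (\<lambda>x. indicator K x * \<phi> n x - indicator K x * v0 x)"
      if "\<forall>x\<in>\<Omega> - {0}. \<bar>\<phi> n x - v0 x\<bar> \<le> e * (1 + \<sigma> (norm x))" for n e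
    proof (rule Bochner_Integration.integrable_bound)
      show "integrable lborel (\<lambda>x. e * g x)" using g_int by simp
      show "AE x in lborel. norm (indicator K x * \<phi> n x - indicator K x * v0 x) \<le> norm (e * g x)"
        using bound[OF that] by eventually_elim auto
    qed measurable
    have v0_int: "integrable lborel (\<lambda>x. indicator K x * v0 x)"
    proof -
      obtain n where "\<forall>x\<in>\<Omega> - {0}. \<bar>\<phi> n x - v0 x\<bar> \<le> 1 * (1 + \<sigma> (norm x))" using unif[of 1] by auto
      from Bochner_Integration.integrable_diff[OF \<phi>_int[of n] diff_int[OF this]] show ?thesis by simp
    qed
    have Kv: "AE x in lebesgue. indicator K x * v0 x = indicator K x * v x"
      unfolding AE_completion_iff using v_v0 by eventually_elim (use K(2) in \<open>auto split: split_indicator\<close>)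
    have v_meas: "(\<lambda>x. indicator K x * v x) \<in> borel_measurable lebesgue"
      by (rule borel_measurable_AE[OF _ Kv]) (auto intro!: measurable_completion)
    have "integrable lebesgue (\<lambda>x. indicator K x * v0 x)"
      using v0_int by (simp add: integrable_completion)
    then have Kv_int: "integrable lebesgue (\<lambda>x. indicator K x * v x)"
      by (rule integrable_cong_AE_imp[OF _ v_meas]) (use Kv in eventually_elim, simp)
    have LINT_eq: "(LINT x:K|lebesgue. \<bar>\<phi> n x - v x\<bar>) = (\<integral>x. \<bar>indicator K x * \<phi> n x - indicator K x * v0 x\<bar> \<partial>lborel)" for n
    proof -
      have "(LINT x:K|lebesgue. \<bar>\<phi> n x - v x\<bar>) = (\<integral>x. \<bar>indicator K x * \<phi> n x - indicator K x * v x\<bar> \<partial>lebesgue)"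
        unfolding set_lebesgue_integral_def by (intro Bochner_Integration.integral_cong) (auto split: split_indicator)
      also have "\<dots> = (\<integral>x. \<bar>indicator K x * \<phi> n x - indicator K x * v0 x\<bar> \<partial>lebesgue)"
      proof (rule integral_cong_AE)
        show "AE x in lebesgue. \<bar>indicator K x * \<phi> n x - indicator K x * v x\<bar> = \<bar>indicator K x * \<phi> n x - indicator K x * v0 x\<bar>"
          using Kv by eventually_elim (simp only:)
        have m: "(\<lambda>x. indicator K x * \<phi> n x) \<in> borel_measurable lebesgue" "(\<lambda>x. indicator K x * v0 x) \<in> borel_measurable lebesgue"
          by (intro measurable_completion; measurable)+
        show "(\<lambda>x. \<bar>indicator K x * \<phi> n x - indicator K x * v x\<bar>) \<in> borel_measurable lebesgue"
          "(\<lambda>x. \<bar>indicator K x * \<phi> n x - indicator K x * v0 x\<bar>) \<in> borel_measurable lebesgue"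
          by (intro borel_measurable_abs borel_measurable_diff m v_meas)+
      qed
      also have "\<dots> = (\<integral>x. \<bar>indicator K x * \<phi> n x - indicator K x * v0 x\<bar> \<partial>lborel)"
        by (rule integral_completion) measurable
      finally show ?thesis .
    qed
    have "(\<lambda>n. LINT x:K|lebesgue. \<bar>\<phi> n x - v x\<bar>) \<longlonglongrightarrow> 0"
    proof (rule LIMSEQ_I)
      fix e :: real assume e: "e > 0"
      define I where "I = (\<integral>x. g x \<partial>lborel)"
      have "e / (\<bar>I\<bar> + 1) > 0" using e by simp
      from unif[OF this] obtain n0 where n0: "\<And>n. n \<ge> n0 \<Longrightarrow> \<forall>x\<in>\<Omega> - {0}. \<bar>\<phi> n x - v0 x\<bar> \<le> e / (\<bar>I\<bar> + 1) * (1 + \<sigma> (norm x))"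
        by blast
      have "norm ((LINT x:K|lebesgue. \<bar>\<phi> n x - v x\<bar>) - 0) < e" if "n \<ge> n0" for n
      proof -
        have "(\<integral>x. \<bar>indicator K x * \<phi> n x - indicator K x * v0 x\<bar> \<partial>lborel) \<le> (\<integral>x. e / (\<bar>I\<bar> + 1) * g x \<partial>lborel)"
          by (rule integral_mono_AE[OF integrable_abs[OF diff_int[OF n0[OF that]]] _ bound[OF n0[OF that]]]) (use g_int in simp)
        also have "\<dots> = e / (\<bar>I\<bar> + 1) * I" by (simp add: I_def)
        also have "\<dots> < e"
        proof -
          have "e * I < e * (\<bar>I\<bar> + 1)" using e by (intro mult_strict_left_mono) auto
          moreover have "\<bar>I\<bar> + 1 > 0" by simp
          ultimately show ?thesis by (simp add: pos_divide_less_eq)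
        qed
        finally have "(LINT x:K|lebesgue. \<bar>\<phi> n x - v x\<bar>) < e" unfolding LINT_eq .
        moreover have "(LINT x:K|lebesgue. \<bar>\<phi> n x - v x\<bar>) \<ge> 0" unfolding LINT_eq by simp
        ultimately show ?thesis by simp
      qed
      then show "\<exists>n0. \<forall>n\<ge>n0. norm ((LINT x:K|lebesgue. \<bar>\<phi> n x - v x\<bar>) - 0) < e" by blast
    qed
    with Kv_int show ?thesis by (simp add: set_integrable_def)
  qed
  with \<phi> Cauchy show ?thesis unfolding represents_def by blast
qed

section \<open>Closability of the Dirichlet form\<close>

lemma norm_wgrad_inner: "(norm (wgrad \<phi> x))\<^sup>2 = indicator \<Omega> x * (\<rho> x * (grad \<phi> x \<bullet> grad \<phi> x))"
  unfolding norm_wgrad by (simp only: power2_norm_eq_inner)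

text \<open>Let \<open>B k\<close> be the energy with respect to a \<open>C\<^sup>1\<close> weight \<open>\<rho>' k\<close> from a sequence tending to \<open>\<rho>\<close> from
  below. From \<open>|a|\<^sup>2 \<le> |a - b|\<^sup>2 + 2 a \<bullet> b\<close>, the energy \<open>B k\<close>
  of \<open>\<theta> n\<close> is at most that of \<open>\<theta> n - \<theta> m\<close>, which is small for all \<open>k\<close>, plus a pairing which tends to 0 as
  \<open>m \<rightarrow> \<infinity>\<close> with \<open>n\<close> and \<open>k\<close> fixed. The limit \<open>k \<rightarrow> \<infinity>\<close> comes last, so the pairing never involves the
  singular weight.\<close>

lemma closable:
  assumes \<theta>: "\<And>n. \<theta> n \<in> test_functions \<Omega>" and C: "l2_Cauchy lborel (\<lambda>n. wgrad (\<theta> n))"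
    and lim: "\<And>K. compact K \<Longrightarrow> K \<subseteq> \<Omega> \<Longrightarrow> (\<lambda>n. LINT x:K|lebesgue. \<bar>\<theta> n x\<bar>) \<longlonglongrightarrow> 0"
  shows "(\<lambda>n. l2 lborel (wgrad (\<theta> n))) \<longlonglongrightarrow> 0"
proof -
  obtain \<rho>' where \<rho>'_C: "\<And>k. C_k 1 (\<rho>' k)"
    and \<rho>'_le: "\<And>k x. x \<in> \<Omega> - {0} \<Longrightarrow> 0 \<le> \<rho>' k x \<and> \<rho>' k x \<le> \<rho> x"
    and \<rho>'_lim: "\<And>x. x \<in> \<Omega> - {0} \<Longrightarrow> (\<lambda>k. \<rho>' k x) \<longlonglongrightarrow> \<rho> x"
    using \<rho>_approx by metis
  have \<rho>'_cont: "continuous_on UNIV (\<rho>' k)" for k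
    using C_k_Suc_imp[of 0 "\<rho>' k"] \<rho>'_C[of k] by simp
  have [measurable]: "grad (\<theta> n) \<in> borel_measurable borel" "\<rho>' k \<in> borel_measurable borel" for n k
    using test_functionsD(4)[OF \<theta>] \<rho>'_cont by (auto intro: borel_measurable_continuous_onI)
  have grad0: "grad \<phi> x = 0" if "\<phi> \<in> test_functions \<Omega>" "x \<notin> \<Omega>" for \<phi> x
    using test_functionsD(5)[OF that(1)] that(2) by blast
  have int: "integrable lborel (\<lambda>x. \<rho>' k x * (grad \<phi> x \<bullet> grad \<psi> x))"
    if \<phi>: "\<phi> \<in> test_functions \<Omega>" and \<psi>: "\<psi> \<in> test_functions \<Omega>" for \<phi> \<psi> k
  proof -
    obtain K where K: "compact K" "\<And>x. x \<notin> K \<Longrightarrow> \<phi> x = 0 \<and> grad \<phi> x = 0"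
      using test_functionsD(5)[OF \<phi>] by blast
    show ?thesis
      by (rule integrable_continuous_compact_support[OF _ K(1)])
         (use K(2) in \<open>auto intro!: continuous_intros \<rho>'_cont test_functionsD(4)[OF \<phi>] test_functionsD(4)[OF \<psi>]\<close>)
  qed
  define B where "B k \<phi> = (\<integral>x. \<rho>' k x * (grad \<phi> x \<bullet> grad \<phi> x) \<partial>lborel)" for k \<phi>
  have B_le: "B k \<phi> \<le> (l2 lborel (wgrad \<phi>))\<^sup>2" if \<phi>: "\<phi> \<in> test_functions \<Omega>" for k \<phi>
    unfolding B_def l2_sq
  proof (rule integral_mono_AE[OF int[OF \<phi> \<phi>]])
    show "integrable lborel (\<lambda>x. (norm (wgrad \<phi> x))\<^sup>2)"
      using sq_integrable_wgrad[OF \<phi>] by (simp add: sq_integrable_def)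
    show "AE x in lborel. \<rho>' k x * (grad \<phi> x \<bullet> grad \<phi> x) \<le> (norm (wgrad \<phi> x))\<^sup>2"
      using AE_nonzero
    proof eventually_elim
      case (elim x)
      show ?case
        using \<rho>'_le[of x k] elim grad0[OF \<phi>, of x]
        by (cases "x \<in> \<Omega>") (auto simp: norm_wgrad_inner intro: mult_right_mono)
    qed
  qed
  have B_lim: "(\<lambda>k. B k \<phi>) \<longlonglongrightarrow> (l2 lborel (wgrad \<phi>))\<^sup>2" if \<phi>: "\<phi> \<in> test_functions \<Omega>" for \<phi>
    unfolding B_def l2_sq
  proof (rule integral_dominated_convergence[where w = "\<lambda>x. (norm (wgrad \<phi> x))\<^sup>2"])
    note [measurable] = test_functions_measurable(2)[OF \<phi>]
    show "(\<lambda>x. \<rho>' k x * (grad \<phi> x \<bullet> grad \<phi> x)) \<in> borel_measurable lborel" for k by measurable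
    show "integrable lborel (\<lambda>x. (norm (wgrad \<phi> x))\<^sup>2)"
      using sq_integrable_wgrad[OF \<phi>] by (simp add: sq_integrable_def)
    then show "(\<lambda>x. (norm (wgrad \<phi> x))\<^sup>2) \<in> borel_measurable lborel" by simp
    show "AE x in lborel. (\<lambda>k. \<rho>' k x * (grad \<phi> x \<bullet> grad \<phi> x)) \<longlonglongrightarrow> (norm (wgrad \<phi> x))\<^sup>2"
      using AE_nonzero
    proof eventually_elim
      case (elim x)
      show ?case
      proof (cases "x \<in> \<Omega>")
        case True
        then have "(\<lambda>k. \<rho>' k x * (grad \<phi> x \<bullet> grad \<phi> x)) \<longlonglongrightarrow> \<rho> x * (grad \<phi> x \<bullet> grad \<phi> x)"
          using elim by (intro tendsto_intros \<rho>'_lim) auto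
        then show ?thesis using True by (simp add: norm_wgrad_inner)
      qed (simp add: norm_wgrad_inner grad0[OF \<phi>])
    qed
    show "AE x in lborel. norm (\<rho>' k x * (grad \<phi> x \<bullet> grad \<phi> x)) \<le> (norm (wgrad \<phi> x))\<^sup>2" for k
      using AE_nonzero
    proof eventually_elim
      case (elim x)
      show ?case
        using \<rho>'_le[of x k] elim grad0[OF \<phi>, of x]
        by (cases "x \<in> \<Omega>") (auto simp: norm_wgrad_inner abs_mult intro: mult_right_mono)
    qed
  qed
  show ?thesis
  proof (rule LIMSEQ_I)
    fix e :: real assume e: "e > 0"
    then obtain n0 where n0: "\<And>m n. m \<ge> n0 \<Longrightarrow> n \<ge> n0 \<Longrightarrow> l2 lborel (\<lambda>x. wgrad (\<theta> m) x - wgrad (\<theta> n) x) < e / 2"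
      using C unfolding l2_Cauchy_def by (meson half_gt_zero)
    have "l2 lborel (wgrad (\<theta> n)) < e" if n: "n \<ge> n0" for n
    proof -
      have "B k (\<theta> n) \<le> (e / 2)\<^sup>2" for k
      proof -
        have le: "B k (\<theta> n) \<le> (e / 2)\<^sup>2 + 2 * (\<integral>x. \<rho>' k x * (grad (\<theta> n) x \<bullet> grad (\<theta> m) x) \<partial>lborel)" if m: "m \<ge> n0" for m
        proof -
          let ?\<eta> = "\<lambda>x. \<theta> n x - \<theta> m x"
          have \<eta>: "?\<eta> \<in> test_functions \<Omega>" by (intro test_functions_diff \<theta>)
          have "B k (\<theta> n) \<le> (\<integral>x. \<rho>' k x * (grad ?\<eta> x \<bullet> grad ?\<eta> x) + 2 * (\<rho>' k x * (grad (\<theta> n) x \<bullet> grad (\<theta> m) x)) \<partial>lborel)"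
            unfolding B_def
          proof (rule integral_mono_AE[OF int[OF \<theta> \<theta>]])
            show "integrable lborel (\<lambda>x. \<rho>' k x * (grad ?\<eta> x \<bullet> grad ?\<eta> x) + 2 * (\<rho>' k x * (grad (\<theta> n) x \<bullet> grad (\<theta> m) x)))"
              by (intro Bochner_Integration.integrable_add integrable_mult_right int \<eta> \<theta>)
            show "AE x in lborel. \<rho>' k x * (grad (\<theta> n) x \<bullet> grad (\<theta> n) x)
                \<le> \<rho>' k x * (grad ?\<eta> x \<bullet> grad ?\<eta> x) + 2 * (\<rho>' k x * (grad (\<theta> n) x \<bullet> grad (\<theta> m) x))"
              using AE_nonzero
            proof eventually_elim
              case (elim x)
              show ?case
              proof (cases "x \<in> \<Omega>")
                case True
                then have "\<rho>' k x \<ge> 0" using \<rho>'_le[of x k] elim by auto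
                then have "0 \<le> \<rho>' k x * (grad (\<theta> m) x \<bullet> grad (\<theta> m) x)" by simp
                then show ?thesis
                  by (simp add: grad_diff[OF \<theta> \<theta>] inner_diff_left inner_diff_right inner_commute algebra_simps)
              qed (simp add: grad0[OF \<theta>] grad0[OF \<eta>])
            qed
          qed
          also have "\<dots> = B k ?\<eta> + 2 * (\<integral>x. \<rho>' k x * (grad (\<theta> n) x \<bullet> grad (\<theta> m) x) \<partial>lborel)"
            unfolding B_def using int[OF \<eta> \<eta>, of k] int[OF \<theta> \<theta>, of k n m] by simp
          also have "B k ?\<eta> \<le> (e / 2)\<^sup>2"
          proof -
            have "B k ?\<eta> \<le> (l2 lborel (wgrad ?\<eta>))\<^sup>2" by (rule B_le[OF \<eta>])
            also have "\<dots> \<le> (e / 2)\<^sup>2"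
              using n0[OF n m] by (intro power_mono) (auto simp: wgrad_diff \<theta> l2_nonneg)
            finally show ?thesis .
          qed
          finally show ?thesis by simp
        qed
        have "(\<lambda>m. (e / 2)\<^sup>2 + 2 * (\<integral>x. \<rho>' k x * (grad (\<theta> n) x \<bullet> grad (\<theta> m) x) \<partial>lborel)) \<longlonglongrightarrow> (e / 2)\<^sup>2 + 2 * 0"
          by (intro tendsto_intros gradient_pairing_tendsto_0[OF \<theta> \<theta> \<rho>'_C lim])
        then have "(\<lambda>m. (e / 2)\<^sup>2 + 2 * (\<integral>x. \<rho>' k x * (grad (\<theta> n) x \<bullet> grad (\<theta> m) x) \<partial>lborel)) \<longlonglongrightarrow> (e / 2)\<^sup>2"
          by simp
        then show ?thesis
          by (rule LIMSEQ_le_const) (use le in blast)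
      qed
      then have "(l2 lborel (wgrad (\<theta> n)))\<^sup>2 \<le> (e / 2)\<^sup>2"
        by (intro tendsto_upperbound[OF B_lim[OF \<theta>]]) auto
      then have "l2 lborel (wgrad (\<theta> n)) \<le> e / 2"
        by (rule power2_le_imp_le) (use e in simp)
      then show ?thesis using e by simp
    qed
    then show "\<exists>n0. \<forall>n\<ge>n0. norm (l2 lborel (wgrad (\<theta> n)) - 0) < e"
      by (auto simp: l2_nonneg)
  qed
qed

lemma represents_unique:
  assumes \<phi>v: "represents \<rho> \<Omega> \<phi> v" and \<psi>v: "represents \<rho> \<Omega> \<psi> v"
  shows "(\<lambda>n. l2 lborel (\<lambda>x. wgrad (\<phi> n) x - wgrad (\<psi> n) x)) \<longlonglongrightarrow> 0"
proof -
  have \<phi>: "\<phi> n \<in> test_functions \<Omega>" and \<psi>: "\<psi> n \<in> test_functions \<Omega>" for n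
    using assms by (auto simp: represents_def)
  have C: "l2_Cauchy lborel (\<lambda>n. wgrad (\<phi> n))" "l2_Cauchy lborel (\<lambda>n. wgrad (\<psi> n))"
    using assms by (simp_all add: represents_def dirichlet_Cauchy_iff[OF \<phi>, symmetric] dirichlet_Cauchy_iff[OF \<psi>, symmetric])
  have [measurable]: "\<phi> n \<in> borel_measurable borel" "\<psi> n \<in> borel_measurable borel" for n
    using test_functionsD(3)[OF \<phi>] test_functionsD(3)[OF \<psi>] by (auto intro: borel_measurable_continuous_onI)
  have "(\<lambda>n. l2 lborel (wgrad (\<lambda>x. \<phi> n x - \<psi> n x))) \<longlonglongrightarrow> 0"
  proof (rule closable)
    show "(\<lambda>x. \<phi> n x - \<psi> n x) \<in> test_functions \<Omega>" for n by (intro test_functions_diff \<phi> \<psi>)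
    show "l2_Cauchy lborel (\<lambda>n. wgrad (\<lambda>x. \<phi> n x - \<psi> n x))"
      unfolding wgrad_diff[OF \<phi> \<psi>] by (intro l2_Cauchy_diff C sq_integrable_wgrad \<phi> \<psi>)
    fix K assume K: "compact K" "K \<subseteq> \<Omega>"
    have [measurable]: "K \<in> sets borel" by (rule borel_compact[OF K(1)])
    have v: "set_integrable lebesgue K v"
      and lim: "(\<lambda>n. LINT x:K|lebesgue. \<bar>\<phi> n x - v x\<bar>) \<longlonglongrightarrow> 0" "(\<lambda>n. LINT x:K|lebesgue. \<bar>\<psi> n x - v x\<bar>) \<longlonglongrightarrow> 0"
      using assms K by (auto simp: represents_def)
    have int: "set_integrable lebesgue K \<eta>" if "\<eta> \<in> test_functions \<Omega>" for \<eta>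
    proof -
      have "integrable lborel (\<lambda>x. indicator K x *\<^sub>R \<eta> x)"
        by (rule borel_integrable_compact[OF K(1) continuous_on_subset[OF test_functionsD(3)[OF that]]]) simp
      then show ?thesis unfolding set_integrable_def by (subst integrable_completion) auto
    qed
    have bound: "(LINT x:K|lebesgue. \<bar>\<phi> n x - \<psi> n x\<bar>) \<le> (LINT x:K|lebesgue. \<bar>\<phi> n x - v x\<bar>) + (LINT x:K|lebesgue. \<bar>\<psi> n x - v x\<bar>)" for n
    proof -
      have i: "set_integrable lebesgue K (\<lambda>x. \<bar>\<phi> n x - v x\<bar>)" "set_integrable lebesgue K (\<lambda>x. \<bar>\<psi> n x - v x\<bar>)"
        "set_integrable lebesgue K (\<lambda>x. \<bar>\<phi> n x - \<psi> n x\<bar>)"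
        by (intro set_integrable_abs set_integral_diff(1) int \<phi> \<psi> v)+
      have "(LINT x:K|lebesgue. \<bar>\<phi> n x - \<psi> n x\<bar>) \<le> (LINT x:K|lebesgue. \<bar>\<phi> n x - v x\<bar> + \<bar>\<psi> n x - v x\<bar>)"
        by (rule set_integral_mono[OF i(3) set_integral_add(1)[OF i(1,2)]]) auto
      also have "\<dots> = (LINT x:K|lebesgue. \<bar>\<phi> n x - v x\<bar>) + (LINT x:K|lebesgue. \<bar>\<psi> n x - v x\<bar>)"
        by (rule set_integral_add(2)[OF i(1,2)])
      finally show ?thesis .
    qed
    have nonneg: "0 \<le> (LINT x:K|lebesgue. \<bar>\<phi> n x - \<psi> n x\<bar>)" for n
      unfolding set_lebesgue_integral_def by (rule Bochner_Integration.integral_nonneg) simp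
    have "(\<lambda>n. (LINT x:K|lebesgue. \<bar>\<phi> n x - v x\<bar>) + (LINT x:K|lebesgue. \<bar>\<psi> n x - v x\<bar>)) \<longlonglongrightarrow> 0 + 0"
      by (intro tendsto_intros lim)
    then have "(\<lambda>n. (LINT x:K|lebesgue. \<bar>\<phi> n x - v x\<bar>) + (LINT x:K|lebesgue. \<bar>\<psi> n x - v x\<bar>)) \<longlonglongrightarrow> 0"
      by simp
    then show "(\<lambda>n. LINT x:K|lebesgue. \<bar>\<phi> n x - \<psi> n x\<bar>) \<longlonglongrightarrow> 0"
      by (rule Lim_null_comparison[rotated]) (intro always_eventually allI, simp only: real_norm_def abs_of_nonneg[OF nonneg] bound)
  qed
  then show ?thesis by (simp add: wgrad_diff \<phi> \<psi>)
qed

text \<open>Any two representing sequences differ by one that tends to zero in energy, so the limit of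
  the norms does not depend on the choice.\<close>

lemma completion_norm_eq:
  assumes rep: "represents \<rho> \<Omega> \<phi> v" and lim: "(\<lambda>n. l2 lborel (wgrad (\<phi> n))) \<longlonglongrightarrow> l"
  shows "completion_norm \<rho> \<Omega> v = l"
  unfolding completion_norm_def
proof (rule the_equality)
  have \<phi>: "\<phi> n \<in> test_functions \<Omega>" for n using rep by (simp add: represents_def)
  show "\<exists>\<phi>. represents \<rho> \<Omega> \<phi> v \<and> (\<lambda>n. dirichlet_norm \<rho> \<Omega> (\<phi> n)) \<longlonglongrightarrow> l"
    using rep lim by (intro exI[of _ \<phi>]) (simp add: dirichlet_norm_eq_l2 \<phi>)
  fix l' assume "\<exists>\<phi>. represents \<rho> \<Omega> \<phi> v \<and> (\<lambda>n. dirichlet_norm \<rho> \<Omega> (\<phi> n)) \<longlonglongrightarrow> l'"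
  then obtain \<psi> where \<psi>v: "represents \<rho> \<Omega> \<psi> v" and l': "(\<lambda>n. dirichlet_norm \<rho> \<Omega> (\<psi> n)) \<longlonglongrightarrow> l'" by blast
  have \<psi>: "\<psi> n \<in> test_functions \<Omega>" for n using \<psi>v by (simp add: represents_def)
  have "(\<lambda>n. l2 lborel (wgrad (\<psi> n))) \<longlonglongrightarrow> l"
    by (rule l2_limit_transfer[OF lim represents_unique[OF rep \<psi>v]]) (auto intro: sq_integrable_wgrad \<phi> \<psi>)
  with l' show "l' = l" by (simp add: dirichlet_norm_eq_l2 \<psi> LIMSEQ_unique)
qed

section \<open>The completion in terms of profiles\<close>

text \<open>In a given dimension, the right-hand sides depend on the weight only through \<open>\<kappa>\<close>.\<close>

lemma completion_iff_approximates:
  assumes prof: "AE x in lebesgue. x \<in> \<Omega> - {0} \<longrightarrow> v x = u (\<sigma> (norm x))"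
  shows "v \<in> completion \<rho> \<Omega> \<longleftrightarrow> (\<exists>U P. approximates u U P)"
    and "approximates u U P \<Longrightarrow> (completion_norm \<rho> \<Omega> v)\<^sup>2
    = \<kappa> * (measure lborel (shell :: 'a set) / polar_factor DIM('a) * (lim (\<lambda>n. l2 lborel (P n)))\<^sup>2)"
proof -
  have ex: "\<exists>\<phi> V Q. (\<forall>n. radial_test (\<phi> n) (V n) (Q n)) \<and> (\<lambda>n. l2 lborel (\<lambda>s. P n s - Q n s)) \<longlonglongrightarrow> 0 \<and> represents \<rho> \<Omega> \<phi> v"
    if app: "approximates u U P" for U P
  proof -
    obtain \<phi> V Q where t: "\<And>n. radial_test (\<phi> n) (V n) (Q n)" and d: "(\<lambda>n. l2 lborel (\<lambda>s. P n s - Q n s)) \<longlonglongrightarrow> 0"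
      using approximates_radial_test[OF app] by blast
    have "approximates u V Q"
      by (rule approximates_perturb[OF app _ d]) (use t in \<open>auto simp: radial_test_def\<close>)
    from radial_test_represents[OF this t prof] t d show ?thesis by blast
  qed
  show "v \<in> completion \<rho> \<Omega> \<longleftrightarrow> (\<exists>U P. approximates u U P)"
  proof
    assume "v \<in> completion \<rho> \<Omega>"
    then obtain \<phi> where "represents \<rho> \<Omega> \<phi> v" by (auto simp: completion_def)
    from represents_imp_approximates[OF this prof] show "\<exists>U P. approximates u U P" by blast
  next
    assume "\<exists>U P. approximates u U P"
    then obtain U P where "approximates u U P" by blast
    from ex[OF this] show "v \<in> completion \<rho> \<Omega>" unfolding completion_def by blast
  qed
  assume app: "approximates u U P"
  then obtain \<phi> V Q where t: "\<And>n. radial_test (\<phi> n) (V n) (Q n)"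
    and d: "(\<lambda>n. l2 lborel (\<lambda>s. P n s - Q n s)) \<longlonglongrightarrow> 0" and rep: "represents \<rho> \<Omega> \<phi> v"
    using ex by blast
  have sq: "sq_integrable lborel (P n)" "sq_integrable lborel (Q n)" for n
    using app t by (auto simp: approximates_def radial_test_def intro: admissible_sq_integrable)
  define l where "l = lim (\<lambda>n. l2 lborel (P n))"
  have "(\<lambda>n. l2 lborel (P n)) \<longlonglongrightarrow> l"
    using l2_Cauchy_convergent[OF _ sq(1)] app by (simp add: l_def approximates_def convergent_LIMSEQ_iff)
  from l2_limit_transfer[OF this d sq] have "(\<lambda>n. l2 lborel (Q n)) \<longlonglongrightarrow> l" .
  then have "(\<lambda>n. l2 lborel (Q n) / sqrt mean_const) \<longlonglongrightarrow> l / sqrt mean_const"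
    using mean_const_pos by (intro tendsto_intros) auto
  then have "(\<lambda>n. l2 lborel (wgrad (\<phi> n))) \<longlonglongrightarrow> l / sqrt mean_const"
    using mean_const_pos by (simp add: radial_test_energy[OF t])
  from completion_norm_eq[OF rep this] have "(completion_norm \<rho> \<Omega> v)\<^sup>2 = l\<^sup>2 / mean_const"
    using mean_const_pos by (simp add: power_divide)
  then show "(completion_norm \<rho> \<Omega> v)\<^sup>2
      = \<kappa> * (measure lborel (shell :: 'a set) / polar_factor DIM('a) * (lim (\<lambda>n. l2 lborel (P n)))\<^sup>2)"
    by (simp add: l_def mean_const_def)
qed

end

section \<open>The two weights\<close>

text \<open>In polar coordinates \<open>r\<^sup>N\<^sup>-\<^sup>1 r\<^sup>2\<^sup>-\<^sup>N = r\<close>.\<close>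

lemma set_integrable_norm_powr:
  fixes K :: "'a::euclidean_space set"
  assumes "DIM('a) \<ge> 2" "compact K"
  shows "set_integrable lborel K (\<lambda>x. norm x powr (- (real DIM('a) - 2)))"
proof -
  obtain M where M: "M \<ge> 0" "\<And>x. x \<in> K \<Longrightarrow> norm x \<le> M"
    using compact_imp_bounded[OF assms(2)] by (metis bounded_pos less_imp_le)
  have [measurable]: "K \<in> sets borel" using assms(2) by (simp add: compact_imp_closed borel_closed)
  define h where "h x = indicator K x * norm x powr (- (real DIM('a) - 2))" for x :: 'a
  have [measurable]: "h \<in> borel_measurable borel" unfolding h_def by measurable
  have "ennreal (polar_factor DIM('a)) * (\<integral>\<^sup>+x. ennreal (h x) \<partial>lborel)
      = (\<integral>\<^sup>+t. \<integral>\<^sup>+y. indicator {0<..} t * indicator (shell :: 'a set) y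
            * ennreal (t ^ (DIM('a) - 1)) * ennreal (h (t *\<^sub>R sgn y)) \<partial>lborel \<partial>lborel)"
    by (subst nn_integral_polar) (auto simp: polar_const_eq)
  also have "\<dots> \<le> (\<integral>\<^sup>+t. \<integral>\<^sup>+y. (indicator {0..M} t * ennreal M) * indicator (shell :: 'a set) y \<partial>lborel \<partial>lborel)"
  proof (intro nn_integral_mono)
    fix t :: real and y :: 'a
    show "indicator {0<..} t * indicator shell y * ennreal (t ^ (DIM('a) - 1)) * ennreal (h (t *\<^sub>R sgn y))
       \<le> (indicator {0..M} t * ennreal M) * indicator shell y"
    proof (cases "t > 0 \<and> y \<in> shell \<and> t *\<^sub>R sgn y \<in> K")
      case True
      then have n: "norm (t *\<^sub>R sgn y) = t" by (auto simp: shell_def norm_sgn)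
      then have tM: "t \<le> M" using M(2)[of "t *\<^sub>R sgn y"] True by simp
      have "t ^ (DIM('a) - 1) * t powr (- (real DIM('a) - 2)) = t powr (real (DIM('a) - 1)) * t powr (- (real DIM('a) - 2))"
        by (subst powr_realpow) (use True in auto)
      also have "\<dots> = t powr (real (DIM('a) - 1) + - (real DIM('a) - 2))"
        by (rule powr_add[symmetric])
      also have "real (DIM('a) - 1) + - (real DIM('a) - 2) = 1"
        using assms(1) by (simp add: of_nat_diff)
      finally have "t ^ (DIM('a) - 1) * h (t *\<^sub>R sgn y) = t"
        using True n by (simp add: h_def)
      then have "ennreal (t ^ (DIM('a) - 1)) * ennreal (h (t *\<^sub>R sgn y)) = ennreal t"
        using True by (subst ennreal_mult[symmetric]) (auto simp: h_def)
      then show ?thesis using True tM by (auto simp: ennreal_leI)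
    qed (auto simp: h_def split: split_indicator)
  qed
  also have "\<dots> = (\<integral>\<^sup>+t. (ennreal M * ennreal (measure lborel (shell :: 'a set))) * indicator {0..M} t \<partial>lborel)"
    by (intro nn_integral_cong) (auto simp: nn_integral_cmult_indicator emeasure_shell mult_ac split: split_indicator)
  also have "\<dots> = ennreal (M * measure lborel (shell :: 'a set) * M)"
    using M(1) by (simp add: nn_integral_cmult_indicator ennreal_mult)
  finally have "ennreal (polar_factor DIM('a)) * (\<integral>\<^sup>+x. ennreal (h x) \<partial>lborel) < \<infinity>"
    using le_less_trans by fastforce
  then have "(\<integral>\<^sup>+x. ennreal (h x) \<partial>lborel) < \<infinity>"
    using polar_factor_pos[of "DIM('a)"] by (auto simp: ennreal_mult_less_top)
  then have "integrable lborel h"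
    by (intro integrableI_nonneg) (auto simp: h_def)
  then show ?thesis by (simp add: set_integrable_def h_def[abs_def])
qed

lemma radial_weight_whole_space:
  assumes "DIM('a::euclidean_space) \<ge> 3"
  defines "m \<equiv> real DIM('a) - 2"
  shows "radial_weight (UNIV :: 'a set) (\<lambda>_. 1) (\<lambda>s. s powr (- (1 / m))) (\<lambda>s. - (1 / m) * s powr (- (1 / m) - 1)) (\<lambda>t. t powr (- m)) m"
proof
  have m: "m \<ge> 1" using assms by simp
  have inv: "(t powr (- m)) powr (- (1 / m)) = t" "(t powr (- (1 / m))) powr (- m) = t" if "t > 0" for t
    using m that by (simp_all add: powr_powr)
  have img: "(\<lambda>s. s powr (- (1 / m))) ` {0<..} = {0<..}"
  proof
    show "{0<..} \<subseteq> (\<lambda>s. s powr (- (1 / m))) ` {0<..}"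
    proof
      fix t :: real assume "t \<in> {0<..}"
      then show "t \<in> (\<lambda>s. s powr (- (1 / m))) ` {0<..}"
        by (intro image_eqI[of _ _ "t powr (- m)"]) (auto simp: inv)
    qed
  qed auto
  show "x \<in> UNIV \<longleftrightarrow> norm x \<in> (\<lambda>s. s powr (- (1 / m))) ` {0<..}" if "x \<noteq> 0" for x :: 'a
    using that unfolding img by simp
  show "((\<lambda>s. s powr (- (1 / m))) has_real_derivative - (1 / m) * s powr (- (1 / m) - 1)) (at s)" if "s > 0" for s
    using that by (auto intro!: derivative_eq_intros)
  show "- (1 / m) * s powr (- (1 / m) - 1) < 0" if "s > 0" for s
    using m that by simp
  show "continuous_on {0<..} (\<lambda>s. - (1 / m) * s powr (- (1 / m) - 1))"
    by (intro continuous_intros) auto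
  show "(s powr (- (1 / m))) powr (- m) = s" if "s > 0" for s by (rule inv(2)[OF that])
  show "continuous_on ((\<lambda>s. s powr (- (1 / m))) ` {0<..}) (\<lambda>t. t powr (- m))"
    unfolding img by (intro continuous_intros) auto
  show "m > 0" using m by simp
  show "1 * (s powr (- (1 / m))) ^ (DIM('a) - 1) = - m * (- (1 / m) * s powr (- (1 / m) - 1))" if s: "s > 0" for s
  proof -
    have e: "real (DIM('a) - 1) = m + 1" using assms by (simp add: m_def of_nat_diff)
    have "(s powr (- (1 / m))) ^ (DIM('a) - 1) = (s powr (- (1 / m))) powr (m + 1)"
      unfolding e[symmetric] by (subst powr_realpow) (use s in auto)
    also have "\<dots> = s powr (- (1 / m) * (m + 1))" by (rule powr_powr)
    also have "- (1 / m) * (m + 1) = - (1 / m) - 1" using m by (simp add: field_simps)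
    finally show ?thesis using m by simp
  qed
  show "set_integrable lborel K (\<lambda>x::'a. 1 :: real)" if "compact K" for K
    unfolding set_integrable_def by (rule borel_integrable_compact[OF that]) simp
  show "set_integrable lborel K (\<lambda>x::'a. norm x powr (- m))" if "compact K" for K
    unfolding m_def by (rule set_integrable_norm_powr[OF _ that]) (use assms in simp)
  show "\<exists>\<rho>' :: nat \<Rightarrow> 'a \<Rightarrow> real. (\<forall>k. C_k 1 (\<rho>' k)) \<and> (\<forall>k x. x \<in> UNIV - {0} \<longrightarrow> 0 \<le> \<rho>' k x \<and> \<rho>' k x \<le> 1) \<and> (\<forall>x\<in>UNIV - {0}. (\<lambda>k. \<rho>' k x) \<longlonglongrightarrow> 1)"
    by (rule exI[of _ "\<lambda>_ _. 1"]) (use C_k_const[of 1 "1::real"] in auto)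
qed (use assms in auto)

text \<open>The weight \<open>|x|\<^sup>2\<^sup>-\<^sup>N\<close> is regularised to \<open>(|x|\<^sup>2 + 1/(k + 1))\<close> to the power \<open>(2 - N)/2\<close>.\<close>

lemma H_weight_approximation:
  assumes "DIM('a::euclidean_space) \<ge> 2"
  shows "\<exists>\<rho>' :: nat \<Rightarrow> 'a \<Rightarrow> real. (\<forall>k. C_k 1 (\<rho>' k)) \<and> (\<forall>k x. x \<noteq> 0 \<longrightarrow> 0 \<le> \<rho>' k x \<and> \<rho>' k x \<le> H_weight x)
     \<and> (\<forall>x. x \<noteq> 0 \<longrightarrow> (\<lambda>k. \<rho>' k x) \<longlonglongrightarrow> H_weight x)"
proof -
  define m where "m = (real DIM('a) - 2) / 2"
  have m: "m \<ge> 0" using assms by (simp add: m_def)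
  define \<rho>' :: "nat \<Rightarrow> 'a \<Rightarrow> real" where "\<rho>' k x = (x \<bullet> x + 1 / real (Suc k)) powr (- m)" for k x
  have pos: "x \<bullet> x + 1 / real (Suc k) > 0" for x :: 'a and k
    by (rule add_nonneg_pos) auto
  have nz: "x \<bullet> x + 1 / real (Suc k) \<noteq> 0" for x :: 'a and k
    using pos[of x k] by simp
  have H: "H_weight x = (x \<bullet> x) powr (- m)" if "x \<noteq> 0" for x :: 'a
  proof -
    have "x \<bullet> x = norm x powr 2" using that by (simp add: power2_norm_eq_inner[symmetric])
    moreover have "(norm x powr 2) powr (- m) = norm x powr (- (real DIM('a) - 2))"
      unfolding powr_powr by (rule arg_cong[where f = "\<lambda>a. norm x powr a"]) (simp add: m_def field_simps)
    ultimately show ?thesis by (simp only: H_weight_def)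
  qed
  have "C_k 1 (\<rho>' k)" for k
  proof -
    have "((\<lambda>z. (z + 1 / real (Suc k)) powr (- m)) has_real_derivative (- m * (x \<bullet> x + 1 / real (Suc k)) powr (- m - 1))) (at (x \<bullet> x))" for x :: 'a
      using pos[of x k] by (auto intro!: derivative_eq_intros)
    from GDERIV_radial[OF this]
    have G: "GDERIV (\<rho>' k) x :> (2 * (- m * (x \<bullet> x + 1 / real (Suc k)) powr (- m - 1))) *\<^sub>R x" for x
      unfolding \<rho>'_def[abs_def] .
    have "C_k (Suc 0) (\<rho>' k)"
    proof (rule C_k_SucI[OF G])
      fix b :: 'a
      have "continuous_on UNIV (\<lambda>x::'a. ((2 * (- m * (x \<bullet> x + 1 / real (Suc k)) powr (- m - 1))) *\<^sub>R x) \<bullet> b)"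
        using nz by (intro continuous_intros) blast
      then show "C_k 0 (\<lambda>x. ((2 * (- m * (x \<bullet> x + 1 / real (Suc k)) powr (- m - 1))) *\<^sub>R x) \<bullet> b)" by simp
    qed
    then show ?thesis by simp
  qed
  moreover have "0 \<le> \<rho>' k x \<and> \<rho>' k x \<le> H_weight x" if "x \<noteq> 0" for k x
  proof -
    have "(x \<bullet> x + 1 / real (Suc k)) powr (- m) \<le> (x \<bullet> x) powr (- m)"
      by (rule powr_mono2') (use m that in auto)
    then show ?thesis by (simp add: H[OF that] \<rho>'_def)
  qed
  moreover have "(\<lambda>k. \<rho>' k x) \<longlonglongrightarrow> H_weight x" if "x \<noteq> 0" for x
  proof -
    have "(\<lambda>k. x \<bullet> x + 1 / real (Suc k)) \<longlonglongrightarrow> x \<bullet> x + 0"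
      by (intro tendsto_intros LIMSEQ_Suc[OF lim_1_over_n])
    from tendsto_powr[OF this tendsto_const, of "- m"] show ?thesis
      using that by (simp add: H[OF that] \<rho>'_def)
  qed
  ultimately show ?thesis by blast
qed

text \<open>Near the origin the logarithm is dominated by \<open>R/|x|\<close> and so, up to a constant, by the weight itself.\<close>

lemma radial_weight_ball:
  assumes dim: "DIM('a::euclidean_space) \<ge> 3" and R: "R > 0"
  shows "radial_weight (ball 0 R :: 'a set) H_weight (\<lambda>s. R * exp (- s)) (\<lambda>s. - R * exp (- s)) (\<lambda>t. - ln (t / R)) 1"
proof
  have img: "(\<lambda>s. R * exp (- s)) ` {0<..} = {0<..<R}"
  proof
    show "{0<..<R} \<subseteq> (\<lambda>s. R * exp (- s)) ` {0<..}"
    proof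
      fix t assume t: "t \<in> {0<..<R}"
      then show "t \<in> (\<lambda>s. R * exp (- s)) ` {0<..}"
        using R by (intro image_eqI[of _ _ "- ln (t / R)"]) (auto simp: ln_less_zero)
    qed
  qed (use R in auto)
  show "x \<in> ball 0 R \<longleftrightarrow> norm x \<in> (\<lambda>s. R * exp (- s)) ` {0<..}" if "x \<noteq> 0" for x :: 'a
    using that unfolding img by simp
  show "((\<lambda>s. R * exp (- s)) has_real_derivative - R * exp (- s)) (at s)" for s
    by (auto intro!: derivative_eq_intros)
  show "continuous_on {0<..} (\<lambda>s. - R * exp (- s))"
    by (intro continuous_intros)
  show "continuous_on ((\<lambda>s. R * exp (- s)) ` {0<..}) (\<lambda>t. - ln (t / R))"
    unfolding img using R by (intro continuous_intros) auto
  show "- ln (R * exp (- s) / R) = s" for s using R by simp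
  show "H_weight x * (R * exp (- s)) ^ (DIM('a) - 1) = - 1 * (- R * exp (- s))" if "norm x = R * exp (- s)" for s and x :: 'a
  proof -
    define t where "t = R * exp (- s)"
    have t: "t > 0" using R by (simp add: t_def)
    have "H_weight x * t ^ (DIM('a) - 1) = t powr (- (real DIM('a) - 2)) * t powr (real (DIM('a) - 1))"
      unfolding H_weight_def that t_def[symmetric] by (subst powr_realpow[OF t]) rule
    also have "\<dots> = t powr (- (real DIM('a) - 2) + real (DIM('a) - 1))" by (rule powr_add[symmetric])
    also have "- (real DIM('a) - 2) + real (DIM('a) - 1) = 1" using dim by (simp add: of_nat_diff)
    finally show ?thesis using t by (simp add: t_def)
  qed
  show "(H_weight :: 'a \<Rightarrow> real) \<in> borel_measurable borel"
    unfolding H_weight_def[abs_def] by measurable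
  show H_int: "set_integrable lborel K (H_weight :: 'a \<Rightarrow> real)" if "compact K" for K
    unfolding H_weight_def[abs_def] by (rule set_integrable_norm_powr[OF _ that]) (use dim in simp)
  show "set_integrable lborel K (\<lambda>x::'a. - ln (norm x / R))" if K: "compact K" "K \<subseteq> ball 0 R" for K
  proof -
    \<comment> \<open>from \<open>t < R\<close>: \<open>R / t = R t\<^sup>N\<^sup>-\<^sup>3 t\<^sup>2\<^sup>-\<^sup>N\<close> is at most \<open>R R\<^sup>N\<^sup>-\<^sup>3 t\<^sup>2\<^sup>-\<^sup>N\<close>\<close>
    define c where "c = R * R powr (real DIM('a) - 3)"
    have [measurable]: "K \<in> sets borel" by (rule borel_compact[OF K(1)])
    have "integrable lborel (\<lambda>x::'a. c * (indicator K x *\<^sub>R H_weight x))"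
      using H_int[OF K(1)] unfolding set_integrable_def by simp
    then show ?thesis
      unfolding set_integrable_def
    proof (rule Bochner_Integration.integrable_bound)
      show "AE x in lborel. norm (indicator K x *\<^sub>R - ln (norm x / R)) \<le> norm (c * (indicator K x *\<^sub>R H_weight x))"
      proof (rule eventually_mono[OF AE_lborel_singleton[of "0::'a"]])
        fix x :: 'a assume x: "x \<noteq> 0"
        show "norm (indicator K x *\<^sub>R - ln (norm x / R)) \<le> norm (c * (indicator K x *\<^sub>R H_weight x))"
        proof (cases "x \<in> K")
          case True
          define t where "t = norm x"
          have t: "0 < t" "t < R" using x True K(2) by (auto simp: t_def)
          have "ln (R / t) \<le> R / t - 1" using t R by (intro ln_le_minus_one) auto
          also have "\<dots> \<le> R * t powr (- 1)" using t by (simp add: powr_minus_divide)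
          also have "t powr (- 1) = t powr (real DIM('a) - 3) * t powr (- (real DIM('a) - 2))"
            by (simp add: powr_add[symmetric])
          also have "\<dots> \<le> R powr (real DIM('a) - 3) * t powr (- (real DIM('a) - 2))"
            using t dim by (intro mult_right_mono powr_mono2) auto
          finally have 1: "ln (R / t) \<le> c * t powr (- (real DIM('a) - 2))"
            using R by (simp add: c_def mult.assoc)
          have "- ln (t / R) = ln (R / t)" using t R by (simp add: ln_div)
          moreover have "0 \<le> ln (R / t)" using t by simp
          ultimately have "\<bar>- ln (t / R)\<bar> \<le> c * t powr (- (real DIM('a) - 2))" using 1 by simp
          also have "\<dots> \<le> \<bar>c * t powr (- (real DIM('a) - 2))\<bar>" by simp
          finally show ?thesis using True by (simp add: H_weight_def t_def)
        qed simp
      qed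
    qed measurable
  qed
  show "\<exists>\<rho>' :: nat \<Rightarrow> 'a \<Rightarrow> real. (\<forall>k. C_k 1 (\<rho>' k)) \<and> (\<forall>k x. x \<in> ball 0 R - {0} \<longrightarrow> 0 \<le> \<rho>' k x \<and> \<rho>' k x \<le> H_weight x)
     \<and> (\<forall>x\<in>ball 0 R - {0}. (\<lambda>k. \<rho>' k x) \<longlonglongrightarrow> H_weight x)"
  proof -
    have "DIM('a) \<ge> 2" using dim by simp
    from H_weight_approximation[OF this] show ?thesis by blast
  qed
qed (use R in \<open>auto simp: H_weight_def\<close>)

theorem proposition4p1:
  fixes R :: real and v w :: "real ^ 'n \<Rightarrow> real" and f g :: "real \<Rightarrow> real"
  assumes "CARD('n) \<ge> 3" and "R > 0"
    and "has_profile_on (ball 0 R) v f"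
    and "has_profile_on UNIV w g"
    and "\<And>r. 0 < r \<Longrightarrow> r < R \<Longrightarrow>
           f r = g ((- ln (r / R)) powr (- (1 / (real CARD('n) - 2))))"
  shows "(v \<in> H_rad R \<longleftrightarrow> w \<in> D12_rad) \<and>
         (v \<in> H_rad R \<longrightarrow>
           (H_norm R v)\<^sup>2 = inverse (real CARD('n) - 2) * (D12_norm w)\<^sup>2)"
proof -
  define m where "m = real CARD('n) - 2"
  have m: "m \<ge> 1" using assms(1) by (simp add: m_def)
  have dim: "DIM(real ^ 'n) \<ge> 3" using assms(1) by simp
  \<comment> \<open>the common profile of \<open>v\<close> and \<open>w\<close> in the variable \<open>s\<close>\<close>
  define u where "u s = g (s powr (- (1 / m)))" for s
  interpret H: radial_weight "ball 0 R :: (real ^ 'n) set" H_weight "\<lambda>s. R * exp (- s)" "\<lambda>s. - R * exp (- s)" "\<lambda>t. - ln (t / R)" 1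
    by (rule radial_weight_ball[OF dim assms(2)])
  interpret D: radial_weight "UNIV :: (real ^ 'n) set" "\<lambda>_. 1" "\<lambda>s. s powr (- (1 / m))" "\<lambda>s. - (1 / m) * s powr (- (1 / m) - 1)" "\<lambda>t. t powr (- m)" m
    using radial_weight_whole_space[OF dim] by (simp add: m_def)
  have prof_v: "AE x in lebesgue. x \<in> ball 0 R - {0} \<longrightarrow> v x = u (- ln (norm x / R))"
    using assms(3) unfolding has_profile_on_def
    by eventually_elim (use assms(5) in \<open>auto simp: u_def m_def\<close>)
  have prof_w: "AE x in lebesgue. x \<in> UNIV - {0} \<longrightarrow> w x = u (norm x powr (- m))"
    using assms(4) unfolding has_profile_on_def
    by eventually_elim (use m in \<open>auto simp: u_def powr_powr\<close>)
  have "radial_on (ball 0 R) v" "radial_on UNIV w"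
    using assms(3,4) by (auto simp: radial_on_def)
  then have v_iff: "v \<in> H_rad R \<longleftrightarrow> (\<exists>U P. approximates u U P)"
    and w_iff: "w \<in> D12_rad \<longleftrightarrow> (\<exists>U P. approximates u U P)"
    using H.completion_iff_approximates(1)[OF prof_v] D.completion_iff_approximates(1)[OF prof_w]
    by (auto simp: H_rad_def D12_rad_def)
  have "(H_norm R v)\<^sup>2 = inverse (real CARD('n) - 2) * (D12_norm w)\<^sup>2" if "v \<in> H_rad R"
  proof -
    from that v_iff obtain U P where "approximates u U P" by blast
    from H.completion_iff_approximates(2)[OF prof_v this] D.completion_iff_approximates(2)[OF prof_w this]
    show ?thesis
      using m by (simp add: H_norm_def D12_norm_def m_def)
  qed
  with v_iff w_iff show ?thesis by blast
qed

end
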